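(* Let $G=G_1\ast_A G_2$ be an amalgam of finite groups. There exists an algorithm which, given finitely many subgroup generators $h_1,\ldots,h_k\in G$ and a normal word $g\in G$, decides whether or not some nontrivial power of $g$ (that is, an element $g^n$ with $n\ge1$ and $g^n\neq1$ in $G$) belongs to the subgroup $H=\langle h_1,\ldots,h_k\rangle$.
   Context: $G=G_1\ast_A G_2$ is a free product with amalgamation, where $G_1=\langle X_1\mid R_1\rangle$ and $G_2=\langle X_2\mid R_2\rangle$ are finite groups given by finite presentations with $X_1^{\pm}\cap X_2^{\pm}=\emptyset$, $A$ is a group generated by $Y$ with monomorphisms $\phi_i:A\to G_i$ ($i=1,2$), and $G=\langle X_1\cup X_2\mid R_1,R_2,\ \phi_1(a)=\phi_2(a)\ (a\in Y)\rangle$. The amalgam (the finite groups $G_1,G_2,A$, their presentations, the monomorphisms) is fixed and known to the algorithm. Elements of $G$ are input as words in the letters $X^{\pm}$, where $X=X_1\cup X_2$. A word over $X^{\pm}$ is normal if it has a decomposition $g_1g_2\cdots g_n$ where each $g_j$ is a word over $X_1^{\pm}$ or over $X_2^{\pm}$ with $g_j\ne_G1$, consecutive $g_j,g_{j+1}$ are in different factors, and if $n\neq1$ then no $g_j$ lies in $A$. *)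

theory Defs
  imports "HOL-Algebra.Generated_Groups" "HOL-Library.Nat_Bijection"
begin

section \<open>Group presentations\<close>

text \<open>
  The letter \<open>(x, True)\<close> stands for the generator \<open>x\<close> and \<open>(x, False)\<close> for its formal
  inverse, so that disjointness of the signed alphabets amounts to \<open>X1 \<inter> X2 = {}\<close>.
\<close>

type_synonym 'x word = "('x \<times> bool) list"

definition words :: "'x set \<Rightarrow> 'x word set" where
  "words X = lists (X \<times> UNIV)"

definition inv_word :: "'x word \<Rightarrow> 'x word" where
  "inv_word w = rev (map (\<lambda>(x, b). (x, \<not> b)) w)"

inductive pres_eq :: "'x set \<Rightarrow> 'x word set \<Rightarrow> 'x word \<Rightarrow> 'x word \<Rightarrow> bool"
  for X :: "'x set" and R :: "'x word set" where
  refl: "w \<in> words X \<Longrightarrow> pres_eq X R w w"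
| sym: "pres_eq X R v w \<Longrightarrow> pres_eq X R w v"
| trans: "pres_eq X R u v \<Longrightarrow> pres_eq X R v w \<Longrightarrow> pres_eq X R u w"
| cancel: "u \<in> words X \<Longrightarrow> v \<in> words X \<Longrightarrow> x \<in> X \<Longrightarrow>
    pres_eq X R (u @ [(x, b), (x, \<not> b)] @ v) (u @ v)"
| relator: "u \<in> words X \<Longrightarrow> v \<in> words X \<Longrightarrow> r \<in> R \<Longrightarrow> r \<in> words X \<Longrightarrow>
    pres_eq X R (u @ r @ v) (u @ v)"

definition pres_rel :: "'x set \<Rightarrow> 'x word set \<Rightarrow> ('x word \<times> 'x word) set" where
  "pres_rel X R = {(v, w). pres_eq X R v w}"

definition word_class :: "'x set \<Rightarrow> 'x word set \<Rightarrow> 'x word \<Rightarrow> 'x word set" where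
  "word_class X R w = pres_rel X R `` {w}"

definition presented_group :: "'x set \<Rightarrow> 'x word set \<Rightarrow> 'x word set monoid" where
  "presented_group X R =
    \<lparr>carrier = words X // pres_rel X R,
     monoid.mult = (\<lambda>U V. \<Union>u\<in>U. \<Union>v\<in>V. word_class X R (u @ v)),
     one = word_class X R []\<rparr>"

lemma words_append [simp]: "u @ v \<in> words X \<longleftrightarrow> u \<in> words X \<and> v \<in> words X"
  by (auto simp: words_def)

lemma words_Nil [simp]: "[] \<in> words X"
  by (simp add: words_def)

lemma inv_word_in_words [simp]: "w \<in> words X \<Longrightarrow> inv_word w \<in> words X"
  by (auto simp: words_def inv_word_def)

lemma pres_eq_in_words:
  assumes "pres_eq X R v w"
  shows "v \<in> words X \<and> w \<in> words X"
  using assms by induction (auto simp: words_def)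

lemma equiv_pres_rel: "equiv (words X) (pres_rel X R)"
proof (rule equivI)
  show "pres_rel X R \<subseteq> words X \<times> words X"
    by (auto simp: pres_rel_def dest: pres_eq_in_words)
  show "refl_on (words X) (pres_rel X R)"
    by (auto simp: refl_on_def pres_rel_def intro: pres_eq.refl)
  show "Relation.sym (pres_rel X R)"
    unfolding sym_def pres_rel_def using pres_eq.sym by blast
  show "Relation.trans (pres_rel X R)"
    unfolding trans_def pres_rel_def using pres_eq.trans by blast
qed

lemma pres_eq_context:
  assumes "pres_eq X R v w" "a \<in> words X" "b \<in> words X"
  shows "pres_eq X R (a @ v @ b) (a @ w @ b)"
  using assms
proof induction
  case (cancel u v x c)
  then show ?case using pres_eq.cancel[of "a @ u" X "v @ b" x R c] by simp
next
  case (relator u v r)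
  then show ?case using pres_eq.relator[of "a @ u" X "v @ b" r R] by simp
next
  case (sym v w)
  then show ?case using pres_eq.sym by blast
next
  case (trans u v w)
  then show ?case using pres_eq.trans[of X R "a @ u @ b" "a @ v @ b" "a @ w @ b"] by blast
qed (simp add: pres_eq.refl)

lemma pres_eq_append:
  assumes "pres_eq X R v v'" "pres_eq X R w w'"
  shows "pres_eq X R (v @ w) (v' @ w')"
proof (rule pres_eq.trans)
  show "pres_eq X R (v @ w) (v' @ w)"
    using pres_eq_context[OF assms(1), of "[]" w] pres_eq_in_words[OF assms(2)] by simp
  show "pres_eq X R (v' @ w) (v' @ w')"
    using pres_eq_context[OF assms(2), of v' "[]"] pres_eq_in_words[OF assms(1)] by simp
qed

lemma word_class_eq_iff:
  "v \<in> words X \<Longrightarrow> w \<in> words X \<Longrightarrow> word_class X R v = word_class X R w \<longleftrightarrow> pres_eq X R v w"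
  using eq_equiv_class_iff[OF equiv_pres_rel, of v X w R]
  by (simp add: word_class_def pres_rel_def)

lemma mult_presented_group:
  assumes "v \<in> words X" "w \<in> words X"
  shows "word_class X R v \<otimes>\<^bsub>presented_group X R\<^esub> word_class X R w = word_class X R (v @ w)"
proof -
  have "word_class X R (a @ b) = word_class X R (v @ w)"
    if "a \<in> word_class X R v" "b \<in> word_class X R w" for a b
  proof -
    have "pres_eq X R v a" "pres_eq X R w b"
      using that by (auto simp: word_class_def pres_rel_def)
    then have "pres_eq X R (v @ w) (a @ b)" by (rule pres_eq_append)
    moreover from this have "v @ w \<in> words X" "a @ b \<in> words X"
      using pres_eq_in_words by blast+
    ultimately show ?thesis by (metis word_class_eq_iff)
  qed
  moreover have "word_class X R v \<noteq> {}" "word_class X R w \<noteq> {}"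
    using assms pres_eq.refl[of v X R] pres_eq.refl[of w X R]
    by (auto simp: word_class_def pres_rel_def)
  ultimately have "(\<Union>a\<in>word_class X R v. \<Union>b\<in>word_class X R w. word_class X R (a @ b))
      = word_class X R (v @ w)"
    by simp
  then show ?thesis by (simp add: presented_group_def)
qed

lemma carrier_presented_group:
  "carrier (presented_group X R) = word_class X R ` words X"
  by (auto simp: presented_group_def word_class_def quotient_def)

lemma pres_eq_inv_word:
  "w \<in> words X \<Longrightarrow> pres_eq X R (inv_word w @ w) []"
proof (induction w)
  case Nil
  then show ?case by (simp add: inv_word_def pres_eq.refl)
next
  case (Cons l w)
  obtain x b where l: "l = (x, b)" by (cases l)
  have w: "w \<in> words X" "x \<in> X" using Cons.prems l by (auto simp: words_def)
  have "pres_eq X R (inv_word w @ [(x, \<not> b), (x, \<not> \<not> b)] @ w) (inv_word w @ w)"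
    by (rule pres_eq.cancel) (use w in auto)
  then have "pres_eq X R (inv_word (l # w) @ (l # w)) (inv_word w @ w)"
    by (simp add: inv_word_def l)
  then show ?case using Cons.IH[OF w(1)] by (rule pres_eq.trans)
qed

lemma one_presented_group: "\<one>\<^bsub>presented_group X R\<^esub> = word_class X R []"
  by (simp add: presented_group_def)

lemma group_presented_group: "Group.group (presented_group X R)"
proof -
  let ?G = "presented_group X R"
  note rules = one_presented_group carrier_presented_group mult_presented_group
  show ?thesis
  proof (rule groupI)
    fix U assume "U \<in> carrier ?G"
    then obtain u where u: "u \<in> words X" "U = word_class X R u"
      unfolding carrier_presented_group by blast
    have "word_class X R (inv_word u @ u) = word_class X R []"
      using u(1) pres_eq_inv_word[OF u(1), of R] by (simp add: word_class_eq_iff)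
    then have "word_class X R (inv_word u) \<otimes>\<^bsub>?G\<^esub> U = \<one>\<^bsub>?G\<^esub>"
      using u by (simp add: rules)
    moreover have "word_class X R (inv_word u) \<in> carrier ?G"
      using u(1) by (simp add: rules)
    ultimately show "\<exists>V\<in>carrier ?G. V \<otimes>\<^bsub>?G\<^esub> U = \<one>\<^bsub>?G\<^esub>" by blast
  next
    show "\<one>\<^bsub>?G\<^esub> \<in> carrier ?G" by (simp add: rules)
  next
    fix U V assume "U \<in> carrier ?G" "V \<in> carrier ?G"
    then obtain u v where "u \<in> words X" "v \<in> words X" "U = word_class X R u" "V = word_class X R v"
      unfolding carrier_presented_group by blast
    then show "U \<otimes>\<^bsub>?G\<^esub> V \<in> carrier ?G" by (simp add: rules)
  next
    fix U V W assume "U \<in> carrier ?G" "V \<in> carrier ?G" "W \<in> carrier ?G"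
    then obtain u v w where "u \<in> words X" "v \<in> words X" "w \<in> words X"
      "U = word_class X R u" "V = word_class X R v" "W = word_class X R w"
      unfolding carrier_presented_group by blast
    then show "U \<otimes>\<^bsub>?G\<^esub> V \<otimes>\<^bsub>?G\<^esub> W = U \<otimes>\<^bsub>?G\<^esub> (V \<otimes>\<^bsub>?G\<^esub> W)" by (simp add: rules)
  next
    fix U assume "U \<in> carrier ?G"
    then obtain u where "u \<in> words X" "U = word_class X R u"
      unfolding carrier_presented_group by blast
    then show "\<one>\<^bsub>?G\<^esub> \<otimes>\<^bsub>?G\<^esub> U = U" by (simp add: rules)
  qed
qed

section \<open>Amalgams of finite groups\<close>

locale finite_amalgam =
  fixes X1 :: "'x set" and R1 :: "'x word set"
    and X2 :: "'x set" and R2 :: "'x word set"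
    and A :: "('a, 'm) monoid_scheme" and Y :: "'a set"
    and \<phi>1 \<phi>2 :: "'a \<Rightarrow> 'x word set"
  assumes finite_presentations: "finite X1" "finite X2" "finite R1" "finite R2"
    and relators: "R1 \<subseteq> words X1" "R2 \<subseteq> words X2"
    and disjoint_alphabets: "X1 \<inter> X2 = {}"
    and finite_factors:
      "finite (carrier (presented_group X1 R1))" "finite (carrier (presented_group X2 R2))"
    and group_A: "Group.group A"
    and generators_A: "Y \<subseteq> carrier A" "generate A Y = carrier A"
    and monomorphisms:
      "\<phi>1 \<in> mon A (presented_group X1 R1)" "\<phi>2 \<in> mon A (presented_group X2 R2)"

text \<open>
  An element \<open>\<phi>i a\<close> of a factor is a set of words. The relation \<open>\<phi>1 a = \<phi>2 a\<close> is imposed for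
  all words representing the two sides; modulo \<open>R1\<close> and \<open>R2\<close> the choice makes no difference.
\<close>

definition amalgam_relators ::
  "'x word set \<Rightarrow> 'x word set \<Rightarrow> 'a set \<Rightarrow> ('a \<Rightarrow> 'x word set) \<Rightarrow> ('a \<Rightarrow> 'x word set)
    \<Rightarrow> 'x word set" where
  "amalgam_relators R1 R2 Y \<phi>1 \<phi>2 =
    R1 \<union> R2 \<union> {u @ inv_word v | a u v. a \<in> Y \<and> u \<in> \<phi>1 a \<and> v \<in> \<phi>2 a}"

text \<open>
  The image of \<open>A\<close> in the group presented by \<open>X\<close> and \<open>R\<close>. In the amalgam, using \<open>\<phi>2\<close>
  instead of \<open>\<phi>1\<close> gives the same subgroup.
\<close>

definition amalgamated_subgroup ::
  "'x set \<Rightarrow> 'x word set \<Rightarrow> ('a, 'm) monoid_scheme \<Rightarrow> ('a \<Rightarrow> 'x word set) \<Rightarrow> 'x word set set" where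
  "amalgamated_subgroup X R A \<phi>1 = {word_class X R u | a u. a \<in> carrier A \<and> u \<in> \<phi>1 a}"

text \<open>
  Here \<open>R\<close> are the relators of the amalgam on the alphabet \<open>X1 \<union> X2\<close> and \<open>AG\<close> is the
  amalgamated subgroup. The empty decomposition is allowed, so the empty word is normal.
\<close>

definition normal_word ::
  "'x set \<Rightarrow> 'x set \<Rightarrow> 'x word set \<Rightarrow> 'x word set set \<Rightarrow> 'x word \<Rightarrow> bool" where
  "normal_word X1 X2 R AG w \<longleftrightarrow>
    (\<exists>gs. w = concat gs \<and>
      (\<forall>g\<in>set gs. (g \<in> words X1 \<or> g \<in> words X2) \<and>
         word_class (X1 \<union> X2) R g \<noteq> word_class (X1 \<union> X2) R []) \<and>
      (\<forall>j. Suc j < length gs \<longrightarrow>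
         gs ! j \<in> words X1 \<and> gs ! Suc j \<in> words X2 \<or>
         gs ! j \<in> words X2 \<and> gs ! Suc j \<in> words X1) \<and>
      (length gs \<noteq> 1 \<longrightarrow> (\<forall>g\<in>set gs. word_class (X1 \<union> X2) R g \<notin> AG)))"

section \<open>Algorithms\<close>

text \<open>
  Algorithms are Kleene's partial recursive functions, given by their defining terms;
  \<open>evals p xs y\<close> means that \<open>p\<close> halts on the argument list \<open>xs\<close> with output \<open>y\<close>.
  Terms applied to unsuitably many arguments may simply diverge.
\<close>

datatype recfun =
    Zero
  | Succ
  | Proj nat
  | Comp recfun "recfun list"
  | PrimRec recfun recfun
  | Minimize recfun

inductive evals :: "recfun \<Rightarrow> nat list \<Rightarrow> nat \<Rightarrow> bool" where
  zero: "evals Zero xs 0"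
| succ: "evals Succ [x] (Suc x)"
| proj: "i < length xs \<Longrightarrow> evals (Proj i) xs (xs ! i)"
| comp: "list_all2 (\<lambda>g y. evals g xs y) gs ys \<Longrightarrow> evals f ys z \<Longrightarrow> evals (Comp f gs) xs z"
| primrec_0: "evals f xs y \<Longrightarrow> evals (PrimRec f g) (0 # xs) y"
| primrec_Suc: "evals (PrimRec f g) (n # xs) y \<Longrightarrow> evals g (n # y # xs) z \<Longrightarrow>
    evals (PrimRec f g) (Suc n # xs) z"
| minimize: "evals f (n # xs) 0 \<Longrightarrow> (\<forall>m<n. \<exists>y. evals f (m # xs) (Suc y)) \<Longrightarrow>
    evals (Minimize f) xs n"

lemma evals_deterministic: "evals p xs y \<Longrightarrow> evals p xs z \<Longrightarrow> y = z"
proof (induction arbitrary: z rule: evals.induct)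
  case (comp xs gs ys f u)
  from comp.prems obtain ys' where ys': "list_all2 (\<lambda>g y. evals g xs y) gs ys'" "evals f ys' z"
    by (cases rule: evals.cases) auto
  have "ys = ys'"
    using comp.IH(1) ys'(1) by (auto simp: list_all2_conv_all_nth intro!: nth_equalityI)
  then show ?case using comp.IH(2) ys'(2) by blast
next
  case (minimize f n xs)
  from minimize.prems have z: "evals f (z # xs) 0" "\<forall>m<z. \<exists>y. evals f (m # xs) (Suc y)"
    by (cases rule: evals.cases; auto)+
  show ?case
  proof (rule linorder_cases[of n z])
    assume "n < z"
    then obtain y where "evals f (n # xs) (Suc y)" using z(2) by blast
    then have "0 = Suc y" using minimize.IH(1) by blast
    then show ?thesis by simp
  next
    assume "z < n"
    then obtain y where "\<forall>v. evals f (z # xs) v \<longrightarrow> Suc y = v" using minimize.IH by blast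
    then have "Suc y = 0" using z(1) by blast
    then show ?thesis by simp
  qed
next
  case (primrec_Suc f g n xs y u)
  from primrec_Suc.prems obtain y' where "evals (PrimRec f g) (n # xs) y'" "evals g (n # y' # xs) z"
    by (cases rule: evals.cases) auto
  then show ?case using primrec_Suc.IH by blast
next
  case (primrec_0 f xs y g)
  from primrec_0.prems have "evals f xs z" by (cases rule: evals.cases) auto
  then show ?case using primrec_0.IH by blast
qed (erule evals.cases; simp; fail)+

text \<open>Words are passed to algorithms via a numbering \<open>num\<close> of the generators.\<close>

definition word_code :: "('x \<Rightarrow> nat) \<Rightarrow> 'x word \<Rightarrow> nat" where
  "word_code num w = list_encode (map (\<lambda>(x, b). prod_encode (num x, of_bool b)) w)"

end

theory Submission
  imports Defs "HOL-Algebra.Multiplicative_Group"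
begin

text \<open>
  Write \<open>H\<close> for the subgroup generated by \<open>hs\<close>. It suffices to decide membership in finitely
  generated subgroups and to bound the exponents that have to be tried: the answer is yes iff some
  \<open>n \<ge> 1\<close> below the bound satisfies \<open>g\<^sup>n \<in> H\<close> but not \<open>g\<^sup>n \<in> {1}\<close>.

  \<^bold>\<open>The bound\<close> (\<open>exponent_bound\<close>). Every word is equal in \<open>G\<close> to some \<open>u c u\<^sup>-\<^sup>1\<close> where \<open>c\<close> has at
  most one syllable or is cyclically reduced (\<open>cyclic_reduction\<close>). In the first case the powers of
  \<open>g\<close> are periodic in the exponent. In the second case consider the coset \<open>q = H u\<close>. If \<open>g\<^sup>n \<in> H\<close>,
  then \<open>c\<^sup>n\<close> fixes \<open>q\<close> and is equal to a product of generators of \<open>H\<close> conjugated by \<open>u\<close>. Bringing this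
  product into reduced form only merges neighbouring syllables, so the reduced form runs through
  cosets which, up to right multiplication by \<open>A\<close>, were met already when reading \<open>u\<close> or a generator
  (\<open>run_stack_trace\<close>). As reduced forms are unique up to \<open>A\<close>, the cosets \<open>q, q c, \<dots>, q c\<^sup>n\<close>
  all belong to a finite set of explicitly bounded size, and the orbit of \<open>q\<close> under \<open>c\<close> must close up
  within that many steps (\<open>first_return_bound\<close>). Uniqueness of reduced forms is proved by van der
  Waerden's method: \<open>G\<close> acts on the set of normal forms (\<open>stacks_action\<close>). The same action shows that
  powers of cyclically reduced words are nontrivial.

  \<^bold>\<open>Membership.\<close> If \<open>w \<notin> H\<close>, then \<open>G\<close> acts on a finite set, of a size that is known in advance, such
  that some subset of known size is invariant under the generators of \<open>H\<close> but not under \<open>w\<close>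
  (\<open>separation\<close>). To see this, take the product of the coset space of \<open>H\<close> with a finite set \<open>P\<close> on which
  both factors act freely, and cut out the finite piece that is needed to read \<open>w\<close> and the
  generators. Enlarge the piece once to a finite union of orbits of \<open>G\<^sub>1\<close> and once to a finite union of
  orbits of \<open>G\<^sub>2\<close>, both of the same cardinality. These are free \<open>A\<close>-sets of equal size, so the identity of
  the piece extends to an \<open>A\<close>-equivariant bijection between them (\<open>extend_equivariant\<close>), along which
  the two actions are glued to an action of \<open>G\<close> (\<open>finite_completion\<close>).

  Hence \<open>w \<in> H\<close> holds iff every action of \<open>G\<close> on \<open>{0..<M}\<close> for a computable \<open>M\<close> in which the generators
  preserve \<open>{0..<q}\<close> also has \<open>w\<close> preserving \<open>{0..<q}\<close>. An action is a table of numbers and can be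
  coded by the digits of a single number below a computable bound (\<open>in_subgroup_test_correct\<close>), so the
  whole procedure consists of bounded quantifiers and primitive recursions.
\<close>

section \<open>Computable functions on lists of numbers\<close>

text \<open>
  Functions take their arguments as a list, so that nested binders become longer argument lists. The
  rules below are stated for open terms over such lists; together they let a function be shown
  computable by following the structure of the term that defines it.
\<close>

definition computable :: "nat \<Rightarrow> (nat list \<Rightarrow> nat) \<Rightarrow> bool" where
  "computable n f \<longleftrightarrow> (\<exists>p. \<forall>xs. length xs = n \<longrightarrow> evals p xs (f xs))"

abbreviation decidable :: "nat \<Rightarrow> (nat list \<Rightarrow> bool) \<Rightarrow> bool" where
  "decidable n P \<equiv> computable n (\<lambda>xs. of_bool (P xs))"

lemma computable_cong:
  "computable n f \<Longrightarrow> (\<And>xs. length xs = n \<Longrightarrow> f xs = g xs) \<Longrightarrow> computable n g"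
  unfolding computable_def by metis

lemma computable_var: "i < n \<Longrightarrow> computable n (\<lambda>xs. xs ! i)"
  unfolding computable_def using evals.proj by blast

lemma computable_Suc:
  assumes "computable n a"
  shows "computable n (\<lambda>xs. Suc (a xs))"
proof -
  obtain p where p: "\<And>xs. length xs = n \<Longrightarrow> evals p xs (a xs)"
    using assms unfolding computable_def by blast
  have "evals (Comp Succ [p]) xs (Suc (a xs))" if "length xs = n" for xs
    by (rule evals.comp[where ys = "[a xs]"]) (auto intro: p that evals.succ)
  then show ?thesis unfolding computable_def by blast
qed

lemma computable_const: "computable n (\<lambda>_. c)"
proof (induction c)
  case 0
  show ?case unfolding computable_def using evals.zero by blast
next
  case (Suc c)
  then show ?case by (rule computable_Suc)
qed

text \<open>
  Arguments can be dropped, permuted and duplicated.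
\<close>

lemma computable_select:
  assumes "computable (length is) f" "\<forall>i\<in>set is. i < n"
  shows "computable n (\<lambda>xs. f (map ((!) xs) is))"
proof -
  obtain p where p: "\<And>xs. length xs = length is \<Longrightarrow> evals p xs (f xs)"
    using assms(1) unfolding computable_def by blast
  have "evals (Comp p (map Proj is)) xs (f (map ((!) xs) is))" if "length xs = n" for xs
    by (rule evals.comp[where ys = "map ((!) xs) is"])
      (use that assms(2) in \<open>auto intro: p evals.proj simp: list_all2_conv_all_nth\<close>)
  then show ?thesis unfolding computable_def by blast
qed

text \<open>
  Weakening: under a binder, the enclosing arguments form the tail of the argument list.
\<close>

lemma computable_tl:
  assumes "computable n f"
  shows "computable (Suc n) (\<lambda>xs. f (tl xs))"
proof (rule computable_cong)
  show "computable (Suc n) (\<lambda>xs. f (map ((!) xs) [1..<Suc n]))"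
    by (rule computable_select) (use assms in \<open>auto simp del: upt_Suc\<close>)
  show "f (map ((!) xs) [1..<Suc n]) = f (tl xs)" if "length xs = Suc n" for xs
  proof -
    have "map ((!) xs) [1..<Suc n] = tl xs"
      by (rule nth_equalityI) (use that in \<open>auto simp: nth_tl simp del: upt_Suc\<close>)
    then show ?thesis by simp
  qed
qed

text \<open>
  Weakening below a binder. In \<open>computable_rec\<close> the step sees the counter and the previous value; this
  is used for steps that depend on the counter alone.
\<close>

lemma computable_drop_second:
  assumes "computable (Suc n) f"
  shows "computable (Suc (Suc n)) (\<lambda>xs. f (xs ! 0 # tl (tl xs)))"
proof (rule computable_cong)
  show "computable (Suc (Suc n)) (\<lambda>xs. f (map ((!) xs) (0 # [2..<Suc (Suc n)])))"
    by (rule computable_select) (use assms in \<open>auto simp del: upt_Suc simp flip: numeral_2_eq_2\<close>)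
  show "f (map ((!) xs) (0 # [2..<Suc (Suc n)])) = f (xs ! 0 # tl (tl xs))"
    if "length xs = Suc (Suc n)" for xs
  proof -
    have "map ((!) xs) [2..<Suc (Suc n)] = tl (tl xs)"
      by (rule nth_equalityI) (use that in \<open>auto simp: nth_tl simp del: upt_Suc\<close>)
    then show ?thesis by simp
  qed
qed

lemma computable_subst:
  assumes "computable n a" "computable (Suc n) (\<lambda>ys. B (ys ! 0) (tl ys))"
  shows "computable n (\<lambda>xs. B (a xs) xs)"
proof -
  obtain p where p: "\<And>xs. length xs = n \<Longrightarrow> evals p xs (a xs)"
    using assms(1) unfolding computable_def by blast
  obtain q where q: "\<And>ys. length ys = Suc n \<Longrightarrow> evals q ys (B (ys ! 0) (tl ys))"
    using assms(2) unfolding computable_def by blast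
  have "evals (Comp q (p # map Proj [0..<n])) xs (B (a xs) xs)" if "length xs = n" for xs
  proof (rule evals.comp[where ys = "a xs # xs"])
    show "list_all2 (\<lambda>g y. evals g xs y) (p # map Proj [0..<n]) (a xs # xs)"
      using p[OF that] that by (auto simp: list_all2_conv_all_nth nth_Cons' intro: evals.proj)
    show "evals q (a xs # xs) (B (a xs) xs)"
      using q[of "a xs # xs"] that by simp
  qed
  then show ?thesis unfolding computable_def by blast
qed

lemma computable_rec:
  assumes "computable n a" "computable n s"
    and "computable (Suc (Suc n)) (\<lambda>ys. B (ys ! 0) (ys ! 1) (tl (tl ys)))"
  shows "computable n (\<lambda>xs. rec_nat (s xs) (\<lambda>k y. B k y xs) (a xs))"
proof -
  obtain q where q: "\<And>xs. length xs = n \<Longrightarrow> evals q xs (s xs)"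
    using assms(2) unfolding computable_def by blast
  obtain r where r: "\<And>ys. length ys = Suc (Suc n) \<Longrightarrow> evals r ys (B (ys ! 0) (ys ! 1) (tl (tl ys)))"
    using assms(3) unfolding computable_def by blast
  have rec: "evals (PrimRec q r) (m # xs) (rec_nat (s xs) (\<lambda>k y. B k y xs) m)"
    if "length xs = n" for m xs
  proof (induction m)
    case 0
    show ?case using q[OF that] by (simp add: evals.primrec_0)
  next
    case (Suc m)
    show ?case
      using evals.primrec_Suc[OF Suc r[of "m # rec_nat (s xs) (\<lambda>k y. B k y xs) m # xs"]] that by simp
  qed
  then have "evals (PrimRec q r) ys (rec_nat (s (tl ys)) (\<lambda>k y. B k y (tl ys)) (ys ! 0))"
    if "length ys = Suc n" for ys
    using that by (cases ys) auto
  then have "computable (Suc n) (\<lambda>ys. rec_nat (s (tl ys)) (\<lambda>k y. B k y (tl ys)) (ys ! 0))"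
    unfolding computable_def by blast
  with assms(1) show ?thesis by (rule computable_subst)
qed

lemma computable_add:
  assumes "computable n a" "computable n b"
  shows "computable n (\<lambda>xs. a xs + b xs)"
proof (rule computable_cong)
  show "computable n (\<lambda>xs. rec_nat (b xs) (\<lambda>k y. Suc y) (a xs))"
    by (intro computable_rec computable_Suc computable_var assms) simp
  have "rec_nat (b xs) (\<lambda>k y. Suc y) m = m + b xs" for m xs
    by (induction m) auto
  then show "rec_nat (b xs) (\<lambda>k y. Suc y) (a xs) = a xs + b xs" for xs .
qed

lemma computable_sum:
  assumes "computable n a" "computable (Suc n) (\<lambda>ys. B (ys ! 0) (tl ys))"
  shows "computable n (\<lambda>xs. \<Sum>k<a xs. B k xs)"
proof (rule computable_cong)
  have "computable (Suc (Suc n)) (\<lambda>ys. B (ys ! 0) (tl (tl ys)))"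
    using computable_drop_second[OF assms(2)] by simp
  then show "computable n (\<lambda>xs. rec_nat 0 (\<lambda>k y. y + B k xs) (a xs))"
    by (intro computable_rec computable_add computable_const computable_var assms(1)) auto
  have "rec_nat 0 (\<lambda>k y. y + B k xs) m = (\<Sum>k<m. B k xs)" for m xs
    by (induction m) auto
  then show "rec_nat 0 (\<lambda>k y. y + B k xs) (a xs) = (\<Sum>k<a xs. B k xs)" for xs .
qed

lemma computable_mult:
  assumes "computable n a" "computable n b"
  shows "computable n (\<lambda>xs. a xs * b xs)"
proof (rule computable_cong)
  show "computable n (\<lambda>xs. \<Sum>k<a xs. b xs)"
    by (intro computable_sum computable_tl assms)
qed simp

lemma computable_power:
  assumes "computable n a" "computable n b"
  shows "computable n (\<lambda>xs. a xs ^ b xs)"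
proof (rule computable_cong)
  show "computable n (\<lambda>xs. rec_nat 1 (\<lambda>k y. a xs * y) (b xs))"
    by (intro computable_rec computable_mult computable_const computable_var
        computable_tl assms) simp
  have "rec_nat 1 (\<lambda>k y. a xs * y) m = a xs ^ m" for m xs
    by (induction m) auto
  then show "rec_nat 1 (\<lambda>k y. a xs * y) (b xs) = a xs ^ b xs" for xs .
qed

lemma computable_diff:
  assumes "computable n a" "computable n b"
  shows "computable n (\<lambda>xs. a xs - b xs)"
proof -
  have pred: "computable m (\<lambda>xs. c xs - 1)" if "computable m c" for m c
  proof (rule computable_cong)
    show "computable m (\<lambda>xs. rec_nat 0 (\<lambda>k y. k) (c xs))"
      by (intro computable_rec computable_const computable_var that) simp
    show "rec_nat 0 (\<lambda>k y. k) (c xs) = c xs - 1" for xs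
      by (cases "c xs") auto
  qed
  show ?thesis
  proof (rule computable_cong)
    show "computable n (\<lambda>xs. rec_nat (a xs) (\<lambda>k y. y - 1) (b xs))"
      by (intro computable_rec pred computable_var assms) simp
    have "rec_nat (a xs) (\<lambda>k y. y - 1) m = a xs - m" for xs m
      by (induction m) auto
    then show "rec_nat (a xs) (\<lambda>k y. y - 1) (b xs) = a xs - b xs" for xs .
  qed
qed

lemma decidable_le:
  assumes "computable n a" "computable n b"
  shows "decidable n (\<lambda>xs. a xs \<le> b xs)"
proof (rule computable_cong)
  show "computable n (\<lambda>xs. 1 - (a xs - b xs))"
    by (intro computable_diff computable_const assms)
qed auto

lemma decidable_not:
  assumes "decidable n P"
  shows "decidable n (\<lambda>xs. \<not> P xs)"
proof (rule computable_cong)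
  show "computable n (\<lambda>xs. 1 - of_bool (P xs))"
    by (intro computable_diff computable_const assms)
qed auto

lemma decidable_conj:
  assumes "decidable n P" "decidable n Q"
  shows "decidable n (\<lambda>xs. P xs \<and> Q xs)"
proof (rule computable_cong)
  show "computable n (\<lambda>xs. of_bool (P xs) * of_bool (Q xs))"
    by (intro computable_mult assms)
qed auto

lemma decidable_imp:
  assumes "decidable n P" "decidable n Q"
  shows "decidable n (\<lambda>xs. P xs \<longrightarrow> Q xs)"
proof (rule computable_cong)
  show "decidable n (\<lambda>xs. \<not> (P xs \<and> \<not> Q xs))"
    by (intro decidable_conj decidable_not assms)
qed auto

lemma decidable_less:
  assumes "computable n a" "computable n b"
  shows "decidable n (\<lambda>xs. a xs < b xs)"
proof (rule computable_cong)
  show "decidable n (\<lambda>xs. \<not> b xs \<le> a xs)"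
    by (intro decidable_not decidable_le assms)
qed auto

lemma decidable_eq:
  assumes "computable n a" "computable n b"
  shows "decidable n (\<lambda>xs. a xs = b xs)"
proof (rule computable_cong)
  show "decidable n (\<lambda>xs. a xs \<le> b xs \<and> b xs \<le> a xs)"
    by (intro decidable_conj decidable_le assms)
qed auto

text \<open>
  A bounded quantifier is a finite sum: all instances hold iff the number of failing ones is zero.
\<close>

lemma decidable_ball:
  assumes "computable n a" "decidable (Suc n) (\<lambda>ys. P (ys ! 0) (tl ys))"
  shows "decidable n (\<lambda>xs. \<forall>k<a xs. P k xs)"
proof (rule computable_cong)
  show "decidable n (\<lambda>xs. (\<Sum>k<a xs. of_bool (\<not> P k xs)) = (0 :: nat))"
    by (intro decidable_eq computable_sum computable_const decidable_not assms)
qed auto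

lemma decidable_bex:
  assumes "computable n a" "decidable (Suc n) (\<lambda>ys. P (ys ! 0) (tl ys))"
  shows "decidable n (\<lambda>xs. \<exists>k<a xs. P k xs)"
proof (rule computable_cong)
  show "decidable n (\<lambda>xs. \<not> (\<forall>k<a xs. \<not> P k xs))"
    by (intro decidable_not decidable_ball assms)
qed auto

lemma computable_if:
  assumes "decidable n P" "computable n a" "computable n b"
  shows "computable n (\<lambda>xs. if P xs then a xs else b xs)"
proof (rule computable_cong)
  show "computable n (\<lambda>xs. of_bool (P xs) * a xs + of_bool (\<not> P xs) * b xs)"
    by (intro computable_add computable_mult decidable_not assms)
qed auto

lemma computable_mod:
  assumes "computable n a" "computable n b"
  shows "computable n (\<lambda>xs. a xs mod b xs)"
proof (rule computable_cong)
  show "computable n (\<lambda>xs. rec_nat 0 (\<lambda>k y. if Suc y = b xs then 0 else Suc y) (a xs))"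
    by (intro computable_rec computable_if computable_Suc decidable_eq computable_const
        computable_var computable_tl assms) auto
  have "rec_nat 0 (\<lambda>k y. if Suc y = b xs then 0 else Suc y) m = m mod b xs" for m xs
    by (induction m) (auto simp: mod_Suc)
  then show "rec_nat 0 (\<lambda>k y. if Suc y = b xs then 0 else Suc y) (a xs) = a xs mod b xs" for xs .
qed

lemma computable_div:
  assumes "computable n a" "computable n b"
  shows "computable n (\<lambda>xs. a xs div b xs)"
proof (rule computable_cong)
  show "computable n
    (\<lambda>xs. rec_nat 0 (\<lambda>k y. if Suc (k mod b xs) = b xs then Suc y else y) (a xs))"
    by (intro computable_rec computable_if computable_Suc decidable_eq computable_const
        computable_mod computable_var computable_tl assms) auto
  have "rec_nat 0 (\<lambda>k y. if Suc (k mod b xs) = b xs then Suc y else y) m = m div b xs" for m xs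
    by (induction m) (auto simp: div_Suc mod_Suc)
  then show "rec_nat 0 (\<lambda>k y. if Suc (k mod b xs) = b xs then Suc y else y) (a xs)
      = a xs div b xs" for xs .
qed

lemmas computable_intros =
  computable_add computable_sum computable_mult computable_power computable_diff
  decidable_le decidable_less decidable_eq decidable_conj decidable_imp decidable_ball decidable_bex
  computable_if computable_mod computable_div computable_Suc computable_const decidable_not computable_var
  computable_tl

lemma prod_encode_ge: "a \<le> prod_encode (a, b)" "b \<le> prod_encode (a, b)"
  by (simp_all add: le_prod_encode_1 le_prod_encode_2)

lemma computable_prod_encode:
  assumes "computable n a" "computable n b"
  shows "computable n (\<lambda>xs. prod_encode (a xs, b xs))"
  unfolding prod_encode_def triangle_def
  by simp (intro computable_intros assms)

text \<open>
  The inverse of the pairing function by search. The sums have a single nonzero term, because both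
  components of a pair are at most its code.
\<close>

lemma prod_decode_sums:
  "fst (prod_decode m) = (\<Sum>a<Suc m. \<Sum>b<Suc m. if prod_encode (a, b) = m then a else 0)"
  "snd (prod_decode m) = (\<Sum>a<Suc m. \<Sum>b<Suc m. if prod_encode (a, b) = m then b else 0)"
proof -
  obtain c d where cd: "prod_decode m = (c, d)" by fastforce
  then have m: "m = prod_encode (c, d)" by (metis prod_decode_inverse)
  then have le: "c < Suc m" "d < Suc m" using prod_encode_ge[of c d] prod_encode_ge[of d c] by auto
  have iff: "prod_encode (a, b) = m \<longleftrightarrow> a = c \<and> b = d" for a b
    by (simp add: m)
  have *: "(\<Sum>a<Suc m. \<Sum>b<Suc m. if prod_encode (a, b) = m then f a b else 0) = f c d"
    for f :: "nat \<Rightarrow> nat \<Rightarrow> nat"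
  proof -
    have "(\<Sum>b<Suc m. if prod_encode (a, b) = m then f a b else 0) = (if a = c then f c d else 0)" for a
      unfolding iff using le(2) by (cases "a = c") (simp_all del: sum.lessThan_Suc)
    then show ?thesis using le(1) by (simp del: sum.lessThan_Suc)
  qed
  show "fst (prod_decode m) = (\<Sum>a<Suc m. \<Sum>b<Suc m. if prod_encode (a, b) = m then a else 0)"
    unfolding * cd by simp
  show "snd (prod_decode m) = (\<Sum>a<Suc m. \<Sum>b<Suc m. if prod_encode (a, b) = m then b else 0)"
    unfolding * cd by simp
qed

lemma computable_prod_decode:
  assumes "computable n a"
  shows "computable n (\<lambda>xs. fst (prod_decode (a xs)))" "computable n (\<lambda>xs. snd (prod_decode (a xs)))"
  unfolding prod_decode_sums
  by (intro computable_sum computable_if decidable_eq computable_prod_encode computable_const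
     computable_Suc computable_var computable_tl assms; simp)+

text \<open>
  Head and iterated tail of a coded list. The codes satisfy \<open>list_encode [] = 0\<close> and
  \<open>list_encode (x # xs) = Suc (prod_encode (x, list_encode xs))\<close>.
\<close>

definition code_hd :: "nat \<Rightarrow> nat" where
  "code_hd c = fst (prod_decode (c - 1))"

definition code_drop :: "nat \<Rightarrow> nat \<Rightarrow> nat" where
  "code_drop i c = rec_nat c (\<lambda>k y. snd (prod_decode (y - 1))) i"

lemma computable_code_hd:
  "computable n a \<Longrightarrow> computable n (\<lambda>xs. code_hd (a xs))"
  unfolding code_hd_def by (intro computable_prod_decode computable_diff computable_const)

lemma computable_code_drop:
  assumes "computable n a" "computable n b"
  shows "computable n (\<lambda>xs. code_drop (a xs) (b xs))"
  unfolding code_drop_def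
  by (intro computable_rec computable_prod_decode computable_diff computable_const
      computable_var assms) simp

text \<open>
  Dropping beyond the end is harmless because \<open>prod_decode 0 = (0, 0)\<close>, so that the empty list has
  itself as tail.
\<close>

lemma code_drop_list_encode: "code_drop i (list_encode xs) = list_encode (drop i xs)"
proof (induction i)
  case 0
  show ?case by (simp add: code_drop_def)
next
  case (Suc i)
  have z: "prod_decode 0 = (0, 0)" by (simp add: prod_decode_def prod_decode_aux.simps)
  have tl: "snd (prod_decode (list_encode ys - 1)) = list_encode (tl ys)" for ys
    by (cases ys) (simp_all add: z)
  from Suc have "code_drop (Suc i) (list_encode xs) = list_encode (tl (drop i xs))"
    unfolding code_drop_def by (simp only: rec_nat_Suc_imp[OF HOL.refl] nat.rec tl)
  then show ?case by (simp add: drop_Suc tl_drop)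
qed

lemma list_encode_eq_0_iff: "list_encode xs = 0 \<longleftrightarrow> xs = []"
  by (cases xs) auto

lemma code_hd_list_encode: "i < length xs \<Longrightarrow> code_hd (list_encode (drop i xs)) = xs ! i"
  by (simp add: code_hd_def Cons_nth_drop_Suc[symmetric])

lemma length_le_list_encode: "length xs \<le> list_encode xs"
proof (induction xs)
  case (Cons x xs)
  then show ?case using prod_encode_ge(2)[of "list_encode xs" x] by simp
qed simp

text \<open>
  The length of a list is at most its code, so the code itself bounds the positions to be inspected.
\<close>

definition code_ball :: "nat \<Rightarrow> (nat \<Rightarrow> bool) \<Rightarrow> bool" where
  "code_ball c P \<longleftrightarrow> (\<forall>i<c. code_drop i c = 0 \<or> P (code_hd (code_drop i c)))"

lemma code_ball_list_encode: "code_ball (list_encode xs) P \<longleftrightarrow> (\<forall>x\<in>set xs. P x)"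
proof -
  have "code_ball (list_encode xs) P \<longleftrightarrow> (\<forall>i<list_encode xs. i < length xs \<longrightarrow> P (xs ! i))"
    unfolding code_ball_def code_drop_list_encode list_encode_eq_0_iff
    using code_hd_list_encode by (metis drop_eq_Nil linorder_not_less)
  also have "\<dots> \<longleftrightarrow> (\<forall>x\<in>set xs. P x)"
    using length_le_list_encode[of xs] by (auto simp: all_set_conv_all_nth)
  finally show ?thesis .
qed

lemma decidable_code_ball:
  assumes "computable n a" "decidable (Suc n) (\<lambda>ys. P (ys ! 0) (tl ys))"
  shows "decidable n (\<lambda>xs. code_ball (a xs) (\<lambda>k. P k xs))"
proof -
  have "decidable (Suc (Suc n)) (\<lambda>zs. P (zs ! 0) (tl (tl zs)))"
    using computable_drop_second[OF assms(2)] by simp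
  then have *: "decidable (Suc n) (\<lambda>ys. P (code_hd (code_drop (ys ! 0) (a (tl ys)))) (tl ys))"
    by (intro computable_subst[where B = "\<lambda>k ys. of_bool (P k (tl ys))"]
        computable_code_hd computable_code_drop computable_var computable_tl assms(1)) auto
  show ?thesis
    unfolding code_ball_def disj_imp
    by (intro decidable_ball decidable_imp decidable_not decidable_eq computable_code_drop
      computable_var computable_tl computable_const assms(1) *) auto
qed

definition code_fold :: "(nat \<Rightarrow> nat \<Rightarrow> nat) \<Rightarrow> nat \<Rightarrow> nat \<Rightarrow> nat" where
  "code_fold f z c = rec_nat z (\<lambda>i y. if code_drop i c = 0 then y else f y (code_hd (code_drop i c))) c"

lemma code_fold_list_encode: "code_fold f z (list_encode xs) = foldl f z xs"
proof -
  have "rec_nat z (\<lambda>i y. if code_drop i (list_encode xs) = 0 then y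
      else f y (code_hd (code_drop i (list_encode xs)))) m = foldl f z (take m xs)" for m
  proof (induction m)
    case (Suc m)
    then show ?case
      by (cases "m < length xs")
        (simp_all add: code_drop_list_encode list_encode_eq_0_iff code_hd_list_encode
          take_Suc_conv_app_nth)
  qed simp
  then show ?thesis using length_le_list_encode[of xs] by (simp add: code_fold_def)
qed

section \<open>Gluing free actions of finite groups\<close>

text \<open>
  Actions are on the right, so that reading a word from left to right is an iteration of the action.
\<close>

locale right_action = Group.group K for K :: "('k, 'n) monoid_scheme" (structure) +
  fixes Z :: "'z set" and f :: "'z \<Rightarrow> 'k \<Rightarrow> 'z"
  assumes act_closed: "z \<in> Z \<Longrightarrow> k \<in> carrier K \<Longrightarrow> f z k \<in> Z"
    and act_one: "z \<in> Z \<Longrightarrow> f z \<one> = z"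
    and act_mult: "z \<in> Z \<Longrightarrow> k \<in> carrier K \<Longrightarrow> l \<in> carrier K \<Longrightarrow> f (f z k) l = f z (k \<otimes> l)"
begin

lemma act_inv: "z \<in> Z \<Longrightarrow> k \<in> carrier K \<Longrightarrow> f (f z k) (inv k) = z"
  by (simp add: act_mult act_one)

lemma act_back:
  "S \<subseteq> Z \<Longrightarrow> (\<And>s k. s \<in> S \<Longrightarrow> k \<in> carrier K \<Longrightarrow> f s k \<in> S) \<Longrightarrow> z \<in> Z \<Longrightarrow> k \<in> carrier K \<Longrightarrow>
    f z k \<in> S \<Longrightarrow> z \<in> S"
  by (metis act_inv inv_closed)

lemma restrict:
  "S \<subseteq> Z \<Longrightarrow> (\<And>s k. s \<in> S \<Longrightarrow> k \<in> carrier K \<Longrightarrow> f s k \<in> S) \<Longrightarrow> right_action K S f"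
  by unfold_locales (auto simp: act_one act_mult subset_iff)

end

lemma right_action_hom:
  assumes "right_action K Z f" "h \<in> hom A K" "Group.group A"
  shows "right_action A Z (\<lambda>z a. f z (h a))"
proof -
  interpret right_action K Z f by fact
  interpret A: Group.group A by fact
  interpret h: group_hom A K h
    by unfold_locales (fact assms(2))
  show ?thesis
    by unfold_locales (auto simp: act_closed act_one act_mult)
qed

locale free_action = right_action +
  assumes free: "z \<in> Z \<Longrightarrow> k \<in> carrier K \<Longrightarrow> f z k = z \<Longrightarrow> k = \<one>"
begin

lemma inj_act:
  assumes "z \<in> Z"
  shows "inj_on (f z) (carrier K)"
proof (rule inj_onI)
  fix k l assume *: "k \<in> carrier K" "l \<in> carrier K" "f z k = f z l"
  then have "f z (k \<otimes> inv l) = z" using assms by (metis act_inv act_mult inv_closed)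
  then have "k \<otimes> inv l = \<one>" using free assms * by simp
  then show "k = l" using * by (metis inv_equality inv_inv inv_closed)
qed

lemma free_restrict:
  "S \<subseteq> Z \<Longrightarrow> (\<And>s k. s \<in> S \<Longrightarrow> k \<in> carrier K \<Longrightarrow> f s k \<in> S) \<Longrightarrow> free_action K S f"
  using restrict free by (auto simp: free_action_def free_action_axioms_def)

text \<open>
  In an infinite free set there is always room for one more orbit, so the number of orbits of the
  superset can be prescribed.
\<close>

lemma exists_invariant_superset:
  assumes "finite (carrier K)" "infinite Z"
  shows "S \<subseteq> Z \<Longrightarrow> finite S \<Longrightarrow> card S \<le> c \<Longrightarrow>
    \<exists>E. S \<subseteq> E \<and> E \<subseteq> Z \<and> finite E \<and> card E = c * card (carrier K) \<and>
      (\<forall>z\<in>E. \<forall>k\<in>carrier K. f z k \<in> E)"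
proof (induction c arbitrary: S)
  case 0
  then show ?case by auto
next
  case (Suc c)
  obtain S' x where S': "S' \<subseteq> Z" "finite S'" "card S' \<le> c" "S \<subseteq> insert x S'" "x \<in> Z"
  proof (cases "S = {}")
    case True
    moreover obtain x where "x \<in> Z" using assms(2) by fastforce
    ultimately show ?thesis using that[of "{}" x] by auto
  next
    case False
    then obtain x where "x \<in> S" by blast
    moreover from this have "card (S - {x}) \<le> c" using Suc.prems by (simp add: card_Diff_singleton)
    ultimately show ?thesis using that[of "S - {x}" x] Suc.prems by auto
  qed
  obtain E where E: "S' \<subseteq> E" "E \<subseteq> Z" "finite E" "card E = c * card (carrier K)"
    "\<forall>z\<in>E. \<forall>k\<in>carrier K. f z k \<in> E"
    using Suc.IH[OF S'(1-3)] by blast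
  \<comment> \<open>If \<open>x\<close> lies in \<open>E\<close> already, any other point serves to reach the required number of orbits.\<close>
  obtain y where y: "y \<in> Z" "y \<notin> E" "x \<in> insert y E"
    using assms(2) E(2,3) S'(5) by (metis finite_subset insertI1 insert_iff subsetI)
  let ?O = "f y ` carrier K"
  have disj: "E \<inter> ?O = {}"
    using act_back[OF E(2) _ y(1)] E(5) y(2) by auto
  show ?case
  proof (intro exI[of _ "E \<union> ?O"] conjI)
    have "y \<in> ?O" using act_one[OF y(1)] by (metis image_eqI one_closed)
    then show "S \<subseteq> E \<union> ?O" using S'(4) E(1) y(3) by blast
    show "E \<union> ?O \<subseteq> Z" using E(2) y(1) act_closed by auto
    show "finite (E \<union> ?O)" using E(3) assms(1) by simp
    show "card (E \<union> ?O) = Suc c * card (carrier K)"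
      using disj E(3,4) assms(1) inj_act[OF y(1)] by (simp add: card_Un_disjoint card_image)
    show "\<forall>z\<in>E \<union> ?O. \<forall>k\<in>carrier K. f z k \<in> E \<union> ?O"
      using E(5) y(1) by (auto simp: act_mult)
  qed
qed

end

text \<open>
  A free \<open>A\<close>-set is determined up to isomorphism by its number of orbits. The map is extended one
  orbit at a time; equal cardinality provides a point \<open>d'\<close> outside the image whenever there is a point
  \<open>d\<close> outside the domain, and freeness makes \<open>\<alpha> d a \<mapsto> \<beta> d' a\<close> well defined.
\<close>

lemma extend_equivariant:
  assumes "free_action A D \<alpha>" "free_action A D' \<beta>" "finite D" "finite D'" "card D = card D'"
  shows "S \<subseteq> D \<Longrightarrow> (\<And>s a. s \<in> S \<Longrightarrow> a \<in> carrier A \<Longrightarrow> \<alpha> s a \<in> S) \<Longrightarrow>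
    inj_on \<theta> S \<Longrightarrow> \<theta> ` S \<subseteq> D' \<Longrightarrow> (\<And>s a. s \<in> S \<Longrightarrow> a \<in> carrier A \<Longrightarrow> \<theta> (\<alpha> s a) = \<beta> (\<theta> s) a) \<Longrightarrow>
    \<exists>\<eta>. bij_betw \<eta> D D' \<and> (\<forall>s\<in>S. \<eta> s = \<theta> s) \<and>
      (\<forall>z\<in>D. \<forall>a\<in>carrier A. \<eta> (\<alpha> z a) = \<beta> (\<eta> z) a)"
proof (induction "card (D - S)" arbitrary: S \<theta> rule: less_induct)
  case less
  interpret D: free_action A D \<alpha> by fact
  interpret D': free_action A D' \<beta> by fact
  show ?case
  proof (cases "S = D")
    case True
    have "\<theta> ` D = D'"
      using less.prems True assms(4,5) by (metis card_image card_subset_eq)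
    then show ?thesis using less.prems True by (auto simp: bij_betw_def)
  next
    case False
    then obtain d where d: "d \<in> D" "d \<notin> S" using less.prems(1) by blast
    have "card (\<theta> ` S) < card D'"
      using psubset_card_mono[OF assms(3), of S] less.prems(1,3) False assms(5)
      by (simp add: card_image psubset_eq)
    then have "\<theta> ` S \<noteq> D'" by auto
    then obtain d' where d': "d' \<in> D'" "d' \<notin> \<theta> ` S"
      using less.prems(4) by blast
    let ?O = "\<alpha> d ` carrier A"
    let ?S = "S \<union> ?O"
    define \<eta> where "\<eta> z = (if z \<in> S then \<theta> z else \<beta> d' (inv_into (carrier A) (\<alpha> d) z))" for z
    have out: "\<alpha> d a \<notin> S" if "a \<in> carrier A" for a
      using D.act_back[OF less.prems(1,2) d(1) that] d(2) by blast
    have out': "\<beta> d' a \<notin> \<theta> ` S" if "a \<in> carrier A" for a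
    proof
      assume "\<beta> d' a \<in> \<theta> ` S"
      moreover have "\<beta> t b \<in> \<theta> ` S" if t: "t \<in> \<theta> ` S" "b \<in> carrier A" for t b
      proof -
        obtain s where "s \<in> S" "t = \<theta> s" using t(1) by blast
        then have "\<beta> t b = \<theta> (\<alpha> s b)" "\<alpha> s b \<in> S" using t(2) less.prems(2,5) by auto
        then show ?thesis by simp
      qed
      ultimately show False
        using D'.act_back[OF less.prems(4) _ d'(1) that] d'(2) by blast
    qed
    have \<eta>_S: "\<eta> z = \<theta> z" if "z \<in> S" for z
      using that by (simp add: \<eta>_def)
    have \<eta>_O: "\<eta> (\<alpha> d a) = \<beta> d' a" if "a \<in> carrier A" for a
      using out[OF that] that D.inj_act[OF d(1)] by (simp add: \<eta>_def)
    have "\<exists>\<eta>'. bij_betw \<eta>' D D' \<and> (\<forall>s\<in>?S. \<eta>' s = \<eta> s) \<and>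
      (\<forall>z\<in>D. \<forall>a\<in>carrier A. \<eta>' (\<alpha> z a) = \<beta> (\<eta>' z) a)"
    proof (rule less.hyps)
      have "d \<in> ?O" using D.act_one[OF d(1)] by (metis image_eqI D.one_closed)
      then show "card (D - ?S) < card (D - S)"
        by (intro psubset_card_mono) (use d assms(3) in auto)
      show "?S \<subseteq> D" using less.prems(1) d(1) D.act_closed by auto
      show "\<alpha> s a \<in> ?S" if "s \<in> ?S" "a \<in> carrier A" for s a
        using that less.prems(2) d(1) by (auto simp: D.act_mult)
      show "inj_on \<eta> ?S"
        unfolding inj_on_Un
      proof (intro conjI)
        show "inj_on \<eta> S" using less.prems(3) \<eta>_S by (simp add: inj_on_def)
        show "inj_on \<eta> ?O"
        proof (rule inj_onI; elim imageE)
          fix x y a b assume *: "x = \<alpha> d a" "y = \<alpha> d b" "a \<in> carrier A" "b \<in> carrier A" "\<eta> x = \<eta> y"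
          then have "\<beta> d' a = \<beta> d' b" by (simp add: \<eta>_O)
          then show "x = y" using *(1-4) D'.inj_act[OF d'(1)] by (auto dest: inj_onD)
        qed
        show "\<eta> ` (S - ?O) \<inter> \<eta> ` (?O - S) = {}"
        proof (intro equals0I; elim IntE imageE DiffE)
          fix x s t a assume *: "x = \<eta> s" "s \<in> S" "x = \<eta> t" "t = \<alpha> d a" "a \<in> carrier A"
          then have "\<beta> d' a = \<theta> s" by (simp add: \<eta>_S \<eta>_O)
          then show False using out'[OF *(5)] *(2) by simp
        qed
      qed
      show "\<eta> ` ?S \<subseteq> D'"
        using less.prems(4) \<eta>_S \<eta>_O d'(1) D'.act_closed by auto
      show "\<eta> (\<alpha> s a) = \<beta> (\<eta> s) a" if "s \<in> ?S" "a \<in> carrier A" for s a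
        using that(1)
      proof
        assume "s \<in> S"
        then show ?thesis using that(2) less.prems(2,5) \<eta>_S by simp
      next
        assume "s \<in> ?O"
        then obtain b where "b \<in> carrier A" "s = \<alpha> d b" by blast
        then show ?thesis using that(2) d(1) d'(1) \<eta>_O by (simp add: D.act_mult D'.act_mult)
      qed
    qed
    then show ?thesis using \<eta>_S by fastforce
  qed
qed

text \<open>
  The two factors are indexed by \<^typ>\<open>bool\<close>, which allows facts that are symmetric in the factors to
  be stated and proved once.
\<close>

locale amalgam =
  fixes K :: "bool \<Rightarrow> ('k, 'n) monoid_scheme" and A :: "('a, 'm) monoid_scheme"
    and \<phi> :: "bool \<Rightarrow> 'a \<Rightarrow> 'k"
  assumes group_K: "Group.group (K i)" and finite_K: "finite (carrier (K i))"
    and group_A: "Group.group A" and mon_\<phi>: "\<phi> i \<in> mon A (K i)"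
begin

text \<open>
  By the universal property, this is an action of the amalgamated product.
\<close>

definition amalgam_action :: "'z set \<Rightarrow> (bool \<Rightarrow> 'z \<Rightarrow> 'k \<Rightarrow> 'z) \<Rightarrow> bool" where
  "amalgam_action Z F \<longleftrightarrow> (\<forall>i. right_action (K i) Z (F i)) \<and>
    (\<forall>z\<in>Z. \<forall>a\<in>carrier A. F True z (\<phi> True a) = F False z (\<phi> False a))"

definition free_amalgam_action :: "'z set \<Rightarrow> (bool \<Rightarrow> 'z \<Rightarrow> 'k \<Rightarrow> 'z) \<Rightarrow> bool" where
  "free_amalgam_action Z F \<longleftrightarrow> amalgam_action Z F \<and> (\<forall>i. free_action (K i) Z (F i))"

lemma hom_\<phi>: "\<phi> i \<in> hom A (K i)" and inj_\<phi>: "inj_on (\<phi> i) (carrier A)"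
  using mon_\<phi>[of i] by (auto simp: mon_def)

lemma \<phi>_closed: "a \<in> carrier A \<Longrightarrow> \<phi> i a \<in> carrier (K i)"
  using hom_\<phi>[of i] by (auto simp: hom_def)

lemma group_hom_\<phi>: "group_hom A (K i) (\<phi> i)"
  using group_A group_K hom_\<phi> by (simp add: group_hom_def group_hom_axioms_def)

lemma finite_A: "finite (carrier A)"
  using inj_on_finite[OF inj_\<phi>[of True], of "carrier (K True)"] \<phi>_closed finite_K by blast

lemma free_action_\<phi>:
  assumes "free_action (K i) Z f"
  shows "free_action A Z (\<lambda>z a. f z (\<phi> i a))"
proof -
  interpret free_action "K i" Z f by fact
  interpret \<phi>: group_hom A "K i" "\<phi> i" by (rule group_hom_\<phi>)
  have "a = \<one>\<^bsub>A\<^esub>" if "z \<in> Z" "a \<in> carrier A" "f z (\<phi> i a) = z" for z a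
  proof -
    have "\<phi> i a = \<phi> i \<one>\<^bsub>A\<^esub>" using free that \<phi>_closed by simp
    then show ?thesis using inj_\<phi>[of i] that(2) by (simp add: inj_on_def)
  qed
  then show ?thesis
    using right_action_hom[OF right_action_axioms hom_\<phi> group_A]
    by (simp add: free_action_def free_action_axioms_def)
qed

text \<open>
  Only agreement on \<open>A\<close> is required of the actions of the two factors, so an action on \<open>D\<close> and one on
  \<open>D'\<close> combine along any \<open>A\<close>-equivariant bijection \<open>D \<rightarrow> D'\<close>. Choosing the bijection to be the identity
  on \<open>S\<close> keeps both actions unchanged inside \<open>S\<close>.
\<close>

lemma glue_actions:
  assumes "free_action (K True) D f" "free_action (K False) D' f'" "finite D" "finite D'"
    and "card D = card D'" and S: "S \<subseteq> D" "S \<subseteq> D'"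
    and S_inv: "\<And>s a. s \<in> S \<Longrightarrow> a \<in> carrier A \<Longrightarrow> f s (\<phi> True a) \<in> S"
    and S_eq: "\<And>s a. s \<in> S \<Longrightarrow> a \<in> carrier A \<Longrightarrow> f s (\<phi> True a) = f' s (\<phi> False a)"
  obtains F where "free_amalgam_action D F" "F True = f"
    and "\<And>s k. s \<in> S \<Longrightarrow> k \<in> carrier (K False) \<Longrightarrow> f' s k \<in> S \<Longrightarrow> F False s k = f' s k"
proof -
  interpret f: free_action "K True" D f by fact
  interpret f': free_action "K False" D' f' by fact
  obtain \<eta> where \<eta>: "bij_betw \<eta> D D'" "\<forall>s\<in>S. \<eta> s = s"
      "\<forall>z\<in>D. \<forall>a\<in>carrier A. \<eta> (f z (\<phi> True a)) = f' (\<eta> z) (\<phi> False a)"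
    using extend_equivariant[OF free_action_\<phi>[OF assms(1)] free_action_\<phi>[OF assms(2)],
        of S "\<lambda>s. s"] assms by auto
  define g where "g z k = inv_into D \<eta> (f' (\<eta> z) k)" for z k
  have \<eta>_D: "\<eta> z \<in> D'" if "z \<in> D" for z using \<eta>(1) that by (auto simp: bij_betw_def)
  have inv_\<eta>: "inv_into D \<eta> (\<eta> z) = z" if "z \<in> D" for z
    using \<eta>(1) that by (simp add: bij_betw_inv_into_left)
  have \<eta>_inv: "\<eta> (inv_into D \<eta> z) = z" "inv_into D \<eta> z \<in> D" if "z \<in> D'" for z
    using \<eta>(1) that by (auto simp: bij_betw_inv_into_right bij_betw_def inv_into_into)
  have g: "free_action (K False) D g"
  proof unfold_locales
    fix z k assume zk: "z \<in> D" "k \<in> carrier (K False)"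
    then show "g z k \<in> D"
      unfolding g_def by (intro \<eta>_inv f'.act_closed \<eta>_D)
    show "g (g z k) l = g z (k \<otimes>\<^bsub>K False\<^esub> l)" if "l \<in> carrier (K False)" for l
      using zk that by (simp add: g_def \<eta>_inv f'.act_closed \<eta>_D f'.act_mult)
    assume "g z k = z"
    then have "f' (\<eta> z) k = \<eta> z"
      using zk by (metis g_def \<eta>_inv(1) f'.act_closed \<eta>_D)
    then show "k = \<one>\<^bsub>K False\<^esub>" using f'.free zk \<eta>_D by blast
  qed (simp add: g_def f'.act_one \<eta>_D inv_\<eta>)
  define F where "F i = (if i then f else g)" for i
  have "f z (\<phi> True a) = g z (\<phi> False a)" if "z \<in> D" "a \<in> carrier A" for z a
    using that \<eta>(3) by (metis g_def inv_\<eta> f.act_closed \<phi>_closed)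
  then have "free_amalgam_action D F"
    using assms(1) g
    by (auto simp: free_amalgam_action_def amalgam_action_def F_def free_action_def)
  moreover have "F False s k = f' s k"
    if "s \<in> S" "k \<in> carrier (K False)" "f' s k \<in> S" for s k
  proof -
    have "g s k = inv_into D \<eta> (\<eta> (f' s k))"
      using that \<eta>(2) by (simp add: g_def)
    also have "\<dots> = f' s k" using that(3) S(1) by (intro inv_\<eta>) blast
    finally show ?thesis by (simp add: F_def)
  qed
  ultimately show ?thesis using that by (simp add: F_def)
qed

text \<open>
  A finite piece \<open>S\<close> of an infinite free action is preserved inside a finite one. The size
  \<open>c |K\<^sub>1| |K\<^sub>2|\<close> is a multiple of both orders, hence the size of a union of orbits for either factor.
\<close>

lemma finite_completion:
  assumes F: "free_amalgam_action Z F" and "infinite Z" and S: "S \<subseteq> Z" "finite S" "card S \<le> c"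
    and S_inv: "\<And>s a. s \<in> S \<Longrightarrow> a \<in> carrier A \<Longrightarrow> F True s (\<phi> True a) \<in> S"
  obtains E F' where "S \<subseteq> E" "finite E"
    "card E = c * (card (carrier (K True)) * card (carrier (K False)))"
    "amalgam_action E F'"
    "\<And>i s k. s \<in> S \<Longrightarrow> k \<in> carrier (K i) \<Longrightarrow> F i s k \<in> S \<Longrightarrow> F' i s k = F i s k"
proof -
  have free: "free_action (K i) Z (F i)" for i
    using F by (simp add: free_amalgam_action_def)
  have "\<exists>E. S \<subseteq> E \<and> E \<subseteq> Z \<and> finite E \<and>
      card E = (c * card (carrier (K (\<not> i)))) * card (carrier (K i)) \<and>
      (\<forall>z\<in>E. \<forall>k\<in>carrier (K i). F i z k \<in> E)" for i
  proof (rule free_action.exists_invariant_superset[OF free finite_K assms(2) S(1,2)])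
    have "card (carrier (K (\<not> i))) \<ge> 1"
      using finite_K group.is_monoid[OF group_K] monoid.one_closed
      by (metis One_nat_def Suc_leI card_gt_0_iff empty_iff)
    then show "card S \<le> c * card (carrier (K (\<not> i)))"
      using S(3) by (metis le_trans mult.right_neutral mult_le_mono2)
  qed
  then obtain E where E: "\<And>i. S \<subseteq> E i" "\<And>i. E i \<subseteq> Z" "\<And>i. finite (E i)"
      "\<And>i. card (E i) = (c * card (carrier (K (\<not> i)))) * card (carrier (K i))"
      "\<And>i z k. z \<in> E i \<Longrightarrow> k \<in> carrier (K i) \<Longrightarrow> F i z k \<in> E i"
    by metis
  have E_free: "free_action (K i) (E i) (F i)" for i
    using free_action.free_restrict[OF free E(2)] E(5) by blast
  have "F True s (\<phi> True a) = F False s (\<phi> False a)" if "s \<in> S" "a \<in> carrier A" for s a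
    using F S(1) that by (auto simp: free_amalgam_action_def amalgam_action_def)
  then obtain F' where F': "free_amalgam_action (E True) F'" "F' True = F True"
    "\<And>s k. s \<in> S \<Longrightarrow> k \<in> carrier (K False) \<Longrightarrow> F False s k \<in> S \<Longrightarrow> F' False s k = F False s k"
    using glue_actions[OF E_free E_free E(3) E(3) _ E(1) E(1) S_inv] E(4) by (auto simp: ac_simps)
  show ?thesis
  proof (rule that[of "E True" F'])
    show "F' i s k = F i s k" if "s \<in> S" "k \<in> carrier (K i)" "F i s k \<in> S" for i s k
      using that F'(2,3) by (cases i) auto
  qed (use E F' in \<open>auto simp: free_amalgam_action_def ac_simps\<close>)
qed

text \<open>
  The factors act on the two coordinates of \<open>K\<^sub>1 \<times> K\<^sub>2\<close>. The restrictions to \<open>A\<close> differ, but both are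
  free on the same finite set and can therefore be identified.
\<close>

lemma finite_free_action:
  obtains P :: "('k \<times> 'k) set" and F where "free_amalgam_action P F"
    "finite P" "card P = card (carrier (K True)) * card (carrier (K False))"
proof -
  interpret T: Group.group "K True" by (rule group_K)
  interpret F: Group.group "K False" by (rule group_K)
  let ?P = "carrier (K True) \<times> carrier (K False)"
  have "free_action (K True) ?P (\<lambda>z k. (fst z \<otimes>\<^bsub>K True\<^esub> k, snd z))"
    by unfold_locales (auto simp: T.m_assoc)
  moreover have "free_action (K False) ?P (\<lambda>z k. (fst z, snd z \<otimes>\<^bsub>K False\<^esub> k))"
    by unfold_locales (auto simp: F.m_assoc)
  ultimately obtain F where "free_amalgam_action ?P F"
    by (rule glue_actions[where S = "{}"]) (auto simp: finite_K)
  then show ?thesis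
    by (rule that) (simp_all add: finite_K card_cartesian_product)
qed

end

section \<open>Syllables, reduced forms and their uniqueness\<close>

context amalgam
begin

text \<open>
  A syllable \<open>(i, k)\<close> is an element \<open>k\<close> of the factor with index \<open>i\<close>.
\<close>

definition syllables :: "(bool \<times> 'k) list set" where
  "syllables = {v. \<forall>(i, k)\<in>set v. k \<in> carrier (K i)}"

definition run :: "(bool \<Rightarrow> 'z \<Rightarrow> 'k \<Rightarrow> 'z) \<Rightarrow> 'z \<Rightarrow> (bool \<times> 'k) list \<Rightarrow> 'z" where
  "run F = foldl (\<lambda>z (i, k). F i z k)"

lemma run_simps [simp]:
  "run F z [] = z"
  "run F z ((i, k) # v) = run F (F i z k) v"
  "run F z (v @ w) = run F (run F z v) w"
  by (simp_all add: run_def)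

lemma syllables_simps [simp]:
  "[] \<in> syllables"
  "(i, k) # v \<in> syllables \<longleftrightarrow> k \<in> carrier (K i) \<and> v \<in> syllables"
  "v @ w \<in> syllables \<longleftrightarrow> v \<in> syllables \<and> w \<in> syllables"
  by (auto simp: syllables_def)

text \<open>
  Equality in the amalgamated product, as the congruence generated by its defining relations.
\<close>

inductive syl_eq :: "(bool \<times> 'k) list \<Rightarrow> (bool \<times> 'k) list \<Rightarrow> bool" (infix "\<approx>" 50) where
  syl_refl: "v \<in> syllables \<Longrightarrow> v \<approx> v"
| syl_sym: "v \<approx> w \<Longrightarrow> w \<approx> v"
| syl_trans: "u \<approx> v \<Longrightarrow> v \<approx> w \<Longrightarrow> u \<approx> w"
| merge: "u \<in> syllables \<Longrightarrow> v \<in> syllables \<Longrightarrow> k \<in> carrier (K i) \<Longrightarrow> l \<in> carrier (K i) \<Longrightarrow>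
    u @ [(i, k), (i, l)] @ v \<approx> u @ [(i, k \<otimes>\<^bsub>K i\<^esub> l)] @ v"
| drop_one: "u \<in> syllables \<Longrightarrow> v \<in> syllables \<Longrightarrow> u @ [(i, \<one>\<^bsub>K i\<^esub>)] @ v \<approx> u @ v"
| transfer: "u \<in> syllables \<Longrightarrow> v \<in> syllables \<Longrightarrow> a \<in> carrier A \<Longrightarrow>
    u @ [(i, \<phi> i a)] @ v \<approx> u @ [(j, \<phi> j a)] @ v"

declare syl_trans [trans]

lemma K_simps [simp]:
  "\<one>\<^bsub>K i\<^esub> \<in> carrier (K i)"
  "k \<in> carrier (K i) \<Longrightarrow> l \<in> carrier (K i) \<Longrightarrow> k \<otimes>\<^bsub>K i\<^esub> l \<in> carrier (K i)"
  "k \<in> carrier (K i) \<Longrightarrow> inv\<^bsub>K i\<^esub> k \<in> carrier (K i)"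
  "a \<in> carrier A \<Longrightarrow> \<phi> i a \<in> carrier (K i)"
  "k \<in> carrier (K i) \<Longrightarrow> k \<otimes>\<^bsub>K i\<^esub> \<one>\<^bsub>K i\<^esub> = k"
  "k \<in> carrier (K i) \<Longrightarrow> \<one>\<^bsub>K i\<^esub> \<otimes>\<^bsub>K i\<^esub> k = k"
  "k \<in> carrier (K i) \<Longrightarrow> k \<otimes>\<^bsub>K i\<^esub> inv\<^bsub>K i\<^esub> k = \<one>\<^bsub>K i\<^esub>"
  "k \<in> carrier (K i) \<Longrightarrow> inv\<^bsub>K i\<^esub> k \<otimes>\<^bsub>K i\<^esub> k = \<one>\<^bsub>K i\<^esub>"
  using group_K[of i] \<phi>_closed
  by (simp_all add: group.is_monoid monoid.m_closed group.inv_closed group.r_inv group.l_inv)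

lemma A_simps [simp]:
  "\<one>\<^bsub>A\<^esub> \<in> carrier A"
  "a \<in> carrier A \<Longrightarrow> b \<in> carrier A \<Longrightarrow> a \<otimes>\<^bsub>A\<^esub> b \<in> carrier A"
  "a \<in> carrier A \<Longrightarrow> inv\<^bsub>A\<^esub> a \<in> carrier A"
  "\<phi> i \<one>\<^bsub>A\<^esub> = \<one>\<^bsub>K i\<^esub>"
  "a \<in> carrier A \<Longrightarrow> b \<in> carrier A \<Longrightarrow> \<phi> i (a \<otimes>\<^bsub>A\<^esub> b) = \<phi> i a \<otimes>\<^bsub>K i\<^esub> \<phi> i b"
  "a \<in> carrier A \<Longrightarrow> \<phi> i (inv\<^bsub>A\<^esub> a) = inv\<^bsub>K i\<^esub> (\<phi> i a)"
proof -
  interpret \<phi>: group_hom A "K i" "\<phi> i" by (rule group_hom_\<phi>)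
  show "\<phi> i \<one>\<^bsub>A\<^esub> = \<one>\<^bsub>K i\<^esub>"
    "\<one>\<^bsub>A\<^esub> \<in> carrier A"
    "a \<in> carrier A \<Longrightarrow> inv\<^bsub>A\<^esub> a \<in> carrier A"
    "a \<in> carrier A \<Longrightarrow> b \<in> carrier A \<Longrightarrow> a \<otimes>\<^bsub>A\<^esub> b \<in> carrier A"
    "a \<in> carrier A \<Longrightarrow> b \<in> carrier A \<Longrightarrow> \<phi> i (a \<otimes>\<^bsub>A\<^esub> b) = \<phi> i a \<otimes>\<^bsub>K i\<^esub> \<phi> i b"
    "a \<in> carrier A \<Longrightarrow> \<phi> i (inv\<^bsub>A\<^esub> a) = inv\<^bsub>K i\<^esub> (\<phi> i a)"
    by simp_all
qed

lemma K_assoc: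
  "k \<in> carrier (K i) \<Longrightarrow> l \<in> carrier (K i) \<Longrightarrow> m \<in> carrier (K i) \<Longrightarrow>
    k \<otimes>\<^bsub>K i\<^esub> l \<otimes>\<^bsub>K i\<^esub> m = k \<otimes>\<^bsub>K i\<^esub> (l \<otimes>\<^bsub>K i\<^esub> m)"
  using group_K[of i] by (simp add: group.is_monoid monoid.m_assoc)

lemma syl_eq_syllables: "v \<approx> w \<Longrightarrow> v \<in> syllables \<and> w \<in> syllables"
  by (induction rule: syl_eq.induct) auto

lemma syl_eq_context:
  "v \<approx> w \<Longrightarrow> x \<in> syllables \<Longrightarrow> y \<in> syllables \<Longrightarrow> x @ v @ y \<approx> x @ w @ y"
proof (induction rule: syl_eq.induct)
  case (merge u v k i l)
  then show ?case using syl_eq.merge[of "x @ u" "v @ y" k i l] by simp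
next
  case (drop_one u v i)
  then show ?case using syl_eq.drop_one[of "x @ u" "v @ y" i] by simp
next
  case (transfer u v a i j)
  then show ?case using syl_eq.transfer[of "x @ u" "v @ y" a i j] by simp
qed (auto intro: syl_refl syl_sym syl_trans)

lemma syl_eq_append:
  assumes "v \<approx> v'" "w \<approx> w'"
  shows "v @ w \<approx> v' @ w'"
proof -
  have "v @ w \<approx> v' @ w"
    using syl_eq_context[OF assms(1), of "[]" w] syl_eq_syllables[OF assms(2)] by simp
  also have "v' @ w \<approx> v' @ w'"
    using syl_eq_context[OF assms(2), of v' "[]"] syl_eq_syllables[OF assms(1)] by simp
  finally show ?thesis .
qed

lemma amalgam_actionD:
  assumes "amalgam_action Z F"
  shows "z \<in> Z \<Longrightarrow> k \<in> carrier (K i) \<Longrightarrow> F i z k \<in> Z"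
    and "z \<in> Z \<Longrightarrow> F i z \<one>\<^bsub>K i\<^esub> = z"
    and "z \<in> Z \<Longrightarrow> k \<in> carrier (K i) \<Longrightarrow> l \<in> carrier (K i) \<Longrightarrow> F i (F i z k) l = F i z (k \<otimes>\<^bsub>K i\<^esub> l)"
    and "z \<in> Z \<Longrightarrow> a \<in> carrier A \<Longrightarrow> F i z (\<phi> i a) = F j z (\<phi> j a)"
proof -
  interpret right_action "K i" Z "F i" using assms by (simp add: amalgam_action_def)
  show "z \<in> Z \<Longrightarrow> k \<in> carrier (K i) \<Longrightarrow> F i z k \<in> Z"
    and "z \<in> Z \<Longrightarrow> F i z \<one>\<^bsub>K i\<^esub> = z"
    and "z \<in> Z \<Longrightarrow> k \<in> carrier (K i) \<Longrightarrow> l \<in> carrier (K i) \<Longrightarrow> F i (F i z k) l = F i z (k \<otimes>\<^bsub>K i\<^esub> l)"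
    by (auto simp: act_closed act_one act_mult)
  show "z \<in> Z \<Longrightarrow> a \<in> carrier A \<Longrightarrow> F i z (\<phi> i a) = F j z (\<phi> j a)"
    using assms unfolding amalgam_action_def by (cases i; cases j) auto
qed

lemma run_closed: "amalgam_action Z F \<Longrightarrow> z \<in> Z \<Longrightarrow> v \<in> syllables \<Longrightarrow> run F z v \<in> Z"
  by (induction v arbitrary: z) (auto simp: amalgam_actionD)

text \<open>
  One direction of the universal property: equal elements act equally.
\<close>

lemma run_cong:
  assumes "amalgam_action Z F"
  shows "v \<approx> w \<Longrightarrow> z \<in> Z \<Longrightarrow> run F z v = run F z w"
proof (induction rule: syl_eq.induct)
  case (merge u v k i l)
  then show ?case using amalgam_actionD(3)[OF assms run_closed[OF assms]] by simp
next
  case (drop_one u v i)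
  then show ?case using amalgam_actionD(2)[OF assms run_closed[OF assms]] by simp
next
  case (transfer u v a i j)
  then show ?case using amalgam_actionD(4)[OF assms run_closed[OF assms], of z u a i j] by simp
qed auto

definition inv_syl :: "(bool \<times> 'k) list \<Rightarrow> (bool \<times> 'k) list" where
  "inv_syl v = rev (map (\<lambda>(i, k). (i, inv\<^bsub>K i\<^esub> k)) v)"

lemma inv_syl_simps [simp]:
  "inv_syl [] = []"
  "inv_syl ((i, k) # v) = inv_syl v @ [(i, inv\<^bsub>K i\<^esub> k)]"
  "length (inv_syl v) = length v"
  by (simp_all add: inv_syl_def)

lemma inv_syl_syllables [simp]: "v \<in> syllables \<Longrightarrow> inv_syl v \<in> syllables"
  by (induction v) (auto simp: split: prod.splits)

lemma inv_syl_cancel: "v \<in> syllables \<Longrightarrow> inv_syl v @ v \<approx> []"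
proof (induction v)
  case (Cons s v)
  obtain i k where s: "s = (i, k)" by (cases s)
  have "inv_syl v @ [(i, inv\<^bsub>K i\<^esub> k), (i, k)] @ v \<approx> inv_syl v @ [(i, inv\<^bsub>K i\<^esub> k \<otimes>\<^bsub>K i\<^esub> k)] @ v"
    by (rule merge) (use Cons.prems s in auto)
  also have "inv_syl v @ [(i, inv\<^bsub>K i\<^esub> k \<otimes>\<^bsub>K i\<^esub> k)] @ v \<approx> inv_syl v @ v"
    using drop_one[of "inv_syl v" v i] Cons.prems s by auto
  also have "inv_syl v @ v \<approx> []" using Cons s by auto
  finally show ?case by (simp add: s)
qed (simp add: syl_refl)

lemma inv_syl_cancel': "v \<in> syllables \<Longrightarrow> v @ inv_syl v \<approx> []"
proof (induction v)
  case (Cons s v)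
  obtain i k where s: "s = (i, k)" by (cases s)
  have "[(i, k)] @ (v @ inv_syl v) @ [(i, inv\<^bsub>K i\<^esub> k)] \<approx> [(i, k)] @ [] @ [(i, inv\<^bsub>K i\<^esub> k)]"
    by (rule syl_eq_context) (use Cons s in auto)
  also have "[(i, k)] @ [] @ [(i, inv\<^bsub>K i\<^esub> k)] \<approx> [(i, k \<otimes>\<^bsub>K i\<^esub> inv\<^bsub>K i\<^esub> k)]"
    using merge[of "[]" "[]" k i "inv\<^bsub>K i\<^esub> k"] Cons.prems s by auto
  also have "[(i, k \<otimes>\<^bsub>K i\<^esub> inv\<^bsub>K i\<^esub> k)] \<approx> []"
    using drop_one[of "[]" "[]" i] Cons.prems s by auto
  finally show ?case by (simp add: s)
qed (simp add: syl_refl)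

lemma run_inv_syl:
  assumes "amalgam_action Z F" "z \<in> Z" "v \<in> syllables"
  shows "run F (run F z v) (inv_syl v) = z" "run F (run F z (inv_syl v)) v = z"
  using run_cong[OF assms(1) inv_syl_cancel'[OF assms(3)] assms(2)]
    run_cong[OF assms(1) inv_syl_cancel[OF assms(3)] assms(2)] by simp_all

text \<open>
  Reduced sequences in the usual sense, except that a single syllable from \<open>A\<close> is not reduced either.
\<close>

fun reduced :: "(bool \<times> 'k) list \<Rightarrow> bool" where
  "reduced [] \<longleftrightarrow> True"
| "reduced ((i, k) # v) \<longleftrightarrow> k \<in> carrier (K i) \<and> k \<notin> \<phi> i ` carrier A \<and>
    (v \<noteq> [] \<longrightarrow> fst (hd v) \<noteq> i) \<and> reduced v"

lemma reduced_syllables: "reduced v \<Longrightarrow> v \<in> syllables"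
  by (induction v rule: reduced.induct) auto

lemma reduced_append:
  "reduced (v @ w) \<longleftrightarrow> reduced v \<and> reduced w \<and> (v \<noteq> [] \<longrightarrow> w \<noteq> [] \<longrightarrow> fst (last v) \<noteq> fst (hd w))"
  by (induction v rule: reduced.induct) auto

text \<open>
  A syllable from \<open>A\<close> can be read in either factor and therefore merges with any neighbour.
\<close>

lemma absorb_syllable:
  assumes "a \<in> carrier A" "x @ [(j, l)] @ y \<in> syllables"
  shows "x @ [(i, \<phi> i a), (j, l)] @ y \<approx> x @ [(j, \<phi> j a \<otimes>\<^bsub>K j\<^esub> l)] @ y"
    and "x @ [(j, l), (i, \<phi> i a)] @ y \<approx> x @ [(j, l \<otimes>\<^bsub>K j\<^esub> \<phi> j a)] @ y"
proof -
  have "x @ [(i, \<phi> i a)] @ (j, l) # y \<approx> x @ [(j, \<phi> j a)] @ (j, l) # y"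
    by (rule transfer) (use assms in auto)
  also have "x @ [(j, \<phi> j a)] @ (j, l) # y \<approx> x @ [(j, \<phi> j a \<otimes>\<^bsub>K j\<^esub> l)] @ y"
    using merge[of x y "\<phi> j a" j l] assms by simp
  finally show "x @ [(i, \<phi> i a), (j, l)] @ y \<approx> x @ [(j, \<phi> j a \<otimes>\<^bsub>K j\<^esub> l)] @ y" by simp
  have "(x @ [(j, l)]) @ [(i, \<phi> i a)] @ y \<approx> (x @ [(j, l)]) @ [(j, \<phi> j a)] @ y"
    by (rule transfer) (use assms in auto)
  also have "(x @ [(j, l)]) @ [(j, \<phi> j a)] @ y \<approx> x @ [(j, l \<otimes>\<^bsub>K j\<^esub> \<phi> j a)] @ y"
    using merge[of x y l j "\<phi> j a"] assms by simp
  finally show "x @ [(j, l), (i, \<phi> i a)] @ y \<approx> x @ [(j, l \<otimes>\<^bsub>K j\<^esub> \<phi> j a)] @ y" by simp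
qed

lemma not_reduced_shorten:
  "v \<in> syllables \<Longrightarrow> \<not> reduced v \<Longrightarrow> length v \<noteq> 1 \<Longrightarrow> \<exists>w. v \<approx> w \<and> length w < length v"
proof (induction v rule: reduced.induct)
  case (2 i k v)
  then obtain j l w where v: "v = (j, l) # w" by (cases v) auto
  have mem: "k \<in> carrier (K i)" "l \<in> carrier (K j)" "w \<in> syllables" using 2 v by auto
  consider (same) "i = j" | (left) "k \<in> \<phi> i ` carrier A"
    | (right) "w = []" "l \<in> \<phi> j ` carrier A" | (later) "\<not> reduced v" "w \<noteq> []"
    using 2 v by (cases "w = []") auto
  then show ?case
  proof cases
    case same
    then have "(i, k) # v \<approx> (i, k \<otimes>\<^bsub>K i\<^esub> l) # w"
      using merge[of "[]" w k i l] mem v by simp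
    then show ?thesis using v by (intro exI conjI) auto
  next
    case left
    then obtain a where a: "a \<in> carrier A" "k = \<phi> i a" by blast
    then have "(i, k) # v \<approx> (j, \<phi> j a \<otimes>\<^bsub>K j\<^esub> l) # w"
      using absorb_syllable(1)[of a "[]" j l w i] mem v by simp
    then show ?thesis using v by (intro exI conjI) auto
  next
    case right
    then obtain a where a: "a \<in> carrier A" "l = \<phi> j a" by blast
    then have "(i, k) # v \<approx> [(i, k \<otimes>\<^bsub>K i\<^esub> \<phi> i a)]"
      using absorb_syllable(2)[of a "[]" i k "[]" j] mem v right by simp
    then show ?thesis using v by (intro exI conjI) auto
  next
    case later
    then obtain u where u: "v \<approx> u" "length u < length v"
      using 2 v by auto
    have "(i, k) # v \<approx> (i, k) # u"
      using syl_eq_context[OF u(1), of "[(i, k)]" "[]"] mem by simp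
    then show ?thesis using u(2) by (intro exI conjI) auto
  qed
qed simp

text \<open>
  Shorten the sequence while it is not reduced, and conjugate the first syllable to the end while the
  outer syllables belong to the same factor. Each conjugation lengthens \<open>u\<close> by one and shortens the
  rest by one, which gives the bound on the length of \<open>u\<close>.
\<close>

lemma cyclic_reduction:
  assumes "v \<in> syllables"
  shows "\<exists>u c. u \<in> syllables \<and> c \<in> syllables \<and> length u \<le> length v \<and> v \<approx> u @ c @ inv_syl u \<and>
    (length c \<le> 1 \<or> reduced c \<and> fst (last c) \<noteq> fst (hd c))"
  using assms
proof (induction "length v" arbitrary: v rule: less_induct)
  case less
  consider (short) "length v \<le> 1" | (not_reduced) "length v > 1" "\<not> reduced v"
    | (cyclic) "reduced v" "fst (last v) \<noteq> fst (hd v)"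
    | (conj) "length v > 1" "reduced v" "fst (last v) = fst (hd v)"
    by linarith
  then show ?case
  proof cases
    case short
    then show ?thesis using less.prems by (intro exI[of _ "[]"] exI[of _ v]) (auto intro: syl_refl)
  next
    case cyclic
    then show ?thesis using less.prems by (intro exI[of _ "[]"] exI[of _ v]) (auto intro: syl_refl)
  next
    case not_reduced
    then obtain w where w: "v \<approx> w" "length w < length v"
      using not_reduced_shorten[of v] less.prems by auto
    obtain u c where "u \<in> syllables" "c \<in> syllables" "length u \<le> length w"
      "w \<approx> u @ c @ inv_syl u" "length c \<le> 1 \<or> reduced c \<and> fst (last c) \<noteq> fst (hd c)"
      using less.hyps[OF w(2)] syl_eq_syllables[OF w(1)] by blast
    then show ?thesis
      using w by (intro exI[of _ u] exI[of _ c]) (auto intro: syl_trans)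
  next
    case conj
    then obtain i k w where v: "v = (i, k) # w" "w \<noteq> []"
      by (cases v) auto
    moreover obtain j l w' where w: "w = w' @ [(j, l)]"
      using v(2) by (metis rev_exhaust surj_pair)
    ultimately have v: "v = (i, k) # w' @ [(i, l)]" using conj(3) by auto
    have mem: "k \<in> carrier (K i)" "l \<in> carrier (K i)" "w' \<in> syllables" using less.prems v by auto
    \<comment> \<open>Moving \<open>k\<close> from the front to the end conjugates by the first syllable.\<close>
    let ?w = "w' @ [(i, l \<otimes>\<^bsub>K i\<^esub> k)]"
    obtain u c where uc: "u \<in> syllables" "c \<in> syllables" "length u \<le> length ?w"
      "?w \<approx> u @ c @ inv_syl u" "length c \<le> 1 \<or> reduced c \<and> fst (last c) \<noteq> fst (hd c)"
      using less.hyps[of ?w] mem v by auto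
    have "v @ [(i, k), (i, inv\<^bsub>K i\<^esub> k)] \<approx> v @ []"
      by (rule syl_eq_append[OF syl_refl]) (use less.prems inv_syl_cancel'[of "[(i, k)]"] mem in auto)
    then have "v \<approx> v @ [(i, k), (i, inv\<^bsub>K i\<^esub> k)]"
      using syl_sym by simp
    also have "v @ [(i, k), (i, inv\<^bsub>K i\<^esub> k)] \<approx> [(i, k)] @ ?w @ [(i, inv\<^bsub>K i\<^esub> k)]"
      using merge[of "(i, k) # w'" "[(i, inv\<^bsub>K i\<^esub> k)]" l i k] mem v by auto
    also have "[(i, k)] @ ?w @ [(i, inv\<^bsub>K i\<^esub> k)]
        \<approx> [(i, k)] @ (u @ c @ inv_syl u) @ [(i, inv\<^bsub>K i\<^esub> k)]"
      by (rule syl_eq_context[OF uc(4)]) (use mem in auto)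
    finally have "v \<approx> ((i, k) # u) @ c @ inv_syl ((i, k) # u)" by simp
    then show ?thesis
      using uc mem v by (intro exI[of _ "(i, k) # u"] exI[of _ c]) auto
  qed
qed

text \<open>
  A transversal of the left cosets \<open>k A\<close> that represents \<open>A\<close> itself by the neutral element, and the
  remaining factor in \<open>A\<close>: \<open>k = rep i k \<cdot> res i k\<close>.
\<close>

definition rep :: "bool \<Rightarrow> 'k \<Rightarrow> 'k" where
  "rep i k = (if k \<in> \<phi> i ` carrier A then \<one>\<^bsub>K i\<^esub>
    else SOME t. t \<in> (\<lambda>a. k \<otimes>\<^bsub>K i\<^esub> \<phi> i a) ` carrier A)"

definition res :: "bool \<Rightarrow> 'k \<Rightarrow> 'a" where
  "res i k = inv_into (carrier A) (\<phi> i) (inv\<^bsub>K i\<^esub> (rep i k) \<otimes>\<^bsub>K i\<^esub> k)"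

lemma mult_embedding_iff:
  assumes "k \<in> carrier (K i)" "a \<in> carrier A"
  shows "k \<otimes>\<^bsub>K i\<^esub> \<phi> i a \<in> \<phi> i ` carrier A \<longleftrightarrow> k \<in> \<phi> i ` carrier A"
proof
  assume "k \<otimes>\<^bsub>K i\<^esub> \<phi> i a \<in> \<phi> i ` carrier A"
  then obtain b where b: "b \<in> carrier A" "k \<otimes>\<^bsub>K i\<^esub> \<phi> i a = \<phi> i b" by blast
  then have "\<phi> i (b \<otimes>\<^bsub>A\<^esub> inv\<^bsub>A\<^esub> a) = k \<otimes>\<^bsub>K i\<^esub> \<phi> i a \<otimes>\<^bsub>K i\<^esub> inv\<^bsub>K i\<^esub> (\<phi> i a)" using assms by simp
  also have "\<dots> = k" using assms by (simp add: K_assoc)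
  finally show "k \<in> \<phi> i ` carrier A"
    using b assms by (intro image_eqI[of _ _ "b \<otimes>\<^bsub>A\<^esub> inv\<^bsub>A\<^esub> a"]) simp_all
next
  assume "k \<in> \<phi> i ` carrier A"
  then obtain b where "b \<in> carrier A" "k = \<phi> i b" by blast
  then show "k \<otimes>\<^bsub>K i\<^esub> \<phi> i a \<in> \<phi> i ` carrier A"
    using assms by (intro image_eqI[of _ _ "b \<otimes>\<^bsub>A\<^esub> a"]) simp_all
qed

lemma rep_mult:
  assumes "k \<in> carrier (K i)" "a \<in> carrier A"
  shows "rep i (k \<otimes>\<^bsub>K i\<^esub> \<phi> i a) = rep i k"
proof -
  have "(\<lambda>b. k \<otimes>\<^bsub>K i\<^esub> \<phi> i a \<otimes>\<^bsub>K i\<^esub> \<phi> i b) ` carrier A = (\<lambda>b. k \<otimes>\<^bsub>K i\<^esub> \<phi> i b) ` carrier A"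
  proof (intro equalityI subsetI; elim imageE)
    fix x b assume b: "b \<in> carrier A" "x = k \<otimes>\<^bsub>K i\<^esub> \<phi> i a \<otimes>\<^bsub>K i\<^esub> \<phi> i b"
    then have "x = k \<otimes>\<^bsub>K i\<^esub> \<phi> i (a \<otimes>\<^bsub>A\<^esub> b)" using assms by (simp add: K_assoc)
    then show "x \<in> (\<lambda>b. k \<otimes>\<^bsub>K i\<^esub> \<phi> i b) ` carrier A"
      by (rule image_eqI) (use assms b in simp)
  next
    fix x b assume b: "b \<in> carrier A" "x = k \<otimes>\<^bsub>K i\<^esub> \<phi> i b"
    have "\<phi> i a \<otimes>\<^bsub>K i\<^esub> (inv\<^bsub>K i\<^esub> (\<phi> i a) \<otimes>\<^bsub>K i\<^esub> \<phi> i b) = \<phi> i b"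
      using assms b by (simp flip: K_assoc)
    then have "x = k \<otimes>\<^bsub>K i\<^esub> \<phi> i a \<otimes>\<^bsub>K i\<^esub> \<phi> i (inv\<^bsub>A\<^esub> a \<otimes>\<^bsub>A\<^esub> b)"
      using assms b by (simp add: K_assoc)
    then show "x \<in> (\<lambda>b. k \<otimes>\<^bsub>K i\<^esub> \<phi> i a \<otimes>\<^bsub>K i\<^esub> \<phi> i b) ` carrier A"
      by (rule image_eqI) (use assms b in simp)
  qed
  then show ?thesis using mult_embedding_iff[OF assms] by (simp add: rep_def)
qed

lemma rep_coset:
  assumes "k \<in> carrier (K i)"
  obtains a where "a \<in> carrier A" "rep i k = k \<otimes>\<^bsub>K i\<^esub> \<phi> i a"
proof (cases "k \<in> \<phi> i ` carrier A")
  case True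
  then obtain a where a: "a \<in> carrier A" "k = \<phi> i a" by blast
  then have "rep i k = k \<otimes>\<^bsub>K i\<^esub> \<phi> i (inv\<^bsub>A\<^esub> a)" by (simp add: rep_def)
  then show ?thesis using that a by (meson A_simps(3))
next
  case False
  have "k \<in> (\<lambda>a. k \<otimes>\<^bsub>K i\<^esub> \<phi> i a) ` carrier A"
    using assms by (intro image_eqI[of _ _ "\<one>\<^bsub>A\<^esub>"]) auto
  then have "rep i k \<in> (\<lambda>a. k \<otimes>\<^bsub>K i\<^esub> \<phi> i a) ` carrier A"
    using False by (auto simp: rep_def intro: someI)
  then show ?thesis using that by blast
qed

lemma rep_closed [simp]:
  assumes "k \<in> carrier (K i)"
  shows "rep i k \<in> carrier (K i)"
proof -
  obtain a where "a \<in> carrier A" "rep i k = k \<otimes>\<^bsub>K i\<^esub> \<phi> i a" by (rule rep_coset[OF assms])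
  then show ?thesis using assms by simp
qed

lemma rep_rep [simp]:
  assumes "k \<in> carrier (K i)"
  shows "rep i (rep i k) = rep i k"
proof -
  obtain a where "a \<in> carrier A" "rep i k = k \<otimes>\<^bsub>K i\<^esub> \<phi> i a" by (rule rep_coset[OF assms])
  then show ?thesis using rep_mult[OF assms, of a] by simp
qed

lemma rep_eq_one_iff:
  assumes "k \<in> carrier (K i)"
  shows "rep i k = \<one>\<^bsub>K i\<^esub> \<longleftrightarrow> k \<in> \<phi> i ` carrier A"
proof
  assume "rep i k = \<one>\<^bsub>K i\<^esub>"
  moreover have "\<one>\<^bsub>K i\<^esub> \<in> \<phi> i ` carrier A" by (intro image_eqI[of _ _ "\<one>\<^bsub>A\<^esub>"]) simp_all
  moreover obtain a where "a \<in> carrier A" "rep i k = k \<otimes>\<^bsub>K i\<^esub> \<phi> i a" by (rule rep_coset[OF assms])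
  ultimately have "a \<in> carrier A" "k \<otimes>\<^bsub>K i\<^esub> \<phi> i a \<in> \<phi> i ` carrier A" by simp_all
  then show "k \<in> \<phi> i ` carrier A" using mult_embedding_iff[OF assms] by blast
qed (simp add: rep_def)

lemma res_mult:
  assumes "t \<in> carrier (K i)" "rep i t = t" "a \<in> carrier A"
  shows "res i (t \<otimes>\<^bsub>K i\<^esub> \<phi> i a) = a"
proof -
  have "inv\<^bsub>K i\<^esub> t \<otimes>\<^bsub>K i\<^esub> (t \<otimes>\<^bsub>K i\<^esub> \<phi> i a) = \<phi> i a"
    using assms by (simp flip: K_assoc)
  then show ?thesis using assms inj_\<phi>[of i] by (simp add: res_def rep_mult)
qed

lemma rep_res:
  assumes "k \<in> carrier (K i)"
  shows "res i k \<in> carrier A" "rep i k \<otimes>\<^bsub>K i\<^esub> \<phi> i (res i k) = k"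
proof -
  obtain a where a: "a \<in> carrier A" "rep i k = k \<otimes>\<^bsub>K i\<^esub> \<phi> i a" by (rule rep_coset[OF assms])
  have k: "k = rep i k \<otimes>\<^bsub>K i\<^esub> \<phi> i (inv\<^bsub>A\<^esub> a)" using a assms by (simp add: K_assoc)
  have "res i (rep i k \<otimes>\<^bsub>K i\<^esub> \<phi> i (inv\<^bsub>A\<^esub> a)) = inv\<^bsub>A\<^esub> a"
    using a(1) assms by (intro res_mult) simp_all
  then have "res i k = inv\<^bsub>A\<^esub> a" by (simp only: k[symmetric])
  then show "res i k \<in> carrier A" "rep i k \<otimes>\<^bsub>K i\<^esub> \<phi> i (res i k) = k"
    using a k by simp_all
qed

text \<open>
  Normal forms \<open>t\<^sub>1 t\<^sub>2 \<dots> t\<^sub>m a\<close> with nontrivial coset representatives \<open>t\<^sub>j\<close> from alternating factors and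
  \<open>a \<in> A\<close>. The representatives are kept in a stack whose top is the last one.
\<close>

fun stack :: "(bool \<times> 'k) list \<Rightarrow> bool" where
  "stack [] \<longleftrightarrow> True"
| "stack ((i, t) # ts) \<longleftrightarrow> t \<in> carrier (K i) \<and> rep i t = t \<and> t \<noteq> \<one>\<^bsub>K i\<^esub> \<and>
    (ts \<noteq> [] \<longrightarrow> fst (hd ts) \<noteq> i) \<and> stack ts"

definition stacks :: "((bool \<times> 'k) list \<times> 'a) set" where
  "stacks = {(ts, a). stack ts \<and> a \<in> carrier A}"

text \<open>
  Splits off the last part of a normal form that belongs to the factor \<open>i\<close>; \<open>build\<close> is the inverse. In
  this way the normal forms become pairs of a stack without top in factor \<open>i\<close> and an element of that
  factor, on which the factor acts by right multiplication.
\<close>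

fun peel :: "bool \<Rightarrow> (bool \<times> 'k) list \<times> 'a \<Rightarrow> (bool \<times> 'k) list \<times> 'k" where
  "peel i ([], a) = ([], \<phi> i a)"
| "peel i ((j, t) # ts, a) = (if j = i then (ts, t \<otimes>\<^bsub>K i\<^esub> \<phi> i a) else ((j, t) # ts, \<phi> i a))"

definition build :: "bool \<Rightarrow> (bool \<times> 'k) list \<times> 'k \<Rightarrow> (bool \<times> 'k) list \<times> 'a" where
  "build i = (\<lambda>(ts, k). (if k \<in> \<phi> i ` carrier A then ts else (i, rep i k) # ts, res i k))"

definition stack_act :: "bool \<Rightarrow> (bool \<times> 'k) list \<times> 'a \<Rightarrow> 'k \<Rightarrow> (bool \<times> 'k) list \<times> 'a" where
  "stack_act i \<omega> k = build i (fst (peel i \<omega>), snd (peel i \<omega>) \<otimes>\<^bsub>K i\<^esub> k)"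

lemma peel_stack:
  assumes "\<omega> \<in> stacks" "peel i \<omega> = (ts, k)"
  shows "stack ts" "ts \<noteq> [] \<Longrightarrow> fst (hd ts) \<noteq> i" "k \<in> carrier (K i)"
  using assms by (cases "(i, \<omega>)" rule: peel.cases; auto simp: stacks_def split: if_splits)+

lemma build_stack:
  assumes "stack ts" "ts \<noteq> [] \<Longrightarrow> fst (hd ts) \<noteq> i" "k \<in> carrier (K i)"
  shows "build i (ts, k) \<in> stacks" "peel i (build i (ts, k)) = (ts, k)"
proof -
  show "build i (ts, k) \<in> stacks"
    using assms rep_res[OF assms(3)] rep_eq_one_iff[OF assms(3)] by (auto simp: build_def stacks_def)
  show "peel i (build i (ts, k)) = (ts, k)"
  proof (cases "k \<in> \<phi> i ` carrier A")
    case True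
    then have "rep i k = \<one>\<^bsub>K i\<^esub>" by (simp add: rep_def)
    then have "\<phi> i (res i k) = k" using rep_res[OF assms(3)] by simp
    then show ?thesis using True assms(2) by (cases ts) (auto simp: build_def)
  next
    case False
    then show ?thesis using rep_res[OF assms(3)] by (simp add: build_def)
  qed
qed

lemma res_\<phi>:
  assumes "a \<in> carrier A"
  shows "res i (\<phi> i a) = a"
proof -
  have "rep i \<one>\<^bsub>K i\<^esub> = \<one>\<^bsub>K i\<^esub>"
    using rep_mult[of "\<one>\<^bsub>K i\<^esub>" i "\<one>\<^bsub>A\<^esub>"] rep_eq_one_iff[of "\<one>\<^bsub>K i\<^esub>" i] imageI[of "\<one>\<^bsub>A\<^esub>" "carrier A" "\<phi> i"]
    by simp
  then show ?thesis using res_mult[of "\<one>\<^bsub>K i\<^esub>" i a] assms by simp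
qed

lemma stack_top_notin: "stack ((i, t) # ts) \<Longrightarrow> t \<notin> \<phi> i ` carrier A"
  using rep_eq_one_iff[of t i] by auto

lemma stack_act_embedding:
  assumes "(ts, a) \<in> stacks" "b \<in> carrier A"
  shows "stack_act i (ts, a) (\<phi> i b) = (ts, a \<otimes>\<^bsub>A\<^esub> b)"
proof (cases "ts \<noteq> [] \<and> fst (hd ts) = i")
  case True
  then obtain t ts' where ts: "ts = (i, t) # ts'" by (cases ts) auto
  have t: "t \<in> carrier (K i)" "rep i t = t" "t \<notin> \<phi> i ` carrier A" and a: "a \<in> carrier A"
    using assms ts stack_top_notin[of i t ts'] by (auto simp: stacks_def)
  have "t \<otimes>\<^bsub>K i\<^esub> \<phi> i a \<otimes>\<^bsub>K i\<^esub> \<phi> i b = t \<otimes>\<^bsub>K i\<^esub> \<phi> i (a \<otimes>\<^bsub>A\<^esub> b)"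
    using t a assms(2) by (simp add: K_assoc)
  moreover have ab: "a \<otimes>\<^bsub>A\<^esub> b \<in> carrier A" using a assms(2) by simp
  ultimately show ?thesis
    using t ts mult_embedding_iff[OF t(1) ab] rep_mult[OF t(1) ab] res_mult[OF t(1,2) ab]
    by (simp add: stack_act_def build_def del: A_simps(5))
next
  case False
  have a: "a \<in> carrier A" using assms by (simp add: stacks_def)
  have "peel i (ts, a) = (ts, \<phi> i a)" using False by (cases "(i, (ts, a))" rule: peel.cases) auto
  then show ?thesis
    using a assms(2) res_\<phi>[of "a \<otimes>\<^bsub>A\<^esub> b" i] imageI[of "a \<otimes>\<^bsub>A\<^esub> b" "carrier A" "\<phi> i"]
    by (simp add: stack_act_def build_def)
qed

text \<open>
  Both factors act by right multiplication in the coordinates given by \<open>peel\<close>, and either way an element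
  of \<open>A\<close> only changes the last component. Hence the amalgamated product acts on normal forms, and the
  normal form of an element is well defined as the image of the empty stack.
\<close>

lemma stacks_action: "amalgam_action stacks stack_act"
  unfolding amalgam_action_def
proof (intro conjI allI ballI)
  fix i
  interpret Group.group "K i" by (rule group_K)
  show "right_action (K i) stacks (stack_act i)"
  proof unfold_locales
    fix \<omega> k assume \<omega>: "\<omega> \<in> stacks" and k: "k \<in> carrier (K i)"
    obtain ts x where p: "peel i \<omega> = (ts, x)" by fastforce
    note ps = peel_stack[OF \<omega> p]
    show "stack_act i \<omega> k \<in> stacks"
      using build_stack(1)[OF ps(1,2)] ps(3) k p by (simp add: stack_act_def)
    fix l assume l: "l \<in> carrier (K i)"
    show "stack_act i (stack_act i \<omega> k) l = stack_act i \<omega> (k \<otimes>\<^bsub>K i\<^esub> l)"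
      using build_stack(2)[OF ps(1,2)] ps(3) k l p by (simp add: stack_act_def K_assoc)
  next
    fix \<omega> assume \<omega>: "\<omega> \<in> stacks"
    then show "stack_act i \<omega> \<one>\<^bsub>K i\<^esub> = \<omega>"
      using stack_act_embedding[of "fst \<omega>" "snd \<omega>" "\<one>\<^bsub>A\<^esub>" i] group_A
      by (auto simp: stacks_def group.is_monoid)
  qed
next
  fix \<omega> a assume "\<omega> \<in> stacks" "a \<in> carrier A"
  then show "stack_act True \<omega> (\<phi> True a) = stack_act False \<omega> (\<phi> False a)"
    using stack_act_embedding[of "fst \<omega>" "snd \<omega>" a] by simp
qed

lemma stack_push:
  assumes "(ts, a) \<in> stacks" "ts \<noteq> [] \<Longrightarrow> fst (hd ts) \<noteq> i" "k \<in> carrier (K i)" "k \<notin> \<phi> i ` carrier A"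
  obtains t b where "stack_act i (ts, a) k = ((i, t) # ts, b)"
proof -
  have p: "peel i (ts, a) = (ts, \<phi> i a)" using assms(2) by (cases "(i, (ts, a))" rule: peel.cases) auto
  have a: "a \<in> carrier A" using assms(1) by (simp add: stacks_def)
  have "\<phi> i a \<otimes>\<^bsub>K i\<^esub> k \<notin> \<phi> i ` carrier A"
  proof
    assume "\<phi> i a \<otimes>\<^bsub>K i\<^esub> k \<in> \<phi> i ` carrier A"
    then obtain b where b: "b \<in> carrier A" "\<phi> i a \<otimes>\<^bsub>K i\<^esub> k = \<phi> i b" by blast
    have "\<phi> i (inv\<^bsub>A\<^esub> a \<otimes>\<^bsub>A\<^esub> b) = inv\<^bsub>K i\<^esub> (\<phi> i a) \<otimes>\<^bsub>K i\<^esub> (\<phi> i a \<otimes>\<^bsub>K i\<^esub> k)"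
      using a b by simp
    also have "\<dots> = k" using a assms(3) by (simp flip: K_assoc)
    finally show False
      using a b(1) assms(4) imageI[of "inv\<^bsub>A\<^esub> a \<otimes>\<^bsub>A\<^esub> b" "carrier A" "\<phi> i"] by simp
  qed
  then show ?thesis using that p by (simp add: stack_act_def build_def)
qed

text \<open>
  Reading a reduced sequence never removes anything from the stack, provided that its first syllable is
  in another factor than the top.
\<close>

lemma run_reduced_push:
  assumes "reduced v" "(ts, a) \<in> stacks" "v \<noteq> [] \<Longrightarrow> ts \<noteq> [] \<Longrightarrow> fst (hd ts) \<noteq> fst (hd v)"
  shows "\<exists>ts' b. run stack_act (ts, a) v = (ts' @ ts, b) \<and> length ts' = length v \<and>
    (v \<noteq> [] \<longrightarrow> fst (hd ts') = fst (last v))"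
  using assms
proof (induction v arbitrary: ts a rule: reduced.induct)
  case (2 i k v)
  obtain t b where tb: "stack_act i (ts, a) k = ((i, t) # ts, b)"
    using stack_push[of ts a i k] 2 by auto
  have "((i, t) # ts, b) \<in> stacks"
    using amalgam_actionD(1)[OF stacks_action 2(3), of k i] 2(2) tb by auto
  then obtain ts' c where "run stack_act ((i, t) # ts, b) v = (ts' @ (i, t) # ts, c)"
      "length ts' = length v" "v \<noteq> [] \<longrightarrow> fst (hd ts') = fst (last v)"
    using 2(1)[of "(i, t) # ts" b] 2(2) by auto
  then show ?case
    using tb by (intro exI[of _ "ts' @ [(i, t)]"] exI[of _ c]) (cases ts'; auto)
qed simp

text \<open>
  While the normal form of \<open>v\<close> is computed syllable by syllable, each entry of the stack is created at
  some moment when a prefix \<open>x\<close> of \<open>v\<close> has been read. The stack up to that entry then represents \<open>x\<close> up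
  to an element of \<open>A\<close>. In an arbitrary action this means that the points reached by the normal form
  are, up to \<open>A\<close>, points on the path of \<open>v\<close>.
\<close>

lemma run_stack_trace:
  assumes F: "amalgam_action Z F" and z: "z \<in> Z"
    and "v \<in> syllables" "run stack_act ([], \<one>\<^bsub>A\<^esub>) v = (ts, a)"
  shows "F i (run F z (rev ts)) (\<phi> i a) = run F z v"
    and "ts = us @ ws \<Longrightarrow> \<exists>x y b. v = x @ y \<and> b \<in> carrier A \<and>
      run F z (rev ws) = F True (run F z x) (\<phi> True b)"
proof -
  have "(\<forall>i. F i (run F z (rev ts)) (\<phi> i a) = run F z v) \<and>
    (\<forall>us ws. ts = us @ ws \<longrightarrow> (\<exists>x y b. v = x @ y \<and> b \<in> carrier A \<and>
      run F z (rev ws) = F True (run F z x) (\<phi> True b)))"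
    using assms(3,4)
  proof (induction v arbitrary: ts a rule: rev_induct)
    case Nil
    have "z = F True z (\<phi> True \<one>\<^bsub>A\<^esub>)" using amalgam_actionD(2)[OF F z] by simp
    then show ?case using Nil amalgam_actionD(2)[OF F z] by (auto intro!: exI[of _ "\<one>\<^bsub>A\<^esub>"])
  next
    case (snoc s v)
    obtain i k where s: "s = (i, k)" by (cases s)
    have k: "k \<in> carrier (K i)" and v: "v \<in> syllables" using snoc.prems(1) s by auto
    obtain ts0 a0 where ts0: "run stack_act ([], \<one>\<^bsub>A\<^esub>) v = (ts0, a0)" by fastforce
    have st0: "(ts0, a0) \<in> stacks"
      using run_closed[OF stacks_action _ v, of "([], \<one>\<^bsub>A\<^esub>)"] ts0 by (simp add: stacks_def)
    have IH1: "F j (run F z (rev ts0)) (\<phi> j a0) = run F z v" for j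
      using snoc.IH[OF v ts0] by blast
    have IH2: "\<exists>x y b. v = x @ y \<and> b \<in> carrier A \<and>
        run F z (rev ws) = F True (run F z x) (\<phi> True b)" if "ts0 = us @ ws" for us ws
      using snoc.IH[OF v ts0] that by blast
    obtain ts1 x where p: "peel i (ts0, a0) = (ts1, x)" by fastforce
    note ps = peel_stack[OF st0 p]
    have a0: "a0 \<in> carrier A" using st0 by (simp add: stacks_def)
    have sub: "\<exists>us. ts0 = us @ ts1"
      using p by (cases "(i, (ts0, a0))" rule: peel.cases) (auto split: if_splits)
    have syl: "rev us \<in> syllables" if "stack us" for us
      using that by (induction us rule: stack.induct) auto
    let ?z1 = "run F z (rev ts1)"
    have z1: "?z1 \<in> Z" using run_closed[OF F z] syl ps(1) by blast
    have peel_eq: "F i ?z1 x = run F z v"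
    proof (cases "\<exists>t. ts0 = (i, t) # ts1")
      case True
      then obtain t where t: "ts0 = (i, t) # ts1" by blast
      then have "x = t \<otimes>\<^bsub>K i\<^esub> \<phi> i a0" "t \<in> carrier (K i)"
        using p st0 by (auto simp: stacks_def)
      then show ?thesis using IH1[of i] t amalgam_actionD(3)[OF F z1] a0 by simp
    next
      case False
      then have "ts1 = ts0" "x = \<phi> i a0"
        using p by (cases "(i, (ts0, a0))" rule: peel.cases; auto split: if_splits)+
      then show ?thesis using IH1 by simp
    qed
    let ?k = "x \<otimes>\<^bsub>K i\<^esub> k"
    have kk: "?k \<in> carrier (K i)" using ps(3) k by simp
    have run_k: "F i ?z1 ?k = run F z (v @ [(i, k)])"
      using peel_eq amalgam_actionD(3)[OF F z1 ps(3) k] by simp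
    have ts_a: "build i (ts1, ?k) = (ts, a)"
    proof -
      have "stack_act i (ts0, a0) k = (ts, a)" using snoc.prems(2) s ts0 by simp
      then show ?thesis using p by (simp add: stack_act_def)
    qed
    have old: "\<exists>x y b. v @ [s] = x @ y \<and> b \<in> carrier A \<and>
        run F z (rev ws) = F True (run F z x) (\<phi> True b)" if ws: "ts1 = us @ ws" for us ws
    proof -
      obtain us0 where "ts0 = us0 @ ts1" using sub by blast
      then obtain x y b where "v = x @ y" "b \<in> carrier A"
          "run F z (rev ws) = F True (run F z x) (\<phi> True b)"
        using IH2[of "us0 @ us" ws] ws by auto
      then show ?thesis by (intro exI[of _ x] exI[of _ "y @ [s]"] exI[of _ b]) simp
    qed
    show ?case
    proof (cases "?k \<in> \<phi> i ` carrier A")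
      case True
      then have "ts = ts1" "a = res i ?k" using ts_a by (auto simp: build_def)
      moreover have "\<phi> i (res i ?k) = ?k" using True res_\<phi> by auto
      ultimately have "F i (run F z (rev ts)) (\<phi> i a) = run F z (v @ [s])" "a \<in> carrier A"
        using run_k s rep_res(1)[OF kk] by auto
      then have "F j (run F z (rev ts)) (\<phi> j a) = run F z (v @ [s])" for j
        using amalgam_actionD(4)[OF F z1, of a i j] \<open>ts = ts1\<close> by simp
      then show ?thesis using old \<open>ts = ts1\<close> by blast
    next
      case False
      let ?t = "rep i ?k"
      have ts: "ts = (i, ?t) # ts1" and a: "a = res i ?k" using ts_a False by (auto simp: build_def)
      have aA: "a \<in> carrier A" and ta: "?t \<otimes>\<^bsub>K i\<^esub> \<phi> i a = ?k" using rep_res[OF kk] a by auto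
      have z2: "run F z (rev ts) \<in> Z"
        using ts z1 kk amalgam_actionD(1)[OF F z1] by simp
      have 1: "F i (run F z (rev ts)) (\<phi> i a) = run F z (v @ [s])"
        using ts ta kk aA amalgam_actionD(3)[OF F z1] run_k s by simp
      have all: "F j (run F z (rev ts)) (\<phi> j a) = run F z (v @ [s])" for j
        using amalgam_actionD(4)[OF F z2 aA, of i j] 1 by simp
      have "F True (run F z (v @ [s])) (\<phi> True (inv\<^bsub>A\<^esub> a)) = run F z (rev ts)"
        using all[of True, symmetric] aA amalgam_actionD(2,3)[OF F z2] by simp
      then have "\<exists>x y b. v @ [s] = x @ y \<and> b \<in> carrier A \<and>
          run F z (rev ts) = F True (run F z x) (\<phi> True b)"
        using aA by (intro exI[of _ "v @ [s]"] exI[of _ "[]"] exI[of _ "inv\<^bsub>A\<^esub> a"]) simp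
      then have "\<exists>x y b. v @ [s] = x @ y \<and> b \<in> carrier A \<and>
          run F z (rev ws) = F True (run F z x) (\<phi> True b)" if "ts = us @ ws" for us ws
        using that ts old by (cases us) auto
      then show ?thesis using all by blast
    qed
  qed
  then show "F i (run F z (rev ts)) (\<phi> i a) = run F z v"
    and "ts = us @ ws \<Longrightarrow> \<exists>x y b. v = x @ y \<and> b \<in> carrier A \<and>
      run F z (rev ws) = F True (run F z x) (\<phi> True b)"
    by blast+
qed

definition syl_power :: "(bool \<times> 'k) list \<Rightarrow> nat \<Rightarrow> (bool \<times> 'k) list" where
  "syl_power v n = concat (replicate n v)"

lemma syl_power_simps [simp]: "syl_power v 0 = []" "syl_power v (Suc n) = v @ syl_power v n"
  by (simp_all add: syl_power_def)

lemma syl_power_add: "syl_power v (m + n) = syl_power v m @ syl_power v n"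
  by (simp add: syl_power_def replicate_add)

lemma length_power: "length (syl_power v n) = n * length v"
  by (induction n) auto

lemma power_syllables: "v \<in> syllables \<Longrightarrow> syl_power v n \<in> syllables"
  by (induction n) auto

lemma hd_power: "v \<noteq> [] \<Longrightarrow> n > 0 \<Longrightarrow> hd (syl_power v n) = hd v"
  by (cases n) auto

lemma last_power: "v \<noteq> [] \<Longrightarrow> n > 0 \<Longrightarrow> last (syl_power v n) = last v"
proof -
  assume "v \<noteq> []" "n > 0"
  moreover have "syl_power v n = syl_power v (n - 1) @ v" if "n > 0"
    using syl_power_add[of v "n - 1" 1] that by simp
  ultimately show ?thesis by simp
qed

text \<open>
  Having its first and last syllable in different factors, such a sequence has even length, and all
  its powers are reduced.
\<close>

definition cyclically_reduced :: "(bool \<times> 'k) list \<Rightarrow> bool" where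
  "cyclically_reduced c \<longleftrightarrow> c \<noteq> [] \<and> reduced c \<and> fst (last c) \<noteq> fst (hd c)"

lemma reduced_power:
  assumes "cyclically_reduced c"
  shows "reduced (syl_power c n)"
proof (induction n)
  case (Suc n)
  then show ?case
    using assms hd_power[of c n] by (cases n) (auto simp: cyclically_reduced_def reduced_append)
qed simp

lemma empty_stack: "([], \<one>\<^bsub>A\<^esub>) \<in> stacks"
  by (simp add: stacks_def)

text \<open>
  For \<open>i \<le> n\<close> the normal form of \<open>c\<^sup>i\<close> is an initial part of that of \<open>c\<^sup>n\<close>, up to the final element of \<open>A\<close>.
\<close>

lemma run_stack_power:
  assumes "cyclically_reduced c" "i \<le> n"
  shows "\<exists>ts a us b. run stack_act ([], \<one>\<^bsub>A\<^esub>) (syl_power c i) = (ts, a) \<and>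
    run stack_act ([], \<one>\<^bsub>A\<^esub>) (syl_power c n) = (us @ ts, b) \<and> length ts = i * length c"
proof -
  obtain ts a where ts: "run stack_act ([], \<one>\<^bsub>A\<^esub>) (syl_power c i) = (ts, a)" "length ts = i * length c"
    "syl_power c i \<noteq> [] \<longrightarrow> fst (hd ts) = fst (last (syl_power c i))"
    using run_reduced_push[OF reduced_power[OF assms(1), of i] empty_stack] by (auto simp: length_power)
  have st: "(ts, a) \<in> stacks"
    using run_closed[OF stacks_action empty_stack reduced_syllables[OF reduced_power[OF assms(1), of i]]] ts(1)
    by simp
  have "fst (hd ts) \<noteq> fst (hd (syl_power c (n - i)))" if "syl_power c (n - i) \<noteq> []" "ts \<noteq> []"
  proof -
    have "i > 0" "n - i > 0" "c \<noteq> []"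
      using that ts(2) assms(1) by (cases i; cases "n - i"; auto simp: cyclically_reduced_def)+
    moreover from this have "syl_power c i \<noteq> []" by (cases i) auto
    ultimately show ?thesis
      using ts(3) assms(1) hd_power[of c "n - i"] last_power[of c i]
      by (simp add: cyclically_reduced_def)
  qed
  then obtain us b where "run stack_act (ts, a) (syl_power c (n - i)) = (us @ ts, b)"
    using run_reduced_push[OF reduced_power[OF assms(1), of "n - i"] st] by blast
  moreover have "syl_power c n = syl_power c i @ syl_power c (n - i)"
    using assms(2) by (simp flip: syl_power_add)
  ultimately show ?thesis using ts by auto
qed

lemma power_not_trivial:
  assumes "cyclically_reduced c" "n \<ge> 1"
  shows "\<not> syl_power c n \<approx> []"
proof
  assume "syl_power c n \<approx> []"
  then have "run stack_act ([], \<one>\<^bsub>A\<^esub>) (syl_power c n) = ([], \<one>\<^bsub>A\<^esub>)"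
    using run_cong[OF stacks_action _ empty_stack] by fastforce
  moreover obtain ts b where "run stack_act ([], \<one>\<^bsub>A\<^esub>) (syl_power c n) = (ts, b)"
    "length ts = n * length c"
    using run_stack_power[OF assms(1), of n n] by auto
  ultimately show False using assms by (auto simp: cyclically_reduced_def)
qed

text \<open>
  The normal form of \<open>v\<close> is that of \<open>c\<^sup>n\<close>, which passes through \<open>c\<^sup>i\<close> up to \<open>A\<close>. Thus the point
  \<open>z c\<^sup>i\<close> is close to the path of any sequence \<open>v\<close> that represents \<open>c\<^sup>n\<close>.
\<close>

lemma power_orbit_near_path:
  assumes F: "amalgam_action Z F" and z: "z \<in> Z" and c: "cyclically_reduced c"
    and v: "v \<approx> syl_power c n" and i: "i \<le> n"
  shows "\<exists>x y b. v = x @ y \<and> b \<in> carrier A \<and>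
    run F z (syl_power c i) = F True (run F z x) (\<phi> True b)"
proof -
  obtain ts a us a' where ts: "run stack_act ([], \<one>\<^bsub>A\<^esub>) (syl_power c i) = (ts, a)"
    "run stack_act ([], \<one>\<^bsub>A\<^esub>) (syl_power c n) = (us @ ts, a')"
    using run_stack_power[OF c i] by blast
  have syl: "syl_power c i \<in> syllables" "v \<in> syllables"
    using reduced_syllables[OF reduced_power[OF c]] syl_eq_syllables[OF v] by auto
  have "run stack_act ([], \<one>\<^bsub>A\<^esub>) v = (us @ ts, a')"
    using run_cong[OF stacks_action v empty_stack] ts(2) by simp
  from run_stack_trace(2)[OF F z syl(2) this HOL.refl] obtain x y b where
    x: "v = x @ y" "b \<in> carrier A" "run F z (rev ts) = F True (run F z x) (\<phi> True b)"
    by blast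
  have "(ts, a) \<in> stacks"
    using run_closed[OF stacks_action empty_stack syl(1)] ts(1) by simp
  then have a: "a \<in> carrier A" by (simp add: stacks_def)
  have "run F z x \<in> Z" using run_closed[OF F z, of x] syl(2) x(1) by simp
  then have "F True (run F z (rev ts)) (\<phi> True a) = F True (run F z x) (\<phi> True (b \<otimes>\<^bsub>A\<^esub> a))"
    using amalgam_actionD(3)[OF F] x a by simp
  then have "run F z (syl_power c i) = F True (run F z x) (\<phi> True (b \<otimes>\<^bsub>A\<^esub> a))"
    using run_stack_trace(1)[OF F z syl(1) ts(1), of True] by simp
  then show ?thesis using x a by (intro exI[of _ x] exI[of _ y] exI[of _ "b \<otimes>\<^bsub>A\<^esub> a"]) simp
qed

text \<open>
  Before the first return the points \<open>z c\<^sup>i\<close> are pairwise distinct, and all of them lie in the set \<open>V A\<close>.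
  The bound does not depend on \<open>n\<close>, nor on the length of \<open>v\<close>.
\<close>

lemma first_return_bound:
  assumes F: "amalgam_action Z F" and z: "z \<in> Z" and c: "cyclically_reduced c"
    and v: "v \<approx> syl_power c n" "run F z v = z" and n: "n \<ge> 1"
    and V: "finite V" "\<And>x y. v = x @ y \<Longrightarrow> run F z x \<in> V"
  shows "\<exists>m\<ge>1. m \<le> card V * card (carrier A) \<and> run F z (syl_power c m) = z"
proof -
  define m where "m = (LEAST m. m \<ge> 1 \<and> run F z (syl_power c m) = z)"
  have "n \<ge> 1 \<and> run F z (syl_power c n) = z"
    using n v run_cong[OF F v(1) z] by simp
  then have m: "m \<ge> 1" "run F z (syl_power c m) = z" "m \<le> n"
    unfolding m_def using LeastI[of "\<lambda>m. m \<ge> 1 \<and> run F z (syl_power c m) = z" n]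
    by (auto intro: Least_le)
  have least: "run F z (syl_power c i) \<noteq> z" if "i \<ge> 1" "i < m" for i
    using that not_less_Least[of i "\<lambda>m. m \<ge> 1 \<and> run F z (syl_power c m) = z"] by (auto simp: m_def)
  have csyl: "syl_power c i \<in> syllables" for i using reduced_syllables[OF reduced_power[OF c]] .
  have ne: "run F z (syl_power c i) \<noteq> run F z (syl_power c j)" if "i < j" "j < m" for i j
  proof
    assume eq: "run F z (syl_power c i) = run F z (syl_power c j)"
    have "syl_power c j = syl_power c (j - i) @ syl_power c i" using that by (simp flip: syl_power_add)
    then have "run F z (syl_power c i) = run F (run F z (syl_power c (j - i))) (syl_power c i)" using eq by simp
    then have "z = run F z (syl_power c (j - i))"
      using run_inv_syl(1)[OF F _ csyl[of i]] z run_closed[OF F z csyl] by metis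
    moreover have "j - i \<ge> 1" "j - i < m" using that by auto
    ultimately show False using least[of "j - i"] by metis
  qed
  have "inj_on (\<lambda>i. run F z (syl_power c i)) {..<m}"
    by (rule linorder_inj_onI) (use ne in auto)
  moreover have "(\<lambda>i. run F z (syl_power c i)) ` {..<m} \<subseteq> (\<lambda>(p, a). F True p (\<phi> True a)) ` (V \<times> carrier A)"
  proof (rule image_subsetI)
    fix i assume "i \<in> {..<m}"
    then obtain x y b where "v = x @ y" "b \<in> carrier A"
        "run F z (syl_power c i) = F True (run F z x) (\<phi> True b)"
      using power_orbit_near_path[OF F z c v(1), of i] m(3) by auto
    then show "run F z (syl_power c i) \<in> (\<lambda>(p, a). F True p (\<phi> True a)) ` (V \<times> carrier A)"
      using V(2) by (intro image_eqI[of _ _ "(run F z x, b)"]) auto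
  qed
  ultimately have "m \<le> card ((\<lambda>(p, a). F True p (\<phi> True a)) ` (V \<times> carrier A))"
    using V(1) finite_A by (metis card_inj_on_le card_lessThan finite_SigmaI finite_imageI)
  also have "\<dots> \<le> card V * card (carrier A)"
    using V(1) finite_A by (metis card_cartesian_product card_image_le finite_SigmaI)
  finally show ?thesis using m(1,2) by blast
qed

end

section \<open>The presented group as an amalgam\<close>

lemma inv_word_simps [simp]:
  "inv_word [] = []"
  "inv_word (v @ w) = inv_word w @ inv_word v"
  "inv_word (inv_word w) = w"
  "length (inv_word w) = length w"
  by (simp_all add: inv_word_def rev_map) (simp add: map_idI split: prod.splits)

lemma pres_eq_inv_word': "w \<in> words X \<Longrightarrow> pres_eq X R (w @ inv_word w) []"
  using pres_eq_inv_word[of "inv_word w" X R] by simp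

lemma pres_eq_inv_cong:
  assumes "pres_eq X R v w"
  shows "pres_eq X R (inv_word v) (inv_word w)"
proof -
  have vw: "v \<in> words X" "w \<in> words X" using pres_eq_in_words[OF assms] by auto
  have "pres_eq X R (inv_word v @ (w @ inv_word w) @ []) (inv_word v @ [] @ [])"
    by (rule pres_eq_context[OF pres_eq_inv_word']) (use vw in auto)
  then have 1: "pres_eq X R (inv_word v) (inv_word v @ w @ inv_word w)"
    using pres_eq.sym by simp
  have "pres_eq X R (inv_word v @ v @ inv_word w) (inv_word v @ w @ inv_word w)"
    by (rule pres_eq_context[OF assms]) (use vw in auto)
  then have 2: "pres_eq X R (inv_word v @ w @ inv_word w) (inv_word v @ v @ inv_word w)"
    by (rule pres_eq.sym)
  have 3: "pres_eq X R ((inv_word v @ v) @ inv_word w) ([] @ inv_word w)"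
    by (rule pres_eq_append[OF pres_eq_inv_word pres_eq.refl]) (use vw in auto)
  show ?thesis using pres_eq.trans[OF 1 pres_eq.trans[OF 2]] 3 by simp
qed

lemma pres_eq_cancel_right:
  assumes "pres_eq X R (v @ inv_word w) []" "v \<in> words X" "w \<in> words X"
  shows "pres_eq X R v w"
proof -
  have "pres_eq X R (v @ (inv_word w @ w)) (v @ [])"
    by (rule pres_eq_append[OF pres_eq.refl pres_eq_inv_word]) (use assms in auto)
  then have "pres_eq X R v ((v @ inv_word w) @ w)" using pres_eq.sym by simp
  moreover have "pres_eq X R ((v @ inv_word w) @ w) ([] @ w)"
    by (rule pres_eq_append[OF assms(1) pres_eq.refl[OF assms(3)]])
  ultimately show ?thesis using pres_eq.trans by fastforce
qed

lemma words_Cons [simp]: "(x, b) # w \<in> words X \<longleftrightarrow> x \<in> X \<and> w \<in> words X"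
  by (auto simp: words_def)

text \<open>
  A presentation maps to another one as soon as its relators become trivial there.
\<close>

lemma pres_eq_embed:
  assumes "X \<subseteq> X'" "\<And>r. r \<in> R \<Longrightarrow> r \<in> words X \<Longrightarrow> pres_eq X' R' r []"
  shows "pres_eq X R v w \<Longrightarrow> pres_eq X' R' v w"
proof (induction rule: pres_eq.induct)
  have mono: "w \<in> words X \<Longrightarrow> w \<in> words X'" for w using assms(1) by (auto simp: words_def)
  {
    case (refl w)
    then show ?case using mono pres_eq.refl by blast
  next
    case (cancel u v x b)
    then show ?case using mono assms(1) by (intro pres_eq.cancel) auto
  next
    case (relator u v r)
    then show ?case
      using pres_eq_context[OF assms(2), of r u v] mono by simp
  }
qed (auto intro: pres_eq.sym pres_eq.trans)

text \<open>
  Permutations of a set that satisfy the relators give an action of the presented group.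
\<close>

lemma foldl_pres_eq:
  assumes closed: "\<And>z x b. z \<in> Z \<Longrightarrow> x \<in> X \<Longrightarrow> L z (x, b) \<in> Z"
    and cancel: "\<And>z x b. z \<in> Z \<Longrightarrow> x \<in> X \<Longrightarrow> L (L z (x, b)) (x, \<not> b) = z"
    and rel: "\<And>z r. z \<in> Z \<Longrightarrow> r \<in> R \<Longrightarrow> foldl L z r = z"
  shows "pres_eq X R v w \<Longrightarrow> z \<in> Z \<Longrightarrow> foldl L z v = foldl L z w"
proof (induction arbitrary: z rule: pres_eq.induct)
  have cl: "foldl L z w \<in> Z" if "w \<in> words X" "z \<in> Z" for z w
    using that by (induction w arbitrary: z) (auto simp: closed)
  {
    case (cancel u v x b)
    then show ?case using cl assms(2) by simp
  next
    case (relator u v r)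
    then show ?case using cl rel by simp
  }
qed auto

context finite_amalgam
begin

definition alphabet :: "bool \<Rightarrow> 'x set" where "alphabet i = (if i then X1 else X2)"
definition factor_relators :: "bool \<Rightarrow> 'x word set" where "factor_relators i = (if i then R1 else R2)"
definition factor :: "bool \<Rightarrow> 'x word set monoid" where
  "factor i = presented_group (alphabet i) (factor_relators i)"
definition embedding :: "bool \<Rightarrow> 'a \<Rightarrow> 'x word set" where "embedding i = (if i then \<phi>1 else \<phi>2)"

abbreviation X :: "'x set" where "X \<equiv> X1 \<union> X2"
abbreviation R :: "'x word set" where "R \<equiv> amalgam_relators R1 R2 Y \<phi>1 \<phi>2"
abbreviation G :: "'x word set monoid" where "G \<equiv> presented_group X R"
abbreviation cls :: "'x word \<Rightarrow> 'x word set" where "cls \<equiv> word_class X R"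
abbreviation factor_cls :: "bool \<Rightarrow> 'x word \<Rightarrow> 'x word set" where
  "factor_cls i \<equiv> word_class (alphabet i) (factor_relators i)"
abbreviation factor_eq :: "bool \<Rightarrow> 'x word \<Rightarrow> 'x word \<Rightarrow> bool" where
  "factor_eq i \<equiv> pres_eq (alphabet i) (factor_relators i)"

sublocale amalgam factor A embedding
proof (rule amalgam.intro)
  show "Group.group A" by (rule group_A)
  show "Group.group (factor i)" for i by (simp add: factor_def group_presented_group)
  show "finite (carrier (factor i))" for i
    using finite_factors by (simp add: factor_def alphabet_def factor_relators_def)
  show "embedding i \<in> mon A (factor i)" for i
    using monomorphisms by (simp add: embedding_def factor_def alphabet_def factor_relators_def)
qed

notation syl_eq (infix "\<approx>" 50)

sublocale G: Group.group G
  by (rule group_presented_group)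

lemma factor_cls_simps:
  "v \<in> words (alphabet i) \<Longrightarrow> factor_cls i v \<in> carrier (factor i)"
  "\<one>\<^bsub>factor i\<^esub> = factor_cls i []"
  "v \<in> words (alphabet i) \<Longrightarrow> w \<in> words (alphabet i) \<Longrightarrow>
    factor_cls i v \<otimes>\<^bsub>factor i\<^esub> factor_cls i w = factor_cls i (v @ w)"
  by (simp_all add: factor_def carrier_presented_group one_presented_group mult_presented_group)

lemma cls_simps:
  "v \<in> words X \<Longrightarrow> cls v \<in> carrier G"
  "\<one>\<^bsub>G\<^esub> = cls []"
  "v \<in> words X \<Longrightarrow> w \<in> words X \<Longrightarrow> cls v \<otimes>\<^bsub>G\<^esub> cls w = cls (v @ w)"
  by (simp_all add: carrier_presented_group one_presented_group mult_presented_group)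

lemma factor_elem_cls:
  assumes "k \<in> carrier (factor i)" "u \<in> k"
  shows "u \<in> words (alphabet i)" "k = factor_cls i u"
proof -
  obtain v where v: "v \<in> words (alphabet i)" "k = factor_cls i v"
    using assms(1) unfolding factor_def carrier_presented_group by blast
  then have *: "factor_eq i v u" using assms(2) by (simp add: word_class_def pres_rel_def)
  then show u: "u \<in> words (alphabet i)" using pres_eq_in_words by blast
  show "k = factor_cls i u" using v * u by (simp add: word_class_eq_iff)
qed

lemma factor_elem_nonempty:
  assumes "k \<in> carrier (factor i)"
  shows "\<exists>u. u \<in> k"
proof -
  obtain v where v: "v \<in> words (alphabet i)" "k = factor_cls i v"
    using assms(1) unfolding factor_def carrier_presented_group by blast
  then have "v \<in> k" using pres_eq.refl by (auto simp: word_class_def pres_rel_def)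
  then show ?thesis ..
qed

lemma words_alphabet: "w \<in> words (alphabet i) \<Longrightarrow> w \<in> words X"
  by (auto simp: words_def alphabet_def split: if_splits)

lemma generator_alphabet: "x \<in> X \<Longrightarrow> \<exists>i. x \<in> alphabet i"
  using exI[of "\<lambda>i. x \<in> alphabet i" True] exI[of "\<lambda>i. x \<in> alphabet i" False]
  by (auto simp: alphabet_def)

lemma factor_eq_imp_eq:
  assumes "factor_eq i v w"
  shows "pres_eq X R v w"
proof (rule pres_eq_embed[OF _ _ assms])
  show "alphabet i \<subseteq> X" by (auto simp: alphabet_def)
  fix r assume "r \<in> factor_relators i" "r \<in> words (alphabet i)"
  then show "pres_eq X R r []"
    using pres_eq.relator[of "[]" X "[]" r R] words_alphabet[of r i]
    by (auto simp: amalgam_relators_def factor_relators_def split: if_splits)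
qed

definition letter :: "'x \<times> bool \<Rightarrow> bool \<times> 'x word set" where
  "letter s = (fst s \<in> X1, factor_cls (fst s \<in> X1) [s])"

abbreviation syl :: "'x word \<Rightarrow> (bool \<times> 'x word set) list" where
  "syl \<equiv> map letter"

lemma letter_syllable: "x \<in> X \<Longrightarrow> [letter (x, b)] \<in> syllables"
  by (auto simp: letter_def intro!: factor_cls_simps) (auto simp: alphabet_def)

lemma syl_syllables: "w \<in> words X \<Longrightarrow> syl w \<in> syllables"
proof (induction w)
  case (Cons s w)
  obtain x b where s: "s = (x, b)" by (cases s)
  have "[letter s] @ syl w \<in> syllables"
    unfolding syllables_simps(3) using Cons s letter_syllable by auto
  then show ?case by simp
qed simp

lemma letter_alphabet: "x \<in> alphabet i \<Longrightarrow> letter (x, b) = (i, factor_cls i [(x, b)])"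
  using disjoint_alphabets by (auto simp: letter_def alphabet_def split: if_splits)

lemma syl_factor: "w \<in> words (alphabet i) \<Longrightarrow> syl w \<approx> [(i, factor_cls i w)]"
proof (induction w)
  case Nil
  show ?case using drop_one[of "[]" "[]" i] by (simp add: factor_cls_simps syl_sym)
next
  case (Cons s w)
  obtain x b where s: "s = (x, b)" by (cases s)
  have x: "x \<in> alphabet i" and w: "w \<in> words (alphabet i)" using Cons.prems s by auto
  have mem: "factor_cls i [s] \<in> carrier (factor i)" "factor_cls i w \<in> carrier (factor i)"
    using x w s factor_cls_simps(1) by auto
  have "[letter s] @ syl w \<approx> [letter s] @ [(i, factor_cls i w)]"
    by (rule syl_eq_append[OF syl_refl Cons.IH[OF w]])
      (use letter_syllable[of x b] x s in \<open>auto simp: alphabet_def split: if_splits\<close>)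
  also have "[letter s] @ [(i, factor_cls i w)] \<approx> [(i, factor_cls i [s] \<otimes>\<^bsub>factor i\<^esub> factor_cls i w)]"
    using merge[of "[]" "[]" "factor_cls i [s]" i "factor_cls i w"] mem letter_alphabet[OF x] s by simp
  also have "factor_cls i [s] \<otimes>\<^bsub>factor i\<^esub> factor_cls i w = factor_cls i (s # w)"
    using factor_cls_simps(3)[of "[s]" i w] x w s by simp
  finally show ?case by simp
qed

lemma syl_factor_cong: "factor_eq i v w \<Longrightarrow> syl v \<approx> syl w"
proof -
  assume *: "factor_eq i v w"
  then have vw: "v \<in> words (alphabet i)" "w \<in> words (alphabet i)" using pres_eq_in_words by auto
  then have "factor_cls i v = factor_cls i w" using * by (simp add: word_class_eq_iff)
  then have "syl v \<approx> [(i, factor_cls i w)]" using syl_factor[OF vw(1)] by simp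
  also have "[(i, factor_cls i w)] \<approx> syl w" by (rule syl_sym[OF syl_factor[OF vw(2)]])
  finally show ?thesis .
qed

lemma embedding_words:
  assumes "a \<in> carrier A" "u \<in> embedding i a"
  shows "u \<in> words (alphabet i)" "embedding i a = factor_cls i u"
  using factor_elem_cls[OF \<phi>_closed[OF assms(1)] assms(2)] by auto

text \<open>
  The classes \<open>\<phi>i a\<close> consist of words over the alphabet of the factor, hence so do the relators that
  identify the two images of \<open>A\<close>.
\<close>

lemma amalgam_relator_cases:
  assumes "r \<in> R"
  obtains i where "r \<in> factor_relators i" "r \<in> words (alphabet i)"
  | a u v where "a \<in> Y" "a \<in> carrier A" "u \<in> embedding True a" "v \<in> embedding False a" "r = u @ inv_word v"
proof -
  consider "r \<in> factor_relators True" "r \<in> words (alphabet True)"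
    | "r \<in> factor_relators False" "r \<in> words (alphabet False)"
    | a u v where "a \<in> Y" "u \<in> \<phi>1 a" "v \<in> \<phi>2 a" "r = u @ inv_word v"
    using assms relators unfolding amalgam_relators_def factor_relators_def alphabet_def by auto
  then show thesis
    by cases (use that generators_A(1) in \<open>auto simp: embedding_def\<close>)
qed

lemma syl_relator:
  assumes "r \<in> R"
  shows "syl r \<approx> []"
  using assms
proof (cases rule: amalgam_relator_cases)
  case (1 i)
  then have "factor_eq i r []" using pres_eq.relator[of "[]" "alphabet i" "[]" r] by auto
  then show ?thesis using syl_factor_cong by fastforce
next
  case (2 a u v)
  note u = embedding_words[OF 2(2,3)] and v = embedding_words[OF 2(2,4)]
  have "syl u \<approx> [(True, embedding True a)]"
    using syl_factor[OF u(1)] u(2) by simp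
  also have "[(True, embedding True a)] \<approx> [(False, embedding False a)]"
    using transfer[of "[]" "[]" a True False] 2(2) by simp
  also have "[(False, embedding False a)] \<approx> syl v"
    using syl_sym[OF syl_factor[OF v(1)]] v(2) by simp
  finally have "syl u @ syl (inv_word v) \<approx> syl v @ syl (inv_word v)"
    by (rule syl_eq_append[OF _ syl_refl[OF syl_syllables[OF inv_word_in_words[OF words_alphabet[OF v(1)]]]]])
  also have "syl v @ syl (inv_word v) \<approx> []"
    using syl_factor_cong[OF pres_eq_inv_word'[OF v(1)]] by simp
  finally show ?thesis using 2(5) by simp
qed

text \<open>
  Equality in the presented group implies equality of syllable sequences, so that every action in the
  abstract sense gives an action of words.
\<close>

lemma syl_cong: "pres_eq X R v w \<Longrightarrow> syl v \<approx> syl w"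
proof (induction rule: pres_eq.induct)
  case (cancel u v x b)
  obtain i where i: "x \<in> alphabet i"
    using generator_alphabet[OF cancel(3)] ..
  have "factor_eq i [(x, b), (x, \<not> b)] []"
    using pres_eq.cancel[of "[]" "alphabet i" "[]" x] i by simp
  then have "syl [(x, b), (x, \<not> b)] \<approx> []" using syl_factor_cong by fastforce
  from syl_eq_context[OF this, of "syl u" "syl v"] show ?case
    using cancel syl_syllables by simp
next
  case (relator u v r)
  then show ?case
    using syl_eq_context[OF syl_relator, of r "syl u" "syl v"] syl_syllables by simp
qed (auto intro: syl_refl syl_syllables syl_sym syl_trans)

text \<open>
  The canonical map from a factor into \<open>G\<close>.
\<close>

definition inclusion :: "bool \<Rightarrow> 'x word set \<Rightarrow> 'x word set" where
  "inclusion i k = cls (SOME u. u \<in> k)"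

lemma inclusion_cls:
  assumes "u \<in> words (alphabet i)"
  shows "inclusion i (factor_cls i u) = cls u"
proof -
  let ?v = "SOME v. v \<in> factor_cls i u"
  have "?v \<in> factor_cls i u"
    using factor_elem_nonempty[OF factor_cls_simps(1)[OF assms]] by (rule someI_ex)
  then have "factor_eq i u ?v" by (simp add: word_class_def pres_rel_def)
  then have "pres_eq X R u ?v" by (rule factor_eq_imp_eq)
  moreover from this have "u \<in> words X" "?v \<in> words X" using pres_eq_in_words by blast+
  ultimately have "cls u = cls ?v" by (simp add: word_class_eq_iff)
  then show ?thesis by (simp add: inclusion_def)
qed

lemma inclusion_hom: "inclusion i \<in> hom (factor i) G"
proof (rule homI)
  fix k assume "k \<in> carrier (factor i)"
  then obtain u where u: "u \<in> words (alphabet i)" "k = factor_cls i u"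
    using factor_elem_nonempty factor_elem_cls by metis
  then show "inclusion i k \<in> carrier G"
    using words_alphabet by (simp add: inclusion_cls cls_simps)
  fix l assume "l \<in> carrier (factor i)"
  then obtain v where v: "v \<in> words (alphabet i)" "l = factor_cls i v"
    using factor_elem_nonempty factor_elem_cls by metis
  show "inclusion i (k \<otimes>\<^bsub>factor i\<^esub> l) = inclusion i k \<otimes>\<^bsub>G\<^esub> inclusion i l"
    using u v words_alphabet by (simp add: factor_cls_simps inclusion_cls cls_simps)
qed

text \<open>
  The relators express agreement on the generators \<open>Y\<close> only. Both sides are homomorphisms on \<open>A\<close>,
  so they agree everywhere.
\<close>

lemma inclusion_agree:
  assumes "a \<in> carrier A"
  shows "inclusion True (embedding True a) = inclusion False (embedding False a)"
proof -
  interpret T: group_hom A G "\<lambda>a. inclusion True (embedding True a)"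
    using group_A hom_\<phi> inclusion_hom hom_compose[of "embedding True" A "factor True" "inclusion True" G]
    by (simp add: group_hom_def group_hom_axioms_def comp_def)
  interpret F: group_hom A G "\<lambda>a. inclusion False (embedding False a)"
    using group_A hom_\<phi> inclusion_hom hom_compose[of "embedding False" A "factor False" "inclusion False" G]
    by (simp add: group_hom_def group_hom_axioms_def comp_def)
  have sub: "b \<in> carrier A" if "b \<in> generate A Y" for b using that generators_A(2) by simp
  have gen: "inclusion True (embedding True b) = inclusion False (embedding False b)" if "b \<in> Y" for b
  proof -
    have b: "b \<in> carrier A" using that generators_A(1) by blast
    obtain u v where uv: "u \<in> embedding True b" "v \<in> embedding False b"
      using factor_elem_nonempty[OF \<phi>_closed[OF b]] by metis
    note u = embedding_words[OF b uv(1)] and v = embedding_words[OF b uv(2)]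
    have "u @ inv_word v \<in> R"
      using that uv by (auto simp: amalgam_relators_def embedding_def)
    then have "pres_eq X R (u @ inv_word v) []"
      using pres_eq.relator[of "[]" X "[]" "u @ inv_word v" R] u(1) v(1) words_alphabet by auto
    then have "pres_eq X R u v" using u(1) v(1) words_alphabet pres_eq_cancel_right by blast
    then have "cls u = cls v" using u(1) v(1) words_alphabet by (simp add: word_class_eq_iff)
    then show ?thesis using u v by (simp add: inclusion_cls)
  qed
  have "a \<in> generate A Y" using assms generators_A(2) by simp
  then show ?thesis
  proof (induction rule: generate.induct)
    case (inv h)
    then have "h \<in> carrier A" using generators_A(1) by blast
    then show ?case using gen[OF inv] T.hom_inv F.hom_inv by presburger
  next
    case (eng h1 h2)
    then show ?case using sub T.hom_mult F.hom_mult by presburger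
  qed (use gen T.hom_one F.hom_one in auto)
qed

definition pull :: "('z \<Rightarrow> 'x word set \<Rightarrow> 'z) \<Rightarrow> bool \<Rightarrow> 'z \<Rightarrow> 'x word set \<Rightarrow> 'z" where
  "pull f i z k = f z (inclusion i k)"

lemma pull_action:
  assumes "right_action G Z f"
  shows "amalgam_action Z (pull f)"
  unfolding amalgam_action_def
proof (intro conjI allI ballI)
  fix i
  show "right_action (factor i) Z (pull f i)"
    using right_action_hom[OF assms inclusion_hom group_K, of i] by (simp add: pull_def[abs_def])
next
  fix z a assume "a \<in> carrier A"
  then show "pull f True z (embedding True a) = pull f False z (embedding False a)"
    using inclusion_agree by (simp add: pull_def)
qed

lemma run_pull:
  assumes "right_action G Z f" "z \<in> Z" "w \<in> words X"
  shows "run (pull f) z (syl w) = f z (cls w)"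
proof -
  interpret f: right_action G Z f by fact
  show ?thesis
    using assms(2,3)
  proof (induction w arbitrary: z)
    case Nil
    then show ?case using f.act_one by (simp flip: cls_simps(2))
  next
    case (Cons s w)
    obtain x b where s: "s = (x, b)" by (cases s)
    obtain i where x: "x \<in> alphabet i" using Cons.prems s generator_alphabet[of x] by auto
    have w: "[s] \<in> words X" "w \<in> words X" using Cons.prems s by auto
    have "run (pull f) z (syl (s # w)) = run (pull f) (f z (cls [s])) (syl w)"
      using letter_alphabet[OF x] inclusion_cls[of "[s]" i] x s by (simp add: pull_def)
    also have "\<dots> = f (f z (cls [s])) (cls w)"
      using Cons w by (simp add: f.act_closed cls_simps)
    also have "\<dots> = f z (cls (s # w))"
      using Cons.prems w f.act_mult[of z "cls [s]" "cls w"] by (simp add: cls_simps)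
    finally show ?case .
  qed
qed

lemma regular_action: "right_action G (carrier G) (\<otimes>\<^bsub>G\<^esub>)"
  by unfold_locales (auto simp: G.m_assoc)

lemma coset_action:
  assumes "subgroup H G"
  shows "right_action G (rcosets\<^bsub>G\<^esub> H) (r_coset G)"
proof unfold_locales
  have H: "H \<subseteq> carrier G" using assms by (rule subgroup.subset)
  fix C k assume C: "C \<in> rcosets\<^bsub>G\<^esub> H" and k: "k \<in> carrier G"
  obtain x where x: "x \<in> carrier G" "C = H #>\<^bsub>G\<^esub> x" using C by (auto simp: RCOSETS_def)
  show "C #>\<^bsub>G\<^esub> k \<in> rcosets\<^bsub>G\<^esub> H"
    using x k H by (auto simp: RCOSETS_def G.coset_mult_assoc)
  show "C #>\<^bsub>G\<^esub> k #>\<^bsub>G\<^esub> l = C #>\<^bsub>G\<^esub> (k \<otimes>\<^bsub>G\<^esub> l)" if "l \<in> carrier G" for l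
    using x k H that by (simp add: G.coset_mult_assoc G.m_assoc)
next
  fix C assume "C \<in> rcosets\<^bsub>G\<^esub> H"
  then have "C \<subseteq> carrier G" using G.rcosets_subset_PowG[OF assms] by auto
  then show "C #>\<^bsub>G\<^esub> \<one>\<^bsub>G\<^esub> = C" by (rule G.coset_mult_one)
qed

end

section \<open>A bound for the exponent\<close>

text \<open>
  The prefixes of the words read from a point lead to the vertices of their paths.
\<close>

definition prefixes_of :: "'b list list \<Rightarrow> 'b list set" where
  "prefixes_of hs = {x. \<exists>y. x @ y \<in> set hs}"

lemma card_prefixes_of:
  "finite (prefixes_of hs)" "card (prefixes_of hs) \<le> (\<Sum>h\<leftarrow>hs. length h + 1)"
proof (induction hs)
  case (Cons h hs)
  have eq: "prefixes_of (h # hs) = (\<lambda>n. take n h) ` {..length h} \<union> prefixes_of hs"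
  proof (intro equalityI subsetI)
    fix x assume "x \<in> prefixes_of (h # hs)"
    then obtain y where "x @ y = h \<or> x \<in> prefixes_of hs" by (auto simp: prefixes_of_def)
    then show "x \<in> (\<lambda>n. take n h) ` {..length h} \<union> prefixes_of hs"
      by (auto intro!: image_eqI[of _ _ "length x"])
  next
    fix x assume "x \<in> (\<lambda>n. take n h) ` {..length h} \<union> prefixes_of hs"
    then show "x \<in> prefixes_of (h # hs)"
      by (auto simp: prefixes_of_def) (metis append_take_drop_id)
  qed
  {
    case 1
    show ?case using Cons eq by simp
  next
    case 2
    have "card (prefixes_of (h # hs)) \<le> card ((\<lambda>n. take n h) ` {..length h}) + card (prefixes_of hs)"
      unfolding eq by (rule card_Un_le)
    also have "card ((\<lambda>n. take n h) ` {..length h}) \<le> length h + 1"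
      using card_image_le[of "{..length h}" "\<lambda>n. take n h"] by simp
    finally show ?case using Cons by simp
  }
qed (simp_all add: prefixes_of_def)

context amalgam
begin

lemma syl_eq_power: "v \<approx> w \<Longrightarrow> syl_power v n \<approx> syl_power w n"
  by (induction n) (auto intro: syl_refl syl_eq_append)

lemma power_conjugate:
  assumes "u \<in> syllables" "c \<in> syllables"
  shows "syl_power (u @ c @ inv_syl u) n \<approx> u @ syl_power c n @ inv_syl u"
proof (induction n)
  case 0
  then show ?case using inv_syl_cancel'[OF assms(1)] by (simp add: syl_sym)
next
  case (Suc n)
  have *: "syl_power c n @ inv_syl u \<in> syllables" using assms power_syllables by simp
  have "syl_power (u @ c @ inv_syl u) (Suc n) \<approx> (u @ c @ inv_syl u) @ u @ syl_power c n @ inv_syl u"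
    unfolding syl_power_simps by (rule syl_eq_append[OF syl_refl Suc]) (use assms in simp)
  also have "(u @ c @ inv_syl u) @ u @ syl_power c n @ inv_syl u
      = (u @ c) @ (inv_syl u @ u) @ syl_power c n @ inv_syl u" by simp
  also have "(u @ c) @ (inv_syl u @ u) @ syl_power c n @ inv_syl u
      \<approx> (u @ c) @ [] @ syl_power c n @ inv_syl u"
    by (rule syl_eq_context[OF inv_syl_cancel]) (use assms * in auto)
  finally show ?case by simp
qed

lemma power_single:
  assumes "k \<in> carrier (K i)"
  shows "syl_power [(i, k)] n \<approx> [(i, k [^]\<^bsub>K i\<^esub> n)]"
proof (induction n)
  case 0
  then show ?case using drop_one[of "[]" "[]" i] group_K[of i] by (simp add: syl_sym)
next
  case (Suc n)
  interpret Group.group "K i" by (rule group_K)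
  have "[(i, k)] @ syl_power [(i, k)] n \<approx> [(i, k)] @ [(i, k [^]\<^bsub>K i\<^esub> n)]"
    by (rule syl_eq_append[OF syl_refl Suc]) (use assms in simp)
  also have "[(i, k)] @ [(i, k [^]\<^bsub>K i\<^esub> n)] \<approx> [(i, k \<otimes>\<^bsub>K i\<^esub> k [^]\<^bsub>K i\<^esub> n)]"
    using merge[of "[]" "[]" k i "k [^]\<^bsub>K i\<^esub> n"] assms by simp
  finally show ?case using assms nat_pow_Suc2 by simp
qed

lemma run_concat_vertices:
  assumes "z \<in> V" "\<forall>w\<in>set ws. run F z w = z \<and> (\<forall>x y. w = x @ y \<longrightarrow> run F z x \<in> V)"
  shows "concat ws = x @ y \<Longrightarrow> run F z x \<in> V"
  using assms(2)
proof (induction ws arbitrary: x)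
  case Nil
  then show ?case using assms(1) by simp
next
  case (Cons w ws)
  from Cons.prems(1) consider y' where "w = x @ y'" | x' where "x = w @ x'" "concat ws = x' @ y"
    by (auto simp: append_eq_append_conv2)
  then show ?case by cases (use Cons in auto)
qed

text \<open>
  Two actions that coincide inside \<open>S\<close> read a sequence in the same way as long as the path stays in \<open>S\<close>.
\<close>

lemma run_agree:
  assumes "\<And>i z k. z \<in> S \<Longrightarrow> k \<in> carrier (K i) \<Longrightarrow> F i z k \<in> S \<Longrightarrow> F' i z k = F i z k"
    and "z \<in> S" "v \<in> syllables" "\<And>x y. v = x @ y \<Longrightarrow> run F z x \<in> S"
  shows "run F' z v = run F z v"
  using assms(2-)
proof (induction v arbitrary: z)
  case (Cons s v)
  obtain i k where s: "s = (i, k)" by (cases s)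
  have S: "F i z k \<in> S" using Cons.prems(3)[of "[s]" v] s by simp
  have "run F (F i z k) x \<in> S" if "v = x @ y" for x y
    using Cons.prems(3)[of "s # x" y] that s by simp
  then have "run F' (F i z k) v = run F (F i z k) v"
    using Cons.IH[OF S] Cons.prems(2) s by auto
  then show ?case using assms(1)[OF Cons.prems(1) _ S] Cons.prems(2) s by simp
qed simp

end

context finite_amalgam
begin

definition wpower :: "'x word \<Rightarrow> nat \<Rightarrow> 'x word" where
  "wpower w n = concat (replicate n w)"

lemma wpower_words: "w \<in> words X \<Longrightarrow> wpower w n \<in> words X"
  by (induction n) (auto simp: wpower_def)

lemma syl_wpower: "syl (wpower w n) = syl_power (syl w) n"
  by (simp add: wpower_def syl_power_def map_concat)

lemma cls_wpower: "w \<in> words X \<Longrightarrow> cls (wpower w n) = cls w [^]\<^bsub>G\<^esub> n"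
proof (induction n)
  case 0
  then show ?case by (simp add: wpower_def flip: cls_simps(2))
next
  case (Suc n)
  have "wpower w (Suc n) = w @ wpower w n" by (simp add: wpower_def)
  then show ?case using Suc cls_simps(3)[of w "wpower w n"] wpower_words[of w n]
    G.nat_pow_Suc2[of "cls w" n] cls_simps(1)[of w] by simp
qed

text \<open>
  Obtained from the action of \<open>G\<close> on itself.
\<close>

lemma syl_eq_imp_cls_eq:
  assumes "syl v \<approx> syl w" "v \<in> words X" "w \<in> words X"
  shows "cls v = cls w"
  using run_cong[OF pull_action[OF regular_action] assms(1), of "\<one>\<^bsub>G\<^esub>"] assms(2,3)
  by (simp add: run_pull[OF regular_action] cls_simps(1) del: cls_simps(2))

lemma inv_cls: "w \<in> words X \<Longrightarrow> inv\<^bsub>G\<^esub> (cls w) = cls (inv_word w)"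
  by (rule G.inv_equality) (auto simp: cls_simps word_class_eq_iff pres_eq_inv_word)

definition subgroup_of :: "'x word list \<Rightarrow> 'x word set set" where
  "subgroup_of hs = generate G (cls ` set hs)"

lemma subgroup_of_subgroup: "set hs \<subseteq> words X \<Longrightarrow> subgroup (subgroup_of hs) G"
  unfolding subgroup_of_def by (rule G.generate_is_subgroup) (auto simp: cls_simps)

lemma subgroup_of_words:
  assumes "set hs \<subseteq> words X" "c \<in> subgroup_of hs"
  shows "\<exists>ws. set ws \<subseteq> set hs \<union> inv_word ` set hs \<and> c = cls (concat ws)"
  using assms(2) unfolding subgroup_of_def
proof (induction rule: generate.induct)
  case one
  show ?case by (intro exI[of _ "[]"]) (simp add: cls_simps)
next
  case (incl c)
  then obtain h where "h \<in> set hs" "c = cls h" by blast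
  then show ?case by (intro exI[of _ "[h]"]) simp
next
  case (inv c)
  then obtain h where "h \<in> set hs" "c = cls h" by blast
  then show ?case using inv_cls[of h] assms(1) by (intro exI[of _ "[inv_word h]"]) auto
next
  case (eng c d)
  then obtain vs ws where vw: "set vs \<subseteq> set hs \<union> inv_word ` set hs" "c = cls (concat vs)"
    "set ws \<subseteq> set hs \<union> inv_word ` set hs" "d = cls (concat ws)" by blast
  have "concat us \<in> words X" if "set us \<subseteq> set hs \<union> inv_word ` set hs" for us
    using that assms(1) by (induction us) (auto simp: subset_iff)
  then show ?case using vw by (intro exI[of _ "vs @ ws"]) (auto simp: cls_simps)
qed

abbreviation coset_act :: "bool \<Rightarrow> 'x word set set \<Rightarrow> 'x word set \<Rightarrow> 'x word set set" where
  "coset_act \<equiv> pull (r_coset G)"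

lemma run_coset:
  assumes "subgroup H G" "w \<in> words X"
  shows "run coset_act H (syl w) = H #>\<^bsub>G\<^esub> cls w" "H \<in> rcosets\<^bsub>G\<^esub> H"
proof -
  show H: "H \<in> rcosets\<^bsub>G\<^esub> H" by (rule subgroup.subgroup_in_rcosets[OF assms(1) G.group_axioms])
  show "run coset_act H (syl w) = H #>\<^bsub>G\<^esub> cls w"
    by (rule run_pull[OF coset_action[OF assms(1)] H assms(2)])
qed

lemma coset_eq_iff:
  assumes "subgroup H G" "w \<in> words X"
  shows "H #>\<^bsub>G\<^esub> cls w = H \<longleftrightarrow> cls w \<in> H"
  using G.coset_join1[of H "cls w"] G.coset_join2[of "cls w" H] subgroup.subset[OF assms(1)] assms cls_simps(1)
  by auto

text \<open>
  Reading an inverse generator follows the closed path of the generator backwards, which adds no new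
  vertices.
\<close>

lemma generator_vertices:
  assumes "set hs \<subseteq> words X" "h \<in> set hs \<union> inv_word ` set hs"
  defines "H \<equiv> subgroup_of hs"
  shows "run coset_act H (syl h) = H"
    and "syl h = x @ y \<Longrightarrow> run coset_act H x \<in> (\<lambda>x. run coset_act H (syl x)) ` prefixes_of hs"
proof -
  have H: "subgroup H G" unfolding H_def by (rule subgroup_of_subgroup[OF assms(1)])
  have h: "h \<in> words X" using assms(1,2) by auto
  have gen: "cls k \<in> H" if "k \<in> set hs" for k
    using that unfolding H_def subgroup_of_def by (auto intro: generate.incl)
  have hH: "cls h \<in> H"
    using assms(2)
  proof
    assume "h \<in> inv_word ` set hs"
    then obtain k where k: "k \<in> set hs" "h = inv_word k" by blast
    then have "cls h = inv\<^bsub>G\<^esub> (cls k)" using inv_cls assms(1) by auto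
    then show ?thesis using gen k(1) subgroup.m_inv_closed[OF H] by simp
  qed (rule gen)
  then show "run coset_act H (syl h) = H"
    using run_coset(1)[OF H h] coset_eq_iff[OF H h] by simp
  assume xy: "syl h = x @ y"
  then obtain p q where pq: "h = p @ q" "x = syl p" by (metis map_eq_append_conv)
  show "run coset_act H x \<in> (\<lambda>x. run coset_act H (syl x)) ` prefixes_of hs"
    using assms(2)
  proof
    assume "h \<in> set hs"
    then show ?thesis using pq by (auto simp: prefixes_of_def)
  next
    assume "h \<in> inv_word ` set hs"
    then obtain k where k: "k \<in> set hs" "h = inv_word k" by blast
    then have k': "k = inv_word q @ inv_word p" using pq by (metis inv_word_simps(2,3))
    have w: "p \<in> words X" "q \<in> words X" using h pq by auto
    have "pres_eq X R (inv_word q @ (inv_word p @ p) @ []) (inv_word q @ [] @ [])"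
      by (rule pres_eq_context[OF pres_eq_inv_word]) (use w in auto)
    then have "cls (k @ p) = cls (inv_word q)" using w k' by (simp add: word_class_eq_iff)
    then have "H #>\<^bsub>G\<^esub> cls (inv_word q) = (H #>\<^bsub>G\<^esub> cls k) #>\<^bsub>G\<^esub> cls p"
      using w k' cls_simps(3)[of k p] cls_simps(1) subgroup.subset[OF H] by (simp add: G.coset_mult_assoc)
    also have "H #>\<^bsub>G\<^esub> cls k = H" using coset_eq_iff[OF H] gen[OF k(1)] w k' by simp
    finally have "run coset_act H x = run coset_act H (syl (inv_word q))"
      using run_coset(1)[OF H] w pq(2) by simp
    then show ?thesis using k(1) k' by (auto simp: prefixes_of_def)
  qed
qed

text \<open>
  If the cyclic reduction \<open>c\<close> of \<open>g\<close> lies in a factor, the exponent matters only modulo the order of that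
  factor. Otherwise \<open>first_return_bound\<close> applies to the coset \<open>q = H u\<close>, with \<open>V\<close> consisting of the
  vertices on the paths of the generators and of \<open>u\<close>.
\<close>

lemma exponent_bound:
  fixes n :: nat
  assumes hs: "set hs \<subseteq> words X" and g: "g \<in> words X"
    and n: "n \<ge> 1" "cls g [^]\<^bsub>G\<^esub> n \<noteq> \<one>\<^bsub>G\<^esub>" "cls g [^]\<^bsub>G\<^esub> n \<in> subgroup_of hs"
  shows "\<exists>m\<ge>1. m \<le> card (carrier (factor True)) + card (carrier (factor False)) +
      ((\<Sum>h\<leftarrow>hs. length h + 1) + length g + 1) * card (carrier A) \<and>
    cls g [^]\<^bsub>G\<^esub> m \<noteq> \<one>\<^bsub>G\<^esub> \<and> cls g [^]\<^bsub>G\<^esub> m \<in> subgroup_of hs"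
proof -
  define H where "H = subgroup_of hs"
  have H: "subgroup H G" unfolding H_def by (rule subgroup_of_subgroup[OF hs])
  note act = pull_action[OF coset_action[OF H]]
  have HZ: "H \<in> rcosets\<^bsub>G\<^esub> H" by (rule subgroup.subgroup_in_rcosets[OF H G.group_axioms])
  obtain u c where uc: "u \<in> syllables" "c \<in> syllables" "length u \<le> length g"
    "syl g \<approx> u @ c @ inv_syl u" "length c \<le> 1 \<or> reduced c \<and> fst (last c) \<noteq> fst (hd c)"
    using cyclic_reduction[OF syl_syllables[OF g]] by auto
  have pow: "syl (wpower g m) \<approx> u @ syl_power c m @ inv_syl u" for m
    unfolding syl_wpower using syl_trans[OF syl_eq_power[OF uc(4)] power_conjugate[OF uc(1,2)]] .
  have pow_eq: "cls g [^]\<^bsub>G\<^esub> l = cls g [^]\<^bsub>G\<^esub> m" if "syl_power c l \<approx> syl_power c m" for l m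
  proof -
    have "u @ syl_power c l @ inv_syl u \<approx> u @ syl_power c m @ inv_syl u"
      by (rule syl_eq_context[OF that]) (use uc(1) in auto)
    then have "syl (wpower g l) \<approx> syl (wpower g m)"
      using pow[of l] pow[of m] syl_sym syl_trans by metis
    then show ?thesis using syl_eq_imp_cls_eq wpower_words[OF g] cls_wpower[OF g] by metis
  qed
  consider (trivial) "c = []" | (elliptic) i k where "c = [(i, k)]"
    | (hyperbolic) "cyclically_reduced c"
    using uc(5) by (cases c rule: list.exhaust; cases "tl c") (auto simp: cyclically_reduced_def)
  then show ?thesis
  proof cases
    case trivial
    then have "syl_power c n \<approx> syl_power c 0" by (simp add: syl_power_def syl_refl)
    then show ?thesis using pow_eq[of n 0] n(2) by simp
  next
    case (elliptic i k)
    interpret F: Group.group "factor i" by (rule group_K)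
    have k: "k \<in> carrier (factor i)" using uc(2) elliptic by simp
    let ?N = "order (factor i)"
    \<comment> \<open>Reducing the exponent modulo the order of the factor does not change the power.\<close>
    let ?m = "n mod ?N"
    have N: "?N > 0" using finite_K F.order_gt_0_iff_finite by blast
    have "k [^]\<^bsub>factor i\<^esub> n = k [^]\<^bsub>factor i\<^esub> (?N * (n div ?N) + ?m)" by simp
    also have "\<dots> = (k [^]\<^bsub>factor i\<^esub> ?N) [^]\<^bsub>factor i\<^esub> (n div ?N) \<otimes>\<^bsub>factor i\<^esub> k [^]\<^bsub>factor i\<^esub> ?m"
      by (simp only: F.nat_pow_mult[OF k] F.nat_pow_pow[OF k])
    also have "\<dots> = k [^]\<^bsub>factor i\<^esub> ?m" using k by (simp add: F.pow_order_eq_1)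
    finally have "syl_power c n \<approx> [(i, k [^]\<^bsub>factor i\<^esub> ?m)]"
      using power_single[OF k, of n] elliptic by simp
    also have "[(i, k [^]\<^bsub>factor i\<^esub> ?m)] \<approx> syl_power c ?m"
      using syl_sym[OF power_single[OF k]] elliptic by simp
    finally have eq: "cls g [^]\<^bsub>G\<^esub> n = cls g [^]\<^bsub>G\<^esub> ?m" by (rule pow_eq)
    then have "?m \<ge> 1" using n(2) by (cases "?m") auto
    moreover have "?m \<le> card (carrier (factor True)) + card (carrier (factor False))"
      using less_imp_le[OF mod_less_divisor[OF N, of n]] unfolding order_def
      by (cases i) (auto intro: trans_le_add1 trans_le_add2)
    ultimately show ?thesis using n eq by (intro exI[of _ ?m]) auto
  next
    case hyperbolic
    define q where "q = run coset_act H u"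
    have qZ: "q \<in> rcosets\<^bsub>G\<^esub> H" unfolding q_def by (rule run_closed[OF act HZ uc(1)])
    obtain ws where ws: "set ws \<subseteq> set hs \<union> inv_word ` set hs" "cls (wpower g n) = cls (concat ws)"
      using subgroup_of_words[OF hs n(3)] cls_wpower[OF g] by auto
    have wsX: "concat ws \<in> words X"
      using ws(1) hs by (induction ws) (auto simp: subset_iff)
    \<comment> \<open>A closed path at \<open>q\<close> that first returns to the coset \<open>H\<close>, then reads generators, and comes back;
      by construction its vertices are among those of \<open>u\<close> and of the generators.\<close>
    define v where "v = inv_syl u @ syl (concat ws) @ u"
    have v: "v \<approx> syl_power c n"
    proof -
      have "pres_eq X R (concat ws) (wpower g n)"
        using ws(2) wsX wpower_words[OF g] by (metis word_class_eq_iff)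
      then have "syl (concat ws) \<approx> u @ syl_power c n @ inv_syl u"
        using syl_cong pow syl_trans by metis
      then have "v \<approx> inv_syl u @ (u @ syl_power c n @ inv_syl u) @ u"
        unfolding v_def by (rule syl_eq_context) (use uc(1) in auto)
      also have "inv_syl u @ (u @ syl_power c n @ inv_syl u) @ u = (inv_syl u @ u) @ syl_power c n @ inv_syl u @ u"
        by simp
      also have "(inv_syl u @ u) @ syl_power c n @ inv_syl u @ u \<approx> [] @ syl_power c n @ []"
        by (intro syl_eq_append inv_syl_cancel syl_refl power_syllables uc(1,2))
      finally show ?thesis by simp
    qed
    have unwind: "run coset_act q (inv_syl u) = H"
      unfolding q_def by (rule run_inv_syl(1)[OF act HZ uc(1)])
    have loops: "\<forall>w\<in>set (map syl ws). run coset_act H w = H \<and>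
        (\<forall>x y. w = x @ y \<longrightarrow> run coset_act H x \<in> (\<lambda>x. run coset_act H (syl x)) ` prefixes_of hs)"
    proof
      fix w assume "w \<in> set (map syl ws)"
      then obtain h where h: "h \<in> set hs \<union> inv_word ` set hs" "w = syl h"
        using subsetD[OF ws(1)] by (metis (no_types) image_iff list.set_map)
      show "run coset_act H w = H \<and>
        (\<forall>x y. w = x @ y \<longrightarrow> run coset_act H x \<in> (\<lambda>x. run coset_act H (syl x)) ` prefixes_of hs)"
        using generator_vertices[OF hs h(1)] unfolding h(2) H_def by blast
    qed
    have loop: "run coset_act H (syl (concat ws)) = H"
      using ws(1) by (induction ws) (use generator_vertices(1)[OF hs] in \<open>auto simp: H_def\<close>)
    let ?V1 = "(\<lambda>x. run coset_act H (syl x)) ` prefixes_of hs"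
    let ?V2 = "run coset_act H ` prefixes_of [u]"
    let ?V = "?V1 \<union> ?V2"
    have u_pre: "run coset_act H x \<in> ?V" if "u = x @ y" for x y
      using that by (auto simp: prefixes_of_def)
    have vert: "run coset_act q x \<in> ?V" if "v = x @ y" for x y
    proof -
      from that consider y' where "inv_syl u = x @ y'"
        | x' y' where "x = inv_syl u @ x'" "syl (concat ws) = x' @ y'"
        | x' where "x = inv_syl u @ syl (concat ws) @ x'" "u = x' @ y"
        unfolding v_def by (auto simp: append_eq_append_conv2)
      then show ?thesis
      proof cases
        case 1
        \<comment> \<open>A prefix of the inverse of \<open>u\<close> leads from \<open>q\<close> back to a vertex on the path of \<open>u\<close>.\<close>
        define u1 where "u1 = take (length y') u"
        define u2 where "u2 = drop (length y') u"
        have u12: "u = u1 @ u2" by (simp add: u1_def u2_def)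
        have "inv_syl u = inv_syl u2 @ inv_syl u1"
          unfolding u12 by (simp add: inv_syl_def)
        moreover have "length y' \<le> length u" using arg_cong[OF 1, of length] by simp
        then have "length (inv_syl u1) = length y'" by (simp add: u1_def)
        ultimately have "x = inv_syl u2" using 1 by simp
        then have "run coset_act q x = run coset_act H u1"
          using run_inv_syl(1)[OF act run_closed[OF act HZ, of u1], of u2] uc(1) u12 by (simp add: q_def)
        then show ?thesis using u_pre[OF u12] by simp
      next
        case 2
        have "concat (map syl ws) = x' @ y'" using 2(2) by (simp add: map_concat)
        moreover have "H \<in> ?V" using u_pre[of "[]" u] by simp
        ultimately have "run coset_act H x' \<in> ?V"
          using loops by (intro run_concat_vertices[of H ?V "map syl ws"]) auto
        then show ?thesis using 2(1) unwind by simp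
      next
        case 3
        then show ?thesis using unwind loop u_pre by simp
      qed
    qed
    have finV: "finite ?V" by (simp add: card_prefixes_of(1))
    have qv: "run coset_act q v = q"
      using unwind loop by (simp add: v_def) (simp add: q_def)
    have "\<exists>m\<ge>1. m \<le> card ?V * card (carrier A) \<and> run coset_act q (syl_power c m) = q"
      by (rule first_return_bound[OF act qZ hyperbolic v qv n(1) finV]) (rule vert)
    then obtain m where m: "m \<ge> 1" "m \<le> card ?V * card (carrier A)" "run coset_act q (syl_power c m) = q"
      by blast
    have "card ?V \<le> card ?V1 + card ?V2" by (rule card_Un_le)
    also have "\<dots> \<le> card (prefixes_of hs) + card (prefixes_of [u])"
      by (intro add_mono card_image_le card_prefixes_of)
    also have "\<dots> \<le> (\<Sum>h\<leftarrow>hs. length h + 1) + (length u + 1)"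
      using card_prefixes_of(2)[of hs] card_prefixes_of(2)[of "[u]"] by simp
    finally have "card ?V \<le> (\<Sum>h\<leftarrow>hs. length h + 1) + length g + 1" using uc(3) by simp
    then have bound: "m \<le> ((\<Sum>h\<leftarrow>hs. length h + 1) + length g + 1) * card (carrier A)"
      using m(2) mult_le_mono1 le_trans by blast
    have "run coset_act H (syl (wpower g m)) = run coset_act H (u @ syl_power c m @ inv_syl u)"
      using run_cong[OF act pow HZ] .
    also have "\<dots> = H" using m(3) unwind by (simp add: q_def)
    finally have mem: "cls g [^]\<^bsub>G\<^esub> m \<in> H"
      using run_coset(1)[OF H wpower_words[OF g]] coset_eq_iff[OF H wpower_words[OF g]] cls_wpower[OF g] by simp
    have "cls g [^]\<^bsub>G\<^esub> m \<noteq> \<one>\<^bsub>G\<^esub>"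
    proof
      assume "cls g [^]\<^bsub>G\<^esub> m = \<one>\<^bsub>G\<^esub>"
      then have "pres_eq X R (wpower g m) []"
        using cls_wpower[OF g, of m] wpower_words[OF g, of m] cls_simps(2)
        by (metis word_class_eq_iff words_Nil)
      then have "syl (wpower g m) \<approx> []" using syl_cong by fastforce
      then have "u @ syl_power c m @ inv_syl u \<approx> []" using pow syl_sym syl_trans by metis
      then have "inv_syl u @ (u @ syl_power c m @ inv_syl u) @ u \<approx> inv_syl u @ [] @ u"
        by (rule syl_eq_context) (use uc(1) in auto)
      also have "inv_syl u @ [] @ u \<approx> []" using inv_syl_cancel[OF uc(1)] by simp
      finally have "(inv_syl u @ u) @ syl_power c m @ (inv_syl u @ u) \<approx> []" by simp
      moreover have "(inv_syl u @ u) @ syl_power c m @ (inv_syl u @ u) \<approx> [] @ syl_power c m @ []"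
        by (intro syl_eq_append inv_syl_cancel syl_refl power_syllables uc(1,2))
      ultimately have "syl_power c m \<approx> []" using syl_sym syl_trans by (metis append_Nil append_Nil2)
      then show False using power_not_trivial[OF hyperbolic m(1)] by blast
    qed
    then show ?thesis using m(1) bound mem unfolding H_def by (intro exI[of _ m]) auto
  qed
qed

end

section \<open>Separating a word from a subgroup by a finite action\<close>

context finite_amalgam
begin

text \<open>
  The set \<open>R\<close> contains a relator for each pair of words representing \<open>\<phi>1 a\<close> and \<open>\<phi>2 a\<close> and is infinite in
  general. One pair for each \<open>a \<in> Y\<close> is enough, as the other words are equal to the chosen ones
  in the factors. The cancelling words \<open>x x\<^sup>-\<^sup>1\<close> are included so that one and the same test also ensures
  that opposite letters act by inverse maps.
\<close>

lemma finite_relators: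
  obtains Rs where "set Rs \<subseteq> words X" "\<And>r. r \<in> set Rs \<Longrightarrow> pres_eq X R r []"
    "\<And>x b. x \<in> X \<Longrightarrow> [(x, b), (x, \<not> b)] \<in> set Rs"
    "\<And>v w. pres_eq X R v w \<Longrightarrow> pres_eq X (set Rs) v w"
proof -
  define pick where "pick i a = (SOME u. u \<in> embedding i a)" for i a
  have pick: "pick i a \<in> embedding i a" if "a \<in> carrier A" for i a
    unfolding pick_def by (rule someI_ex[OF factor_elem_nonempty[OF \<phi>_closed[OF that]]])
  have YA: "a \<in> carrier A" if "a \<in> Y" for a using that generators_A(1) by blast
  define C where "C = (\<lambda>(x, b). [(x, b), (x, \<not> b)]) ` (X \<times> (UNIV :: bool set))"
  define T where "T = (\<lambda>a. pick True a @ inv_word (pick False a)) ` Y"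
  define S where "S = R1 \<union> R2 \<union> C \<union> T"
  have "finite Y" using finite_A generators_A(1) finite_subset by blast
  then have "finite S" using finite_presentations by (simp add: S_def C_def T_def)
  then obtain Rs where Rs: "set Rs = S" using finite_list by blast
  have TR: "T \<subseteq> R"
  proof
    fix r assume "r \<in> T"
    then obtain a where a: "a \<in> Y" "r = pick True a @ inv_word (pick False a)"
      by (auto simp: T_def)
    have "pick True a \<in> \<phi>1 a" "pick False a \<in> \<phi>2 a"
      using pick[OF YA[OF a(1)], of True] pick[OF YA[OF a(1)], of False] by (simp_all add: embedding_def)
    then show "r \<in> R" using a by (auto simp: amalgam_relators_def)
  qed
  have RX: "r \<in> words X" if "r \<in> R" for r
    using that by (cases rule: amalgam_relator_cases)
      (auto intro: words_alphabet dest: embedding_words(1)[THEN words_alphabet])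
  have rel: "pres_eq X R r []" if "r \<in> R" for r
    using pres_eq.relator[of "[]" X "[]" r R] RX[OF that] that by simp
  have S_rel: "r \<in> words X" "pres_eq X R r []" if "r \<in> S" for r
  proof -
    have "r \<in> R \<or> r \<in> C" using that TR by (auto simp: S_def amalgam_relators_def)
    then have "r \<in> words X \<and> pres_eq X R r []"
    proof
      assume "r \<in> C"
      then obtain x b where "x \<in> X" "r = [(x, b), (x, \<not> b)]" by (auto simp: C_def)
      then show ?thesis using pres_eq.cancel[of "[]" X "[]" x R b] by simp
    qed (use RX rel in blast)
    then show "r \<in> words X" "pres_eq X R r []" by auto
  qed
  have S_eq: "pres_eq X S r []" if "r \<in> S" for r
    using pres_eq.relator[of "[]" X "[]" r S] S_rel(1)[OF that] that by simp
  have factor: "pres_eq X S v w" if "factor_eq i v w" for i v w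
    using that
  proof (rule pres_eq_embed[rotated 2])
    show "alphabet i \<subseteq> X" by (auto simp: alphabet_def)
    show "pres_eq X S r []" if "r \<in> factor_relators i" for r
      using that S_eq by (auto simp: S_def factor_relators_def split: if_splits)
  qed
  have same: "pres_eq X S u (pick i a)" if "a \<in> carrier A" "u \<in> embedding i a" for i a u
  proof (rule factor)
    show "factor_eq i u (pick i a)"
      using embedding_words[OF that] embedding_words[OF that(1) pick[OF that(1)]]
      by (metis word_class_eq_iff)
  qed
  have all: "pres_eq X S v w" if "pres_eq X R v w" for v w
    using that
  proof (rule pres_eq_embed[rotated 2])
    fix r assume "r \<in> R"
    then show "pres_eq X S r []"
    proof (cases rule: amalgam_relator_cases)
      case (1 i)
      then show ?thesis using S_eq by (auto simp: S_def factor_relators_def split: if_splits)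
    next
      case (2 a u v)
      have "pres_eq X S (u @ inv_word v) (pick True a @ inv_word (pick False a))"
        by (intro pres_eq_append pres_eq_inv_cong same 2)
      moreover have "pres_eq X S (pick True a @ inv_word (pick False a)) []"
        using S_eq 2(1) by (simp add: S_def T_def)
      ultimately show ?thesis using 2(5) pres_eq.trans by blast
    qed
  qed simp
  show ?thesis
  proof (rule that[of Rs])
    show "[(x, b), (x, \<not> b)] \<in> set Rs" if "x \<in> X" for x b
      using that unfolding Rs S_def C_def by auto
  qed (use S_rel all Rs in auto)
qed

text \<open>
  The factor \<open>P\<close> makes the action free, and the third component makes the set infinite.
\<close>

lemma free_product_action:
  assumes "amalgam_action C F" "free_amalgam_action P F'"
  shows "free_amalgam_action (C \<times> P \<times> (UNIV :: nat set)) (\<lambda>i (c, p, n) k. (F i c k, F' i p k, n))"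
proof -
  have F': "amalgam_action P F'" "\<And>i. free_action (factor i) P (F' i)"
    using assms(2) by (auto simp: free_amalgam_action_def)
  note c = amalgam_actionD[OF assms(1)] and p = amalgam_actionD[OF F'(1)]
  have "free_action (factor i) (C \<times> P \<times> UNIV) (\<lambda>(c, p, n) k. (F i c k, F' i p k, n :: nat))" for i
  proof -
    interpret Group.group "factor i" by (rule group_K)
    show ?thesis
    proof unfold_locales
      fix z k
      assume z: "z \<in> C \<times> P \<times> (UNIV :: nat set)" and k: "k \<in> carrier (factor i)"
        and "(case z of (c, p, n) \<Rightarrow> \<lambda>k. (F i c k, F' i p k, n)) k = z"
      then have "fst (snd z) \<in> P" "F' i (fst (snd z)) k = fst (snd z)" by auto
      then show "k = \<one>\<^bsub>factor i\<^esub>" using k by (intro free_action.free[OF F'(2)])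
    qed (auto simp: c p)
  qed
  moreover have "F True x (embedding True a) = F False x (embedding False a)"
    if "x \<in> C" "a \<in> carrier A" for x a
    using c(4)[OF that] .
  moreover have "F' True x (embedding True a) = F' False x (embedding False a)"
    if "x \<in> P" "a \<in> carrier A" for x a
    using p(4)[OF that] .
  ultimately show ?thesis
    by (auto simp: free_amalgam_action_def amalgam_action_def free_action_def)
qed

text \<open>
  An effective form of the fact that finitely generated subgroups of \<open>G\<close> are closed in the profinite
  topology. In the product of the cosets of \<open>H\<close> with \<open>P\<close>, the fibre over the coset \<open>H\<close> is preserved
  exactly by the elements of \<open>H\<close>. The finite piece \<open>S\<close> lies over all cosets met when reading \<open>w\<close> and the
  generators, so after completion to a finite action the generators still preserve the fibre and \<open>w\<close>
  still does not. Finally the points are numbered such that the fibre becomes \<open>{0..<q}\<close>.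
\<close>

lemma separation:
  assumes hs: "set hs \<subseteq> words X" and w: "w \<in> words X" "cls w \<notin> subgroup_of hs"
    and m: "(\<Sum>h\<leftarrow>hs. length h + 1) + length w + 1 \<le> m"
  defines "q \<equiv> card (carrier (factor True)) * card (carrier (factor False))"
  defines "M \<equiv> m * (card (carrier A) * q * q)"
  obtains L where "\<And>z x b. z < M \<Longrightarrow> x \<in> X \<Longrightarrow> L z (x, b) < M"
    "\<And>z r. z < M \<Longrightarrow> pres_eq X R r [] \<Longrightarrow> foldl L z r = z"
    "\<And>z h. z < q \<Longrightarrow> h \<in> set hs \<Longrightarrow> foldl L z h < q"
    "\<exists>z<q. \<not> foldl L z w < q"
proof -
  define H where "H = subgroup_of hs"
  have H: "subgroup H G" unfolding H_def by (rule subgroup_of_subgroup[OF hs])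
  have HZ: "H \<in> rcosets\<^bsub>G\<^esub> H" by (rule subgroup.subgroup_in_rcosets[OF H G.group_axioms])
  let ?C = "rcosets\<^bsub>G\<^esub> H"
  let ?F = coset_act
  have act: "amalgam_action ?C ?F" by (rule pull_action[OF coset_action[OF H]])
  note actD = amalgam_actionD[OF act]
  obtain P :: "('x word set \<times> 'x word set) set" and FP where P: "free_amalgam_action P FP"
    "finite P" "card P = q"
    unfolding q_def by (rule finite_free_action)
  have FP: "amalgam_action P FP" using P(1) by (simp add: free_amalgam_action_def)
  have "q > 0" unfolding q_def using finite_K factor_cls_simps(1)[of "[]"] by (auto simp: card_gt_0_iff)
  then have "P \<noteq> {}" using P(3) by auto
  then obtain p0 where p0: "p0 \<in> P" by blast
  define U where "U = ?C \<times> P \<times> (UNIV :: nat set)"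
  define FU where "FU = (\<lambda>i (c, p, n :: nat) k. (?F i c k, FP i p k, n))"
  have FU: "free_amalgam_action U FU"
    unfolding U_def FU_def by (rule free_product_action[OF act P(1)])
  have run_FU: "run FU (c, p, n) v = (run ?F c v, run FP p v, n)" for c p n v
  proof (induction v arbitrary: c p)
    case (Cons s v)
    then show ?case by (cases s) (simp add: FU_def)
  qed simp
  have "infinite U"
  proof
    assume "finite U"
    then have "finite ((\<lambda>z. snd (snd z)) ` U)" by (rule finite_imageI)
    moreover have "(\<lambda>z. snd (snd z)) ` U = UNIV"
      using HZ p0 by (auto simp: U_def intro!: image_eqI[of _ _ "(H, p0, _)"])
    ultimately show False by simp
  qed
  define V where "V = (\<lambda>x. run ?F H (syl x)) ` prefixes_of (w # hs)"
  have VC: "V \<subseteq> ?C"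
  proof -
    have "x \<in> words X" if x: "x \<in> prefixes_of (w # hs)" for x
    proof -
      obtain y where "x @ y \<in> set (w # hs)" using x unfolding prefixes_of_def by blast
      then have "x @ y \<in> words X" using hs w(1) by auto
      then show ?thesis by simp
    qed
    then show ?thesis unfolding V_def using run_closed[OF act HZ] syl_syllables by blast
  qed
  have finV: "finite V" unfolding V_def by (simp add: card_prefixes_of(1))
  have "card V \<le> card (prefixes_of (w # hs))"
    unfolding V_def by (rule card_image_le[OF card_prefixes_of(1)])
  also have "\<dots> \<le> m" using card_prefixes_of(2)[of "w # hs"] m by simp
  finally have cardV: "card V \<le> m" .
  \<comment> \<open>The piece must be invariant under \<open>A\<close> for the gluing.\<close>
  define VA where "VA = (\<lambda>(c, a). ?F True c (embedding True a)) ` (V \<times> carrier A)"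
  have V_VA: "c \<in> VA" if "c \<in> V" for c
    unfolding VA_def using that VC actD(2)[of c True]
    by (intro image_eqI[of _ _ "(c, \<one>\<^bsub>A\<^esub>)"]) auto
  have VAC: "VA \<subseteq> ?C" unfolding VA_def using VC actD(1) by auto
  define S where "S = VA \<times> P \<times> {0 :: nat}"
  have S: "S \<subseteq> U" "finite S"
    using VAC finV finite_A P(2) by (auto simp: S_def U_def VA_def)
  have "card VA \<le> card V * card (carrier A)"
    unfolding VA_def using finV finite_A by (metis card_cartesian_product card_image_le finite_SigmaI)
  also have "\<dots> \<le> m * card (carrier A)" using cardV by simp
  finally have cardS: "card S \<le> m * card (carrier A) * q"
    using P(3) by (simp add: S_def card_cartesian_product)
  have S_inv: "FU True s (embedding True a) \<in> S" if sa: "s \<in> S" "a \<in> carrier A" for s a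
  proof -
    obtain c b p where s: "s = (?F True c (embedding True b), p, 0)" "c \<in> V" "b \<in> carrier A" "p \<in> P"
      using sa(1) by (auto simp: S_def VA_def)
    have "?F True (?F True c (embedding True b)) (embedding True a)
        = ?F True c (embedding True (b \<otimes>\<^bsub>A\<^esub> a))"
      using s VC that(2) actD(3)[of c "embedding True b" True "embedding True a"] by auto
    then have "?F True (?F True c (embedding True b)) (embedding True a) \<in> VA"
      unfolding VA_def using s that(2)
      by (intro image_eqI[of _ _ "(c, b \<otimes>\<^bsub>A\<^esub> a)"]) auto
    then show ?thesis using s that(2) amalgam_actionD(1)[OF FP] by (simp add: S_def FU_def)
  qed
  obtain E F' where E: "S \<subseteq> E" "finite E" "card E = (m * card (carrier A) * q) * q"
    "amalgam_action E F'"
    "\<And>i s k. s \<in> S \<Longrightarrow> k \<in> carrier (factor i) \<Longrightarrow> FU i s k \<in> S \<Longrightarrow> F' i s k = FU i s k"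
    using finite_completion[OF FU \<open>infinite U\<close> S cardS S_inv] unfolding q_def by metis
  have cardE: "card E = M" using E(3) by (simp add: M_def ac_simps)
  \<comment> \<open>The fibre over the coset \<open>H\<close>.\<close>
  define B where "B = {H} \<times> P \<times> {0 :: nat}"
  have HV: "H \<in> V"
    unfolding V_def by (intro image_eqI[of _ _ "[]"]) (auto simp: prefixes_of_def)
  have BS: "B \<subseteq> S" using V_VA[OF HV] by (auto simp: B_def S_def)
  have cardB: "card B = q" "finite B" using P(2,3) by (auto simp: B_def card_cartesian_product)
  have qM: "q \<le> M" using card_mono[OF E(2), of B] BS E(1) cardB(1) cardE by auto
  obtain \<beta>0 where \<beta>0: "bij_betw \<beta>0 B {..<q}"
    using finite_same_card_bij[of B "{..<q}"] cardB by auto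
  obtain \<beta>1 where \<beta>1: "bij_betw \<beta>1 (E - B) {q..<M}"
    using finite_same_card_bij[of "E - B" "{q..<M}"] cardB E(1,2) BS cardE
    by (auto simp: card_Diff_subset)
  define \<beta> where "\<beta> z = (if z \<in> B then \<beta>0 z else \<beta>1 z)" for z
  have \<beta>B: "bij_betw \<beta> B {..<q}"
    using \<beta>0 by (rule iffD1[OF bij_betw_cong, rotated]) (simp add: \<beta>_def)
  have \<beta>E: "bij_betw \<beta> (E - B) {q..<M}"
    using \<beta>1 by (rule iffD1[OF bij_betw_cong, rotated]) (simp add: \<beta>_def)
  have "bij_betw \<beta> (B \<union> (E - B)) ({..<q} \<union> {q..<M})"
    by (rule bij_betw_combine[OF \<beta>B \<beta>E]) auto
  moreover have "B \<union> (E - B) = E" "{..<q} \<union> {q..<M} = {..<M}" using BS E(1) qM by auto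
  ultimately have \<beta>: "bij_betw \<beta> E {..<M}" by simp
  \<comment> \<open>The numbering sends the fibre to an initial segment.\<close>
  have less_q: "\<beta> z < q \<longleftrightarrow> z \<in> B" if "z \<in> E" for z
    using that bij_betwE[OF \<beta>B] bij_betwE[OF \<beta>E] by (cases "z \<in> B") force+
  define \<gamma> where "\<gamma> = inv_into E \<beta>"
  have \<gamma>: "\<gamma> n \<in> E" "\<beta> (\<gamma> n) = n" if "n < M" for n
    using that \<beta> bij_betw_inv_into_right[OF \<beta>] bij_betwE[OF bij_betw_inv_into[OF \<beta>]]
    by (auto simp: \<gamma>_def)
  have \<gamma>\<beta>: "\<gamma> (\<beta> z) = z" "\<beta> z < M" if "z \<in> E" for z
    using that bij_betw_inv_into_left[OF \<beta>] bij_betwE[OF \<beta>] by (auto simp: \<gamma>_def)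
  define L where "L n s = \<beta> (run F' (\<gamma> n) [letter s])" for n s
  have step: "run F' z [letter (x, b)] \<in> E" if "z \<in> E" "x \<in> X" for z x b
    using run_closed[OF E(4) that(1)] letter_syllable[OF that(2)] by blast
  have foldl_L: "foldl L n v = \<beta> (run F' (\<gamma> n) (syl v))" if "v \<in> words X" "n < M" for v n
    using that
  proof (induction v arbitrary: n)
    case Nil
    then show ?case using \<gamma> by simp
  next
    case (Cons s v)
    obtain x b where s: "s = (x, b)" by (cases s)
    have "run F' (\<gamma> n) [letter s] \<in> E" using step \<gamma>(1) Cons.prems s by auto
    then have "L n s < M" "\<gamma> (L n s) = run F' (\<gamma> n) [letter s]" using \<gamma>\<beta> by (auto simp: L_def)
    moreover have "run F' (\<gamma> n) (syl (s # v)) = run F' (run F' (\<gamma> n) [letter s]) (syl v)"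
      using run_simps(3)[of F' "\<gamma> n" "[letter s]" "syl v"] by simp
    ultimately show ?case using Cons s by simp
  qed
  have vertex: "run FU (H, p, 0) x \<in> S" if h: "h \<in> set (w # hs)" and p: "p \<in> P" and x: "syl h = x @ y" for h p x y
  proof -
    obtain u v where uv: "h = u @ v" "x = syl u" using x by (metis map_eq_append_conv)
    have "h \<in> words X" using h hs w(1) by auto
    then have "x \<in> syllables" using uv syl_syllables by simp
    then have "run FP p x \<in> P" by (rule run_closed[OF FP p])
    moreover have "run ?F H x \<in> V"
      unfolding V_def using uv h by (auto simp: prefixes_of_def)
    ultimately show ?thesis using run_FU V_VA by (simp add: S_def)
  qed
  have trace: "run F' (H, p, 0) (syl h) = (H #>\<^bsub>G\<^esub> cls h, run FP p (syl h), 0)" "run FP p (syl h) \<in> P"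
    if "h \<in> set (w # hs)" "p \<in> P" for h p
  proof -
    have h: "h \<in> words X" using that(1) hs w(1) by auto
    have "run F' (H, p, 0) (syl h) = run FU (H, p, 0) (syl h)"
    proof (rule run_agree[OF E(5)])
      show "(H, p, 0) \<in> S" using that(2) BS by (auto simp: B_def)
      show "syl h \<in> syllables" by (rule syl_syllables[OF h])
    qed (use vertex[OF that] in auto)
    then show "run F' (H, p, 0) (syl h) = (H #>\<^bsub>G\<^esub> cls h, run FP p (syl h), 0)"
      using run_FU run_coset(1)[OF H h] by simp
    show "run FP p (syl h) \<in> P" by (rule run_closed[OF FP that(2) syl_syllables[OF h]])
  qed
  have BE: "B \<subseteq> E" using BS E(1) by blast
  show ?thesis
  proof (rule that[of L])
    show "L z (x, b) < M" if "z < M" "x \<in> X" for z x b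
      unfolding L_def using \<gamma>\<beta>(2) step \<gamma>(1) that by blast
    show "foldl L z r = z" if "z < M" "pres_eq X R r []" for z r
    proof -
      have "run F' (\<gamma> z) (syl r) = \<gamma> z"
        using run_cong[OF E(4) syl_cong[OF that(2)] \<gamma>(1)[OF that(1)]] by simp
      then show ?thesis using foldl_L[of r z] that \<gamma> pres_eq_in_words[OF that(2)] by simp
    qed
    show "foldl L z h < q" if zq: "z < q" and h: "h \<in> set hs" for z h
    proof -
      have zM: "z < M" using zq qM by simp
      have "\<gamma> z \<in> B" using less_q[OF \<gamma>(1)[OF zM]] \<gamma>(2)[OF zM] zq by simp
      then obtain p where p: "p \<in> P" "\<gamma> z = (H, p, 0)" by (auto simp: B_def)
      have hX: "h \<in> words X" using h hs by blast
      have "H #>\<^bsub>G\<^esub> cls h = H"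
        using run_coset(1)[OF H hX] generator_vertices(1)[OF hs] h unfolding H_def by auto
      then have "run F' (\<gamma> z) (syl h) \<in> B"
        using trace[of h p] h p by (auto simp: B_def)
      then show ?thesis unfolding foldl_L[OF hX zM] using less_q[OF subsetD[OF BE]] by blast
    qed
    have p: "(H, p0, 0) \<in> B" using p0 by (simp add: B_def)
    let ?z = "\<beta> (H, p0, 0)"
    have z: "?z < q" "\<gamma> ?z = (H, p0, 0)" using less_q[OF subsetD[OF BE p]] \<gamma>\<beta>(1)[OF subsetD[OF BE p]] p by auto
    have "H #>\<^bsub>G\<^esub> cls w \<noteq> H" using coset_eq_iff[OF H w(1)] w(2) by (simp add: H_def)
    then have "run F' (\<gamma> ?z) (syl w) \<notin> B" using trace[of w p0] p0 z(2) by (simp add: B_def)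
    moreover have "run F' (\<gamma> ?z) (syl w) \<in> E"
      using run_closed[OF E(4) _ syl_syllables[OF w(1)]] z(2) subsetD[OF BE p] by simp
    ultimately have "\<not> \<beta> (run F' (\<gamma> ?z) (syl w)) < q" using less_q by blast
    then have "\<not> foldl L ?z w < q" using foldl_L[OF w(1), of ?z] z(1) qM by simp
    then show "\<exists>z<q. \<not> foldl L z w < q" using z(1) by blast
  qed
qed

text \<open>
  The generators act injectively and map the finite set \<open>{0..<q}\<close> into itself, hence onto itself. So
  their inverses preserve it as well, and with them every element of the subgroup.
\<close>

lemma membership_invariant:
  fixes M q :: nat
  assumes hs: "set hs \<subseteq> words X" and w: "w \<in> words X" "cls w \<in> subgroup_of hs"
    and L: "\<And>z x b. z < M \<Longrightarrow> x \<in> X \<Longrightarrow> L z (x, b) < M"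
    and cancel: "\<And>x b. x \<in> X \<Longrightarrow> [(x, b), (x, \<not> b)] \<in> Rs"
    and Rs: "\<And>z r. z < M \<Longrightarrow> r \<in> Rs \<Longrightarrow> foldl L z r = z"
      "\<And>v w. pres_eq X R v w \<Longrightarrow> pres_eq X Rs v w"
    and q: "q \<le> M" "\<And>z h. z < q \<Longrightarrow> h \<in> set hs \<Longrightarrow> foldl L z h < q"
    and z: "z < q"
  shows "foldl L z w < q"
proof -
  have pres: "foldl L z u = foldl L z v" if "pres_eq X R u v" "z < M" for u v z
  proof (rule foldl_pres_eq[where Z = "{..<M}"])
    show "pres_eq X Rs u v" by (rule Rs(2)[OF that(1)])
    show "L (L z (x, b)) (x, \<not> b) = z" if "z \<in> {..<M}" "x \<in> X" for z x b
      using Rs(1)[of z "[(x, b), (x, \<not> b)]"] cancel that by simp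
  qed (use L Rs(1) that in auto)
  have inv: "foldl L z (inv_word h) < q" if z: "z < q" and h: "h \<in> set hs" for z h
  proof -
    have hX: "h \<in> words X" using h hs by blast
    have undo: "foldl L y (h @ inv_word h) = y" if "y < q" for y
      using pres[OF pres_eq_inv_word'[OF hX], of y] less_le_trans[OF that q(1)] by simp
    have "foldl L y h \<noteq> foldl L y' h" if "y < q" "y' < q" "y \<noteq> y'" for y y'
    proof -
      have "foldl L y (h @ inv_word h) = y" "foldl L y' (h @ inv_word h) = y'"
        using undo that(1,2) by auto
      then show ?thesis using that(3) by auto
    qed
    then have "inj_on (\<lambda>y. foldl L y h) {..<q}" by (auto simp: inj_on_def)
    moreover have "(\<lambda>y. foldl L y h) ` {..<q} \<subseteq> {..<q}" using q(2)[OF _ h] by auto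
    ultimately have "(\<lambda>y. foldl L y h) ` {..<q} = {..<q}"
      by (intro endo_inj_surj) auto
    then obtain y where y: "y < q" "z = foldl L y h" using z by (metis imageE lessThan_iff)
    then have "foldl L z (inv_word h) = foldl L y (h @ inv_word h)" by simp
    also have "\<dots> = y" by (rule undo[OF y(1)])
    finally show ?thesis using y(1) by simp
  qed
  obtain ws where ws: "set ws \<subseteq> set hs \<union> inv_word ` set hs" "cls w = cls (concat ws)"
    using subgroup_of_words[OF hs w(2)] by blast
  have "concat ws \<in> words X" using ws(1) hs by (induction ws) (auto simp: subset_iff)
  then have "pres_eq X R w (concat ws)" using ws(2) w(1) by (metis word_class_eq_iff)
  moreover have "foldl L z (concat ws) < q"
    using ws(1) z
  proof (induction ws arbitrary: z)
    case (Cons u ws)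
    then have "foldl L z u < q" using q(2) inv by auto
    then show ?case using Cons by simp
  qed simp
  ultimately show ?thesis using pres z q(1) by simp
qed

end

section \<open>The decision procedure\<close>

text \<open>
  A table for \<open>M\<close> points assigns to a point \<open>z\<close> and a letter with code \<open>l\<close> the image of \<open>z\<close> under the letter. It
  is stored as digit number \<open>l * M + z\<close> of \<open>t\<close> in base \<open>M\<close>.
\<close>

definition table_step :: "nat \<Rightarrow> nat \<Rightarrow> nat \<Rightarrow> nat \<Rightarrow> nat" where
  "table_step t M z l = (t div M ^ (l * M + z)) mod M"

definition table_run :: "nat \<Rightarrow> nat \<Rightarrow> nat \<Rightarrow> nat \<Rightarrow> nat" where
  "table_run t M z c = code_fold (table_step t M) z c"

definition table_run_power :: "nat \<Rightarrow> nat \<Rightarrow> nat \<Rightarrow> nat \<Rightarrow> nat \<Rightarrow> nat" where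
  "table_run_power t M z c n = rec_nat z (\<lambda>_ y. table_run t M y c) n"

text \<open>
  The number of points is \<open>M = (hc + n * gc + 1) * C\<close>, where \<open>hc\<close> and \<open>gc\<close> are the codes of the generators
  and of \<open>g\<close>. The codes dominate the lengths of the words, so \<open>M\<close> is at least as large as \<open>separation\<close>
  requires for \<open>g\<^sup>n\<close>. The bound \<open>k\<close> exceeds all letter codes, and \<open>rc\<close> codes a finite list of relators.
\<close>

definition in_subgroup_test :: "nat \<Rightarrow> nat \<Rightarrow> nat \<Rightarrow> nat \<Rightarrow> nat \<Rightarrow> nat \<Rightarrow> nat \<Rightarrow> bool" where
  "in_subgroup_test q C k rc hc gc n \<longleftrightarrow> (\<forall>t < ((hc + n * gc + 1) * C) ^ (k * ((hc + n * gc + 1) * C)).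
    (\<forall>z < (hc + n * gc + 1) * C. code_ball rc (\<lambda>r. table_run t ((hc + n * gc + 1) * C) z r = z)) \<and>
    (\<forall>z<q. code_ball hc (\<lambda>h. table_run t ((hc + n * gc + 1) * C) z h < q)) \<longrightarrow>
    (\<forall>z<q. table_run_power t ((hc + n * gc + 1) * C) z gc n < q))"

lemma exists_digits:
  fixes d :: "nat \<Rightarrow> nat"
  assumes "\<And>i. i < n \<Longrightarrow> d i < M"
  shows "\<exists>t<M ^ n. \<forall>i<n. (t div M ^ i) mod M = d i"
  using assms
proof (induction n)
  case 0
  show ?case by simp
next
  case (Suc n)
  then obtain t where t: "t < M ^ n" "\<forall>i<n. (t div M ^ i) mod M = d i" by auto
  have M: "M > 0" using Suc.prems[of 0] by simp
  let ?t = "t + d n * M ^ n"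
  have "d n + 1 \<le> M" using Suc.prems[of n] by simp
  then have "(d n + 1) * M ^ n \<le> M * M ^ n" by (rule mult_le_mono1)
  then have "?t < M ^ Suc n" using t(1) by simp
  moreover have "(?t div M ^ i) mod M = d i" if "i < Suc n" for i
  proof (cases "i = n")
    case True
    then show ?thesis using t(1) M Suc.prems[of n] by simp
  next
    case False
    then have "i < n" using that by simp
    then have "M ^ n = M ^ i * (M * M ^ (n - Suc i))"
      by (metis power_Suc power_add add_diff_inverse_nat Suc_diff_Suc not_less_iff_gr_or_eq)
    define e where "e = M ^ (n - Suc i) * d n"
    have "?t = t + M ^ i * (M * e)"
      using \<open>M ^ n = M ^ i * (M * M ^ (n - Suc i))\<close> by (simp only: e_def ac_simps)
    moreover have "(t + M ^ i * (M * e)) div M ^ i = M * e + t div M ^ i"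
      using M by (intro div_mult_self2) simp
    ultimately have "(?t div M ^ i) mod M = (t div M ^ i) mod M" by simp
    then show ?thesis using t(2) \<open>i < n\<close> by simp
  qed
  ultimately show ?case by blast
qed

lemma computable_table_run:
  assumes "computable n t" "computable n M" "computable n z" "computable n c"
  shows "computable n (\<lambda>xs. table_run (t xs) (M xs) (z xs) (c xs))"
  unfolding table_run_def code_fold_def table_step_def
  by (intro computable_rec computable_if decidable_eq computable_mod computable_div computable_power
      computable_add computable_mult computable_code_hd computable_code_drop computable_const
      computable_var computable_tl assms) simp_all

lemma computable_table_run_power:
  assumes "computable n t" "computable n M" "computable n z" "computable n c" "computable n k"
  shows "computable n (\<lambda>xs. table_run_power (t xs) (M xs) (z xs) (c xs) (k xs))"
  unfolding table_run_power_def
  by (intro computable_rec computable_table_run computable_var computable_tl assms) simp_all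

lemma decidable_in_subgroup_test:
  assumes "computable n hc" "computable n gc" "computable n k"
  shows "decidable n (\<lambda>xs. in_subgroup_test q C K rc (hc xs) (gc xs) (k xs))"
proof -
  have M: "computable n (\<lambda>xs. (hc xs + k xs * gc xs + 1) * C)"
    by (intro computable_add computable_mult computable_const assms)
  show ?thesis
    unfolding in_subgroup_test_def
    by (intro decidable_ball decidable_imp decidable_conj decidable_code_ball decidable_eq decidable_less
        computable_table_run computable_table_run_power computable_power computable_mult[of _ "\<lambda>_. K"]
        computable_const computable_var computable_tl assms M) simp_all
qed

text \<open>
  A power is trivial iff it lies in the subgroup generated by the empty list, whose code is \<open>0\<close>.
\<close>

definition power_test :: "nat \<Rightarrow> nat \<Rightarrow> nat \<Rightarrow> nat \<Rightarrow> nat \<Rightarrow> nat \<Rightarrow> nat \<Rightarrow> nat \<Rightarrow> bool" where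
  "power_test N a q C K rc hc gc \<longleftrightarrow> (\<exists>n < Suc (N + (hc + gc + 1) * a).
    1 \<le> n \<and> in_subgroup_test q C K rc hc gc n \<and> \<not> in_subgroup_test q C K rc 0 gc n)"

lemma decidable_power_test:
  assumes "computable n hc" "computable n gc"
  shows "decidable n (\<lambda>xs. power_test N a q C K rc (hc xs) (gc xs))"
  unfolding power_test_def
  by (intro decidable_bex decidable_conj decidable_not decidable_le decidable_in_subgroup_test
      computable_Suc computable_add computable_mult computable_const computable_var computable_tl assms) simp_all

lemma length_le_word_code: "length w \<le> word_code num w"
  using length_le_list_encode[of "map (\<lambda>(x, b). prod_encode (num x, of_bool b)) w"]
  by (simp add: word_code_def)

lemma path_length_le_list_encode:
  "(\<Sum>h\<leftarrow>hs. length h + 1) \<le> list_encode (map (word_code num) hs)"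
proof (induction hs)
  case (Cons h hs)
  let ?c = "list_encode (map (word_code num) hs)"
  have "word_code num h + ?c \<le> prod_encode (word_code num h, ?c)"
  proof -
    have "n \<le> triangle n" for n by (induction n) simp_all
    from this[of "word_code num h + ?c"] show ?thesis by (simp add: prod_encode_def)
  qed
  then show ?case using Cons length_le_word_code[of h num] by simp
qed simp

definition letter_code :: "('x \<Rightarrow> nat) \<Rightarrow> 'x \<times> bool \<Rightarrow> nat" where
  "letter_code num = (\<lambda>(x, b). prod_encode (num x, of_bool b))"

lemma table_run_word_code:
  "table_run t M z (word_code num w) = foldl (\<lambda>z s. table_step t M z (letter_code num s)) z w"
  unfolding table_run_def word_code_def code_fold_list_encode letter_code_def[symmetric]
  by (induction w arbitrary: z) auto

context finite_amalgam
begin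

lemma letter_code_inj:
  assumes "inj_on num X"
  shows "inj_on (letter_code num) (X \<times> UNIV)"
  using assms by (auto simp: inj_on_def letter_code_def)

text \<open>
  The digits are prescribed at the positions that belong to a letter and set to zero elsewhere. Different
  letters use different positions because their codes differ.
\<close>

lemma exists_table:
  assumes num: "inj_on num X"
    and K: "\<And>x b. x \<in> X \<Longrightarrow> letter_code num (x, b) < K"
    and L: "\<And>z x b. z < M \<Longrightarrow> x \<in> X \<Longrightarrow> L z (x, b) < M"
  shows "\<exists>t < M ^ (K * M). \<forall>w\<in>words X. \<forall>z<M. table_run t M z (word_code num w) = foldl L z w"
proof -
  define d where "d i = (if i div M \<in> letter_code num ` (X \<times> UNIV)
    then L (i mod M) (inv_into (X \<times> UNIV) (letter_code num) (i div M)) else 0)" for i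
  have d: "d i < M" if "i < K * M" for i
  proof -
    have M: "M > 0" using that by (cases M) auto
    show ?thesis
    proof (cases "i div M \<in> letter_code num ` (X \<times> UNIV)")
      case True
      then obtain x b where xb: "inv_into (X \<times> UNIV) (letter_code num) (i div M) = (x, b)" "x \<in> X"
        using inv_into_into[OF True] by (metis mem_Sigma_iff surj_pair)
      then show ?thesis using True L[of "i mod M" x b] M by (simp add: d_def)
    qed (simp add: d_def M)
  qed
  obtain t where t: "t < M ^ (K * M)" "\<forall>i<K * M. (t div M ^ i) mod M = d i"
    using exists_digits[of "K * M" d M] d by blast
  have step: "table_step t M z (letter_code num (x, b)) = L z (x, b)" if "z < M" "x \<in> X" for z x b
  proof -
    let ?l = "letter_code num (x, b)"
    have "?l * M + z < K * M"
    proof -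
      have "?l * M + z < (?l + 1) * M" using that(1) by simp
      also have "\<dots> \<le> K * M" using K[OF that(2), of b] by (intro mult_le_mono1) simp
      finally show ?thesis .
    qed
    moreover have "(?l * M + z) div M = ?l" "(?l * M + z) mod M = z" using that(1) by auto
    ultimately show ?thesis
      using t(2) that(2) letter_code_inj[OF num] by (simp add: table_step_def d_def)
  qed
  have "foldl (\<lambda>z s. table_step t M z (letter_code num s)) z w = foldl L z w"
    if "w \<in> words X" "z < M" for w z
    using that
  proof (induction w arbitrary: z)
    case (Cons s w)
    then show ?case using step L by (cases s) auto
  qed simp
  then show ?thesis using t(1) table_run_word_code by metis
qed

lemma table_run_power:
  "table_run_power t M z (word_code num g) n = table_run t M z (word_code num (wpower g n))"
proof -
  have "wpower g (Suc n) = wpower g n @ g" for n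
    unfolding wpower_def replicate_Suc replicate_append_same[symmetric] by simp
  moreover have "wpower g 0 = []" by (simp add: wpower_def)
  ultimately show ?thesis
    by (induction n) (simp_all add: table_run_power_def table_run_word_code)
qed

text \<open>
  Soundness of a positive answer comes from \<open>separation\<close>, applied with \<open>m\<close> equal to the number of points
  divided by \<open>C\<close>; completeness comes from \<open>membership_invariant\<close>.
\<close>

lemma in_subgroup_test_correct:
  fixes num :: "'x \<Rightarrow> nat"
  defines "q \<equiv> card (carrier (factor True)) * card (carrier (factor False))"
  assumes num: "inj_on num X"
    and K: "\<And>x b. x \<in> X \<Longrightarrow> letter_code num (x, b) < K"
    and Rs: "set Rs \<subseteq> words X" "\<And>r. r \<in> set Rs \<Longrightarrow> pres_eq X R r []"
    "\<And>x b. x \<in> X \<Longrightarrow> [(x, b), (x, \<not> b)] \<in> set Rs"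
    "\<And>v w. pres_eq X R v w \<Longrightarrow> pres_eq X (set Rs) v w"
    and hs: "set hs \<subseteq> words X" and g: "g \<in> words X"
  shows "in_subgroup_test q (card (carrier A) * q * q) K (list_encode (map (word_code num) Rs))
      (list_encode (map (word_code num) hs)) (word_code num g) n
    \<longleftrightarrow> cls g [^]\<^bsub>G\<^esub> n \<in> subgroup_of hs"
proof -
  define m where "m = list_encode (map (word_code num) hs) + n * word_code num g + 1"
  define M where "M = m * (card (carrier A) * q * q)"
  let ?w = "wpower g n"
  have w: "?w \<in> words X" by (rule wpower_words[OF g])
  let ?run = "\<lambda>t z w. table_run t M z (word_code num w)"
  have test: "in_subgroup_test q (card (carrier A) * q * q) K (list_encode (map (word_code num) Rs))
      (list_encode (map (word_code num) hs)) (word_code num g) n \<longleftrightarrow>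
    (\<forall>t < M ^ (K * M). (\<forall>z<M. \<forall>r\<in>set Rs. ?run t z r = z) \<and>
      (\<forall>z<q. \<forall>h\<in>set hs. ?run t z h < q) \<longrightarrow> (\<forall>z<q. ?run t z ?w < q))"
    unfolding in_subgroup_test_def m_def[symmetric] M_def[symmetric] code_ball_list_encode table_run_power
    by simp
  have pos: "card (carrier (factor i)) > 0" for i
    using finite_K factor_cls_simps(1)[of "[]"] by (auto simp: card_gt_0_iff)
  have "card (carrier A) > 0"
    unfolding card_gt_0_iff using finite_A A_simps(1) by blast
  moreover have qpos: "q > 0" using pos by (simp add: q_def)
  moreover have "m > 0" by (simp add: m_def)
  ultimately have "m * (card (carrier A) * q) > 0" by simp
  then have "m * (card (carrier A) * q) \<ge> 1" by linarith
  then have qM: "q \<le> M" using mult_le_mono1[of 1 "m * (card (carrier A) * q)" q] by (simp add: M_def ac_simps)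
  show ?thesis
  proof
    assume mem: "cls g [^]\<^bsub>G\<^esub> n \<in> subgroup_of hs"
    show "in_subgroup_test q (card (carrier A) * q * q) K (list_encode (map (word_code num) Rs))
      (list_encode (map (word_code num) hs)) (word_code num g) n"
      unfolding test
    proof (intro allI impI; elim conjE)
      fix t z
      assume rel: "\<forall>z<M. \<forall>r\<in>set Rs. ?run t z r = z" and gen: "\<forall>z<q. \<forall>h\<in>set hs. ?run t z h < q"
        and z: "z < q"
      have "M > 0" using qM qpos by simp
      show "?run t z ?w < q"
        unfolding table_run_word_code
      proof (rule membership_invariant[where M = M and Rs = "set Rs", OF hs w])
        show "cls ?w \<in> subgroup_of hs" using mem cls_wpower[OF g] by simp
        show "table_step t M z (letter_code num (x, b)) < M" for z x b
          using \<open>M > 0\<close> by (simp add: table_step_def)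
      qed (use rel gen qM z Rs table_run_word_code[of t M _ num] in auto)
    qed
  next
    assume yes: "in_subgroup_test q (card (carrier A) * q * q) K (list_encode (map (word_code num) Rs))
      (list_encode (map (word_code num) hs)) (word_code num g) n"
    show "cls g [^]\<^bsub>G\<^esub> n \<in> subgroup_of hs"
    proof (rule ccontr)
      assume "cls g [^]\<^bsub>G\<^esub> n \<notin> subgroup_of hs"
      then have nin: "cls ?w \<notin> subgroup_of hs" using cls_wpower[OF g] by simp
      have "length ?w = n * length g" by (induction n) (simp_all add: wpower_def)
      also have "\<dots> \<le> n * word_code num g" using length_le_word_code[of g num] by simp
      finally have "(\<Sum>h\<leftarrow>hs. length h + 1) + length ?w + 1 \<le> m"
        using path_length_le_list_encode[of hs num] by (simp add: m_def)
      then obtain L where L: "\<And>z x b. z < M \<Longrightarrow> x \<in> X \<Longrightarrow> L z (x, b) < M"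
        "\<And>z r. z < M \<Longrightarrow> pres_eq X R r [] \<Longrightarrow> foldl L z r = z"
        "\<And>z h. z < q \<Longrightarrow> h \<in> set hs \<Longrightarrow> foldl L z h < q"
        "\<exists>z<q. \<not> foldl L z ?w < q"
        unfolding M_def q_def by (rule separation[OF hs w nin]) blast
      obtain t where t: "t < M ^ (K * M)" "\<forall>w\<in>words X. \<forall>z<M. ?run t z w = foldl L z w"
        using exists_table[where L = L and M = M and K = K, OF num K L(1)] by blast
      have "\<forall>z<M. \<forall>r\<in>set Rs. ?run t z r = z" using t(2) L(2) Rs(1,2) by (auto simp: subset_iff)
      moreover have "\<forall>z<q. \<forall>h\<in>set hs. ?run t z h < q" using t(2) L(3) hs qM by (auto simp: subset_iff)
      moreover have "\<exists>z<q. \<not> ?run t z ?w < q" using t(2) L(4) w qM by auto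
      ultimately show False using yes t(1) unfolding test by blast
    qed
  qed
qed

lemma power_problem_decidable:
  assumes num: "inj_on num X"
  shows "\<exists>p. \<forall>hs g. set hs \<subseteq> words X \<and> g \<in> words X \<longrightarrow>
    evals p [list_encode (map (word_code num) hs), word_code num g]
      (of_bool (\<exists>n::nat. n \<ge> 1 \<and> cls g [^]\<^bsub>G\<^esub> n \<noteq> \<one>\<^bsub>G\<^esub> \<and> cls g [^]\<^bsub>G\<^esub> n \<in> subgroup_of hs))"
proof -
  obtain Rs where Rs: "set Rs \<subseteq> words X" "\<And>r. r \<in> set Rs \<Longrightarrow> pres_eq X R r []"
    "\<And>x b. x \<in> X \<Longrightarrow> [(x, b), (x, \<not> b)] \<in> set Rs"
    "\<And>v w. pres_eq X R v w \<Longrightarrow> pres_eq X (set Rs) v w"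
    by (rule finite_relators) blast
  define K where "K = Suc (Max (insert 0 (letter_code num ` (X \<times> UNIV))))"
  have fin: "finite (insert 0 (letter_code num ` (X \<times> UNIV)))" using finite_presentations by simp
  have K: "letter_code num (x, b) < K" if "x \<in> X" for x b
    unfolding K_def less_Suc_eq_le by (rule Max_ge[OF fin]) (use that in auto)
  define q where "q = card (carrier (factor True)) * card (carrier (factor False))"
  define N where "N = card (carrier (factor True)) + card (carrier (factor False))"
  define a where "a = card (carrier A)"
  let ?rc = "list_encode (map (word_code num) Rs)"
  let ?hc = "\<lambda>hs. list_encode (map (word_code num) hs)"
  have test: "in_subgroup_test q (a * q * q) K ?rc (?hc hs) (word_code num g) n
      \<longleftrightarrow> cls g [^]\<^bsub>G\<^esub> n \<in> subgroup_of hs" if "set hs \<subseteq> words X" "g \<in> words X" for hs g n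
    unfolding q_def a_def using in_subgroup_test_correct[OF num K Rs that] .
  have trivial: "in_subgroup_test q (a * q * q) K ?rc 0 (word_code num g) n
      \<longleftrightarrow> cls g [^]\<^bsub>G\<^esub> n = \<one>\<^bsub>G\<^esub>" if "g \<in> words X" for g n
    using test[of "[]" g n] that by (simp add: subgroup_of_def G.generate_empty)
  have correct: "power_test N a q (a * q * q) K ?rc (?hc hs) (word_code num g) \<longleftrightarrow>
      (\<exists>n::nat. n \<ge> 1 \<and> cls g [^]\<^bsub>G\<^esub> n \<noteq> \<one>\<^bsub>G\<^esub> \<and> cls g [^]\<^bsub>G\<^esub> n \<in> subgroup_of hs)"
    if hs: "set hs \<subseteq> words X" and g: "g \<in> words X" for hs g
  proof
    assume "power_test N a q (a * q * q) K ?rc (?hc hs) (word_code num g)"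
    then show "\<exists>n::nat. n \<ge> 1 \<and> cls g [^]\<^bsub>G\<^esub> n \<noteq> \<one>\<^bsub>G\<^esub> \<and> cls g [^]\<^bsub>G\<^esub> n \<in> subgroup_of hs"
      unfolding power_test_def test[OF hs g] trivial[OF g] by blast
  next
    assume "\<exists>n::nat. n \<ge> 1 \<and> cls g [^]\<^bsub>G\<^esub> n \<noteq> \<one>\<^bsub>G\<^esub> \<and> cls g [^]\<^bsub>G\<^esub> n \<in> subgroup_of hs"
    then obtain n where n: "n \<ge> 1"
      "n \<le> N + ((\<Sum>h\<leftarrow>hs. length h + 1) + length g + 1) * a"
      "cls g [^]\<^bsub>G\<^esub> n \<noteq> \<one>\<^bsub>G\<^esub>" "cls g [^]\<^bsub>G\<^esub> n \<in> subgroup_of hs"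
      unfolding N_def a_def using exponent_bound[OF hs g] by blast
    have "((\<Sum>h\<leftarrow>hs. length h + 1) + length g + 1) * a \<le> (?hc hs + word_code num g + 1) * a"
      using path_length_le_list_encode[of hs num] length_le_word_code[of g num]
      by (intro mult_le_mono1) simp
    then have "n < Suc (N + (?hc hs + word_code num g + 1) * a)"
      using n(2) by (intro le_imp_less_Suc order.trans[OF n(2)] add_left_mono)
    then show "power_test N a q (a * q * q) K ?rc (?hc hs) (word_code num g)"
      unfolding power_test_def test[OF hs g] trivial[OF g] using n by blast
  qed
  have "decidable 2 (\<lambda>xs. power_test N a q (a * q * q) K ?rc (xs ! 0) (xs ! 1))"
    by (intro decidable_power_test computable_var) simp_all
  then obtain p where p: "\<And>xs. length xs = 2 \<Longrightarrow>
      evals p xs (of_bool (power_test N a q (a * q * q) K ?rc (xs ! 0) (xs ! 1)))"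
    unfolding computable_def by blast
  show ?thesis
  proof (intro exI[of _ p] allI impI; elim conjE)
    fix hs g assume hs: "set hs \<subseteq> words X" and g: "g \<in> words X"
    show "evals p [?hc hs, word_code num g] (of_bool
      (\<exists>n::nat. n \<ge> 1 \<and> cls g [^]\<^bsub>G\<^esub> n \<noteq> \<one>\<^bsub>G\<^esub> \<and> cls g [^]\<^bsub>G\<^esub> n \<in> subgroup_of hs))"
      using p[of "[?hc hs, word_code num g]"] correct[OF hs g] by simp
  qed
qed

end

lemma normal_word_in_words:
  assumes "normal_word X1 X2 R AG w"
  shows "w \<in> words (X1 \<union> X2)"
proof -
  obtain gs where gs: "w = concat gs" "\<forall>g\<in>set gs. g \<in> words X1 \<or> g \<in> words X2"
    using assms by (auto simp: normal_word_def)
  then show ?thesis by (fastforce simp: words_def lists_eq_set)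
qed

theorem corollary8p1:
  fixes X1 X2 :: "'x set" and R1 R2 :: "'x word set"
    and A :: "('a, 'm) monoid_scheme" and Y :: "'a set"
    and \<phi>1 \<phi>2 :: "'a \<Rightarrow> 'x word set"
    and num :: "'x \<Rightarrow> nat"
    and X :: "'x set" and R :: "'x word set" and G :: "'x word set monoid"
  assumes amalgam: "finite_amalgam X1 R1 X2 R2 A Y \<phi>1 \<phi>2"
    and num: "inj_on num (X1 \<union> X2)"
    and X: "X = X1 \<union> X2"
    and R: "R = amalgam_relators R1 R2 Y \<phi>1 \<phi>2"
    and G: "G = presented_group X R"
  shows "\<exists>p. \<forall>hs g.
    set hs \<subseteq> words X \<and> normal_word X1 X2 R (amalgamated_subgroup X R A \<phi>1) g \<longrightarrow>
    evals p [list_encode (map (word_code num) hs), word_code num g]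
      (if \<exists>n::nat. n \<ge> 1 \<and> word_class X R g [^]\<^bsub>G\<^esub> n \<noteq> \<one>\<^bsub>G\<^esub> \<and>
            word_class X R g [^]\<^bsub>G\<^esub> n \<in> generate G (word_class X R ` set hs)
       then 1 else 0)"
proof -
  interpret finite_amalgam X1 R1 X2 R2 A Y \<phi>1 \<phi>2 by (rule amalgam)
  obtain p where p: "\<And>hs g. set hs \<subseteq> words (X1 \<union> X2) \<Longrightarrow> g \<in> words (X1 \<union> X2) \<Longrightarrow>
    evals p [list_encode (map (word_code num) hs), word_code num g]
      (of_bool (\<exists>n::nat. n \<ge> 1 \<and> word_class X R g [^]\<^bsub>G\<^esub> n \<noteq> \<one>\<^bsub>G\<^esub> \<and>
        word_class X R g [^]\<^bsub>G\<^esub> n \<in> generate G (word_class X R ` set hs)))"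
    using power_problem_decidable[OF num] unfolding subgroup_of_def X R G by blast
  show ?thesis
  proof (intro exI[of _ p] allI impI; elim conjE)
    fix hs g
    assume "set hs \<subseteq> words X" "normal_word X1 X2 R (amalgamated_subgroup X R A \<phi>1) g"
    then show "evals p [list_encode (map (word_code num) hs), word_code num g]
      (if \<exists>n::nat. n \<ge> 1 \<and> word_class X R g [^]\<^bsub>G\<^esub> n \<noteq> \<one>\<^bsub>G\<^esub> \<and>
            word_class X R g [^]\<^bsub>G\<^esub> n \<in> generate G (word_class X R ` set hs)
       then 1 else 0)"
      using p[of hs g] normal_word_in_words[of X1 X2 R "amalgamated_subgroup X R A \<phi>1" g] X
      unfolding of_bool_def by simp
  qed
qed

end
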